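(* Let $(X_n,M_n,V_n)$ be an adapted process with values in $E\times\mathsf M(E)\times\Sigma$ such that $\mathsf P(X_{n+1}=y\mid\mathcal F_n)=M_n(X_n,y)$ for all $y\in E$ and all $n$. Assume that: (1) the matrices $M_n$ are indecomposable, and their pseudo inverses $Q_n$ and invariant probabilities $\pi_n$ satisfy almost surely $$\lim_{n\to\infty}\frac{|Q_n|^2\log n}{n}=0,\qquad \lim_{n\to\infty}|Q_{n+1}-Q_n|=0,\qquad \lim_{n\to\infty}|\pi_{n+1}-\pi_n|=0;$$ (2) almost surely $\lim_{n\to\infty}M_{n+1}Q_{n+1}(\hat V_{n+1}-\hat V_n)=0$. Let $C\subset\Sigma\times\Sigma$ be a set adapted to $\{(v_n,\theta_n)\}$. Then, almost surely, the limit set of $(v_n)$ is an internally chain transitive set for the differential inclusion $$\dot v\in -v+C(v).$$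
   Context: $E$ is a finite set. A Markov matrix on $E$ is a map $M:E\times E\to[0,\infty)$ with $\sum_yM(x,y)=1$ for all $x$; $\mathsf M(E)$ is the set of these. $\Sigma$ is a compact convex subset of a Euclidean space with norm $\|\cdot\|$. $(\Omega,\mathcal F,\mathsf P)$ is a probability space with a filtration $(\mathcal F_n)_{n\in\mathbb N}$; adapted means $(X_n,M_n,V_n)$ is $\mathcal F_n$-measurable for each $n$. A Markov matrix acts on (possibly vector-valued) functions by $Mf(x)=\sum_yM(x,y)f(y)$, and a probability vector by $\mu f=\sum_x\mu(x)f(x)$. Points $x,y$ are related if there are $i,j\ge0$ with $M^i(x,y)>0$ and $M^j(y,x)>0$. A recurrent class of $M$ is an equivalence class $R$ of this relation which is closed ($M(x,y)=0$ for $x\in R$, $y\notin R$). $M$ is indecomposable if it has a unique recurrent class (possibly periodic). An indecomposable $M$ has a unique invariant probability $\pi$ ($\pi M=\pi$); with $\Pi(x,y)=\pi(y)$, its pseudo inverse is the unique matrix $Q$ with $Q\mathbf 1=0$ and $Q(I-M)=(I-M)Q=I-\Pi$. For a vector $f$ and matrix $N$, $|f|=\max_x|f(x)|$, $|N|=\max_{x,y}|N(x,y)|$. $v_n=\frac1n\sum_{i=1}^nV_i$. $\hat V_n:E\to\Sigma$ is an $\mathcal F_n$-measurable (random) map such that $\hat V_n(x)=\mathsf E(V_{n+1}\mathbf 1_{X_{n+1}=x}\mid\mathcal F_n)/M_n(X_n,x)$ whenever $M_n(X_n,x)\ne0$. $\theta_n=\pi_n\hat V_n=\sum_x\pi_n(x)\hat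 V_n(x)$. $C_n\subset\Sigma\times\Sigma$ is the topological support of the law of $(v_n,\theta_n)$ (smallest closed set of full probability), and $\mathsf{clos}\{C_n\}$ is the set of all limits $z=\lim_k z_{n_k}$ with $z_{n_k}\in C_{n_k}$, $n_k\to\infty$. For $C\subset\Sigma\times\Sigma$ write $C(u)=\{w\in\Sigma:(u,w)\in C\}$. $C$ is adapted to $\{(v_n,\theta_n)\}$ if: $C$ is closed and its projection to the first factor is onto $\Sigma$; $C(u)$ is nonempty and convex for every $u\in\Sigma$; and $\mathsf{clos}\{C_n\}\subset C$. A solution of $\dot v\in-v+C(v)$ is an absolutely continuous $v:\mathbb R\to\Sigma$ with $\dot v(t)+v(t)\in C(v(t))$ for almost every $t$. For $A\subset\Sigma$ and $x,y\in A$ write $x\hookrightarrow_Ay$ if for every $\varepsilon>0$, $T>0$ there are an integer $n$, solutions $\mathbf x_1,\dots,\mathbf x_n$ and reals $t_1,\dots,t_n>T$ such that $\mathbf x_i([0,t_i])\subset A$ for all $i$; $\|\mathbf x_i(t_i)-\mathbf x_{i+1}(0)\|\le\varepsilon$ for $i=1,\dots,n-1$; $\|\mathbf x_1(0)-x\|\le\varepsilon$ and $\|\mathbf x_n(t_n)-y\|\le\varepsilon$. $A$ is internally chain transitive if $A$ is compact and $x\hookrightarrow_Ay$ for all $x,y\in A$. The limit set of $(v_n)$ is the set of all $p=\lim_kv_{n_k}$ with $n_k\to\infty$. *)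

theory Defs
  imports "HOL-Probability.Probability"
begin

text \<open>
  The finite state space is a finite type \<open>'e\<close>; an element \<open>N\<close> of \<open>real^'e^'e\<close> is the matrix
  with entries \<open>N(x,y) = N $ x $ y\<close>, and an element of \<open>real^'e\<close> is a row or a column vector.
\<close>

definition markov_matrix :: "real^'e^'e \<Rightarrow> bool" where
  "markov_matrix N \<longleftrightarrow> (\<forall>x y. 0 \<le> N $ x $ y) \<and> (\<forall>x. (\<Sum>y\<in>UNIV. N $ x $ y) = 1)"

text \<open>The library operator \<open>^\<close> on this type is the entrywise power, not the matrix power.\<close>

definition mat_pow :: "real^'e^'e \<Rightarrow> nat \<Rightarrow> real^'e^'e" where
  "mat_pow N k = (((**) N) ^^ k) (mat 1)"

definition communicates :: "real^'e^'e \<Rightarrow> ('e \<times> 'e) set" where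
  "communicates N = {(x, y). (\<exists>i. mat_pow N i $ x $ y > 0) \<and> (\<exists>j. mat_pow N j $ y $ x > 0)}"

definition recurrent_class :: "real^'e^'e \<Rightarrow> 'e set \<Rightarrow> bool" where
  "recurrent_class N R \<longleftrightarrow>
     R \<in> UNIV // communicates N \<and> (\<forall>x\<in>R. \<forall>y. y \<notin> R \<longrightarrow> N $ x $ y = 0)"

definition indecomposable :: "real^'e^'e \<Rightarrow> bool" where
  "indecomposable N \<longleftrightarrow> (\<exists>!R. recurrent_class N R)"

definition invariant_prob :: "real^'e^'e \<Rightarrow> real^'e" where
  "invariant_prob N =
     (THE p. (\<forall>x. 0 \<le> p $ x) \<and> (\<Sum>x\<in>UNIV. p $ x) = 1 \<and> p v* N = p)"

text \<open>Every row of \<open>inv_projector N\<close> is the invariant probability of \<open>N\<close>.\<close>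

definition inv_projector :: "real^'e^'e \<Rightarrow> real^'e^'e" where
  "inv_projector N = (\<chi> x y. invariant_prob N $ y)"

definition pseudo_inverse :: "real^'e^'e \<Rightarrow> real^'e^'e" where
  "pseudo_inverse N =
     (THE Q. Q *v 1 = 0 \<and>
             Q ** (mat 1 - N) = mat 1 - inv_projector N \<and>
             (mat 1 - N) ** Q = mat 1 - inv_projector N)"

text \<open>The max norms; \<open>norm\<close> on \<open>real^'e\<close> and \<open>real^'e^'e\<close> would be the Euclidean one.\<close>

definition fun_norm :: "('e::finite \<Rightarrow> 'v::real_normed_vector) \<Rightarrow> real" where
  "fun_norm f = Max (range (\<lambda>x. norm (f x)))"

definition mat_norm :: "real^'e^'e \<Rightarrow> real" where
  "mat_norm N = Max (range (\<lambda>(x, y). \<bar>N $ x $ y\<bar>))"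

definition mat_act :: "real^'e^'e \<Rightarrow> ('e \<Rightarrow> 'v::real_vector) \<Rightarrow> 'e \<Rightarrow> 'v" where
  "mat_act N f x = (\<Sum>y\<in>UNIV. N $ x $ y *\<^sub>R f y)"

definition prob_act :: "real^'e \<Rightarrow> ('e \<Rightarrow> 'v::real_vector) \<Rightarrow> 'v" where
  "prob_act p f = (\<Sum>x\<in>UNIV. p $ x *\<^sub>R f x)"

text \<open>Conditional expectation of a vector-valued random variable, taken coordinatewise.\<close>

definition vec_cond_exp ::
    "'w measure \<Rightarrow> 'w measure \<Rightarrow> ('w \<Rightarrow> 'v::euclidean_space) \<Rightarrow> 'w \<Rightarrow> 'v" where
  "vec_cond_exp P G Y \<omega> = (\<Sum>b\<in>Basis. real_cond_exp P G (\<lambda>\<omega>. Y \<omega> \<bullet> b) \<omega> *\<^sub>R b)"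

text \<open>Relevant for \<open>n \<ge> 1\<close> only; at \<open>n = 0\<close> the value is the junk value \<open>0\<close>, which
  influences none of the limits below.\<close>

definition empirical_mean :: "(nat \<Rightarrow> 'w \<Rightarrow> 'v::real_vector) \<Rightarrow> nat \<Rightarrow> 'w \<Rightarrow> 'v" where
  "empirical_mean V n \<omega> = (1 / real n) *\<^sub>R (\<Sum>i=1..n. V i \<omega>)"

definition mean_drift ::
    "(nat \<Rightarrow> 'w \<Rightarrow> real^'e^'e) \<Rightarrow> (nat \<Rightarrow> 'w \<Rightarrow> 'e \<Rightarrow> 'v::real_vector) \<Rightarrow> nat \<Rightarrow> 'w \<Rightarrow> 'v" where
  "mean_drift M Vhat n \<omega> = prob_act (invariant_prob (M n \<omega>)) (Vhat n \<omega>)"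

definition topological_support :: "'a::topological_space measure \<Rightarrow> 'a set" where
  "topological_support \<mu> = \<Inter>{K. closed K \<and> (AE z in \<mu>. z \<in> K)}"

definition clos_seq :: "(nat \<Rightarrow> 'a::topological_space set) \<Rightarrow> 'a set" where
  "clos_seq D = {p. \<exists>r z. filterlim r at_top sequentially \<and>
                        (\<forall>k. z (r k) \<in> D (r k)) \<and> (\<lambda>k. z (r k)) \<longlonglongrightarrow> p}"

definition slice :: "'v set \<Rightarrow> ('v \<times> 'v) set \<Rightarrow> 'v \<Rightarrow> 'v set" where
  "slice S C u = {w\<in>S. (u, w) \<in> C}"

text \<open>\<open>adapted_set P S Z C\<close>: the closed set-valued map \<open>C\<close> on \<open>S\<close> is adapted to the sequence
  \<open>Z\<close> of \<open>S \<times> S\<close>-valued random variables on \<open>P\<close>.\<close>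

definition adapted_set ::
    "'w measure \<Rightarrow> 'v::euclidean_space set \<Rightarrow> (nat \<Rightarrow> 'w \<Rightarrow> 'v \<times> 'v) \<Rightarrow> ('v \<times> 'v) set \<Rightarrow> bool" where
  "adapted_set P S Z C \<longleftrightarrow>
     closed C \<and> fst ` C = S \<and>
     (\<forall>u\<in>S. slice S C u \<noteq> {} \<and> convex (slice S C u)) \<and>
     clos_seq (\<lambda>n. topological_support (distr P borel (Z n))) \<subseteq> C"

definition abs_continuous_on :: "real set \<Rightarrow> (real \<Rightarrow> 'v::metric_space) \<Rightarrow> bool" where
  "abs_continuous_on I f \<longleftrightarrow>
     (\<forall>\<epsilon>>0. \<exists>\<delta>>0. \<forall>D. finite D \<and>
        (\<forall>(a, b)\<in>D. a \<le> b \<and> {a..b} \<subseteq> I) \<and>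
        pairwise (\<lambda>(a, b) (c, d). {a<..<b} \<inter> {c<..<d} = {}) D \<and>
        (\<Sum>(a, b)\<in>D. b - a) < \<delta> \<longrightarrow>
        (\<Sum>(a, b)\<in>D. dist (f a) (f b)) < \<epsilon>)"

text \<open>As usual, absolute continuity on the whole line means absolute continuity on every compact
  interval.\<close>

definition inclusion_solution ::
    "'v::euclidean_space set \<Rightarrow> ('v \<times> 'v) set \<Rightarrow> (real \<Rightarrow> 'v) \<Rightarrow> bool" where
  "inclusion_solution S C v \<longleftrightarrow>
     (\<forall>t. v t \<in> S) \<and> (\<forall>a b. abs_continuous_on {a..b} v) \<and>
     (AE t in lborel. \<exists>d. (v has_vector_derivative d) (at t) \<and> d + v t \<in> slice S C (v t))"

definition chain_reachable ::
    "'v::euclidean_space set \<Rightarrow> ('v \<times> 'v) set \<Rightarrow> 'v set \<Rightarrow> 'v \<Rightarrow> 'v \<Rightarrow> bool" where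
  "chain_reachable S C A x y \<longleftrightarrow>
     (\<forall>\<epsilon>>0. \<forall>T>0. \<exists>(n::nat) (\<xi> :: nat \<Rightarrow> real \<Rightarrow> 'v) (t :: nat \<Rightarrow> real). n \<ge> 1 \<and>
        (\<forall>i\<in>{1..n}. inclusion_solution S C (\<xi> i) \<and> t i > T \<and> \<xi> i ` {0..t i} \<subseteq> A) \<and>
        (\<forall>i\<in>{1..<n}. norm (\<xi> i (t i) - \<xi> (i + 1) 0) \<le> \<epsilon>) \<and>
        norm (\<xi> 1 0 - x) \<le> \<epsilon> \<and> norm (\<xi> n (t n) - y) \<le> \<epsilon>)"

definition internally_chain_transitive ::
    "'v::euclidean_space set \<Rightarrow> ('v \<times> 'v) set \<Rightarrow> 'v set \<Rightarrow> bool" where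
  "internally_chain_transitive S C A \<longleftrightarrow>
     A \<subseteq> S \<and> compact A \<and> (\<forall>x\<in>A. \<forall>y\<in>A. chain_reachable S C A x y)"

definition limit_set :: "(nat \<Rightarrow> 'a::topological_space) \<Rightarrow> 'a set" where
  "limit_set v = {p. \<exists>r. filterlim r at_top sequentially \<and> (\<lambda>k. v (r k)) \<longlonglongrightarrow> p}"

end

theory Submission
  imports Defs "HOL-Complex_Analysis.Great_Picard" "HOL-Real_Asymp.Real_Asymp"
begin

text \<open>
  The averages \<open>v n\<close> satisfy \<open>v (n + 1) - v n = (V (n + 1) - v n) / (n + 1)\<close>, a stochastic
  approximation scheme whose noise is Markovian: \<open>V (n + 1)\<close> has conditional mean
  \<open>M n (X n, \<cdot>) Vhat n\<close>, not the stationary mean \<open>\<theta> n\<close>.  Two independent facts are combined.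

  The first is probabilistic: the noise averages out, that is, the difference between \<open>v n\<close> and
  \<open>w n = (\<theta> 0 + \<dots> + \<theta> (n - 1)) / n\<close> tends to \<open>0\<close> almost surely.  The pseudo inverse solves the
  Poisson equation: with \<open>h n = M n Q n (Vhat n)\<close> one has \<open>M n (h n) - h n = \<theta> n - M n (Vhat n)\<close>,
  so \<open>V (n + 1) - \<theta> n + h n (X (n + 1)) - h n (X n)\<close> is a martingale difference (lemma
  \<open>noise_orthogonal\<close>).  What is left of \<open>V (n + 1) - \<theta> n\<close> is a telescoping sum plus the increments
  \<open>h (n + 1) - h n\<close>, which tend to \<open>0\<close> because \<open>M Q = Q - I + \<Pi>\<close> (lemma
  \<open>norm_corrector_diff_le\<close>).  The martingale difference is not bounded, only of size \<open>1 + |Q n|\<close>.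
  The growth condition on \<open>|Q n|\<close> is exactly what an exponential inequality and the Borel-Cantelli
  lemma need for the strong law of large numbers (theorem \<open>martingale_slln\<close>).

  The second is deterministic.  The sequence \<open>w\<close> is an average of the \<open>\<theta> j\<close> without any noise, and
  it has the same limit points as \<open>v\<close>.  The curve \<open>y t\<close>, the average of the step function \<open>\<theta>\<close> over
  \<open>[0, e\<^sup>t]\<close>, interpolates \<open>w\<close> at the times \<open>ln n\<close> and is Lipschitz.  It satisfies the integrated
  form of \<open>y' = - y + \<theta>\<close>: the quotient \<open>(e\<^sup>h y (t + h) - y t) / (e\<^sup>h - 1)\<close> is the mean of \<open>\<theta>\<close> over
  \<open>[e\<^sup>t, e\<^bsup>t + h\<^esup>]\<close> (lemma \<open>log_time_average_increment\<close>).  All limit points of \<open>(w n, \<theta> n)\<close> lie in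
  the closed set \<open>C\<close>, since \<open>(v n, \<theta> n)\<close> lies almost surely in the support of its law and \<open>v n - w n\<close>
  tends to \<open>0\<close>.  For a limit
  \<open>z\<close> of time shifts of \<open>y\<close>, the mean above therefore stays close to the convex set \<open>C (z t)\<close>; letting
  \<open>h\<close> tend to \<open>0\<close> shows that \<open>z' t + z t\<close> belongs to \<open>C (z t)\<close> wherever \<open>z\<close> is differentiable, which
  is almost everywhere.  By compactness every late
  piece of \<open>y\<close> of bounded length is uniformly close to such a solution inside the limit set (lemma
  \<open>shadowed_by_solution\<close>).  Cutting \<open>y\<close> between a visit near \<open>p\<close> and a later visit near \<open>q\<close> into
  pieces of equal length then gives the chains from \<open>p\<close> to \<open>q\<close>.
\<close>

section \<open>Lipschitz curves are differentiable almost everywhere\<close>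

text \<open>
  The Stieltjes measure of \<open>F\<close> is absolutely continuous and its Radon-Nikodym density is the
  integrand.  Absolute continuity is seen without covering arguments: \<open>L t - F t\<close> is nondecreasing as
  well, and the Stieltjes measures of the two functions add up to \<open>L\<close> times Lebesgue measure.
\<close>

lemma monotone_lipschitz_is_indefinite_integral:
  fixes F :: "real \<Rightarrow> real"
  assumes mono: "\<And>x y. x \<le> y \<Longrightarrow> F x \<le> F y"
    and lip: "\<And>x y. x \<le> y \<Longrightarrow> F y - F x \<le> L * (y - x)"
  obtains g where "\<And>a b. a \<le> b \<Longrightarrow> (g has_integral (F b - F a)) {a..b}"
proof -
  have L0: "0 \<le> L" using mono[of 0 1] lip[of 0 1] by simp
  have Flip: "L-lipschitz_on UNIV F"
  proof (rule lipschitz_onI)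
    fix x y :: real show "dist (F x) (F y) \<le> L * dist x y"
      using mono[of x y] lip[of x y] mono[of y x] lip[of y x] by (cases "x \<le> y") (auto simp: dist_real_def)
  qed (use L0 in auto)
  have contF: "continuous_on UNIV F" using Flip by (rule lipschitz_on_continuous_on)
  \<comment> \<open>The complementary function, whose Stieltjes measure completes that of \<open>F\<close> to \<open>L\<close> times Lebesgue measure.\<close>
  define G where "G = (\<lambda>t. L * t - F t)"
  have monoG: "\<And>x y. x \<le> y \<Longrightarrow> G x \<le> G y" using lip by (fastforce simp: G_def algebra_simps)
  have contG: "continuous_on UNIV G" unfolding G_def by (intro continuous_intros contF)
  have rc: "continuous (at_right a) F" "continuous (at_right a) G" for a
    using contF contG continuous_on_eq_continuous_within[of UNIV F] continuous_on_eq_continuous_within[of UNIV G]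
    by (auto intro: continuous_within_subset)
  define mu where "mu = interval_measure F"
  define nu where "nu = interval_measure G"
  define N where "N = measure_of UNIV (sets borel) (\<lambda>A. emeasure mu A + emeasure nu A)"
  have smu [simp]: "sets mu = sets borel" "sets nu = sets borel" by (auto simp: mu_def nu_def)
  have sN: "sets N = sets borel" unfolding N_def by (metis sets.sets_measure_of_eq space_borel)
  have emN: "emeasure N A = emeasure mu A + emeasure nu A" if "A \<in> sets borel" for A
    unfolding N_def
  proof (rule emeasure_measure_of_sigma)
    show "sigma_algebra UNIV (sets borel :: real set set)" using sets.sigma_algebra_axioms[of borel] by simp
    show "positive (sets borel) (\<lambda>A. emeasure mu A + emeasure nu A)" by (simp add: positive_def)
    show "countably_additive (sets borel) (\<lambda>A. emeasure mu A + emeasure nu A)"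
    proof (rule countably_additiveI)
      fix A :: "nat \<Rightarrow> real set" assume "range A \<subseteq> sets borel" "disjoint_family A" "\<Union>(range A) \<in> sets borel"
      then show "(\<Sum>i. emeasure mu (A i) + emeasure nu (A i)) = emeasure mu (\<Union>(range A)) + emeasure nu (\<Union>(range A))"
        by (simp add: suminf_add[symmetric] suminf_emeasure)
    qed
  qed fact
  have Ioc: "emeasure mu {a<..b} = ennreal (F b - F a)" "emeasure nu {a<..b} = ennreal (G b - G a)" if "a \<le> b" for a b
    unfolding mu_def nu_def using that by (simp_all add: emeasure_interval_measure_Ioc mono monoG rc)
  have Neq: "N = scale_measure (ennreal L) lborel"
  proof (rule measure_eqI_generator_eq[where E="range (\<lambda>(a, b). {a <.. b::real})" and \<Omega>=UNIV and A="\<lambda>n. {- real n <.. real n}"])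
    show "Int_stable (range (\<lambda>(a, b). {a <.. b::real}))"
      by (auto simp: Int_stable_def)
    show "emeasure N X = emeasure (scale_measure (ennreal L) lborel) X" if X: "X \<in> range (\<lambda>(a, b). {a <.. b::real})" for X
    proof -
      obtain a b where ab: "X = {a<..b}" using X by auto
      show ?thesis
      proof (cases "a \<le> b")
        case True
        then have "emeasure N X = ennreal ((F b - F a) + (G b - G a))"
          using ab mono[OF True] monoG[OF True] by (simp add: emN Ioc ennreal_plus)
        also have "(F b - F a) + (G b - G a) = L * (b - a)" by (simp add: G_def algebra_simps)
        finally show ?thesis using ab True L0 by (simp add: ennreal_mult)
      qed (use ab in \<open>simp add: emN\<close>)
    qed
    show "sets N = sigma_sets UNIV (range (\<lambda>(a, b). {a <.. b::real}))"
      by (simp add: sN borel_sigma_sets_Ioc)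
    show "sets (scale_measure (ennreal L) lborel) = sigma_sets UNIV (range (\<lambda>(a, b). {a <.. b::real}))"
      by (simp add: borel_sigma_sets_Ioc)
    show "(\<Union>i. {- real i<..real i}) = UNIV"
    proof -
      have "\<exists>i. x \<in> {- real i<..real i}" for x :: real
      proof -
        obtain i :: nat where "\<bar>x\<bar> < real i" using reals_Archimedean2 by blast
        then have "x \<in> {- real i<..real i}" by auto
        then show ?thesis by blast
      qed
      then show ?thesis by blast
    qed
    show "emeasure N {- real i<..real i} \<noteq> \<infinity>" for i
      by (simp add: emN Ioc)
  qed auto
  have ac: "absolutely_continuous lborel mu"
    unfolding absolutely_continuous_def
  proof
    fix A :: "real set" assume "A \<in> null_sets lborel"
    then have A: "A \<in> sets borel" "emeasure lborel A = 0" by auto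
    have "emeasure N A = 0" using A by (simp add: Neq)
    then show "A \<in> null_sets mu" using A emN[of A] by (auto simp: null_sets_def)
  qed
  obtain f where f [measurable]: "f \<in> borel_measurable lborel" and fd: "density lborel f = mu"
    using sigma_finite_measure.Radon_Nikodym[OF sigma_finite_lborel ac] by auto
  have nn: "(\<integral>\<^sup>+x. f x * indicator {a<..b} x \<partial>lborel) = ennreal (F b - F a)" if "a \<le> b" for a b
    using emeasure_density[OF f, of "{a<..b}"] Ioc(1)[OF that] by (simp add: fd)
  have fin: "AE x in lborel. x \<in> {- real i<..real i} \<longrightarrow> f x \<noteq> \<infinity>" for i :: nat
  proof -
    have "(\<integral>\<^sup>+x. f x * indicator {- real i<..real i} x \<partial>lborel) \<noteq> \<infinity>"
      by (subst nn) auto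
    then have "AE x in lborel. f x * indicator {- real i<..real i} x \<noteq> \<infinity>"
      by (intro nn_integral_PInf_AE) auto
    then show ?thesis by eventually_elim auto
  qed
  have fin: "AE x in lborel. f x \<noteq> \<infinity>"
  proof -
    have "AE x in lborel. \<forall>i::nat. x \<in> {- real i<..real i} \<longrightarrow> f x \<noteq> \<infinity>"
      using fin by (subst AE_all_countable) blast
    then show ?thesis
    proof eventually_elim
      case (elim x)
      obtain i :: nat where "\<bar>x\<bar> < real i" using reals_Archimedean2 by blast
      then have "x \<in> {- real i<..real i}" by auto
      then show ?case using elim by blast
    qed
  qed
  define g where "g = (\<lambda>x. enn2real (f x))"
  have "(g has_integral (F b - F a)) {a..b}" if ab: "a \<le> b" for a b
  proof -
    have "(\<integral>\<^sup>+x. ennreal (g x * indicator {a<..b} x) \<partial>lborel) = (\<integral>\<^sup>+x. f x * indicator {a<..b} x \<partial>lborel)"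
      by (intro nn_integral_cong_AE eventually_mono[OF fin]) (auto simp: g_def indicator_def less_top)
    also have "\<dots> = ennreal (F b - F a)" by (rule nn[OF ab])
    finally have "((\<lambda>x. g x * indicator {a<..b} x) has_integral (F b - F a)) UNIV"
      by (intro nn_integral_has_integral) (use mono[OF ab] in \<open>auto simp: g_def\<close>)
    then have "((\<lambda>x. if x \<in> {a<..b} then g x else 0) has_integral (F b - F a)) UNIV"
      by (rule has_integral_eq[rotated]) auto
    then have "(g has_integral (F b - F a)) {a<..b}"
      by (simp only: has_integral_restrict_UNIV)
    moreover have n1: "negligible {x \<in> {a<..b} - {a..b}. g x \<noteq> 0}"
      by (rule negligible_subset[of "{}"]) auto
    moreover have n2: "negligible {x \<in> {a..b} - {a<..b}. g x \<noteq> 0}"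
      by (rule negligible_subset[of "{a}"]) auto
    ultimately show ?thesis by (simp only: has_integral_spike_set_eq[OF n1 n2])
  qed
  then show ?thesis using that by blast
qed

lemma lipschitz_is_indefinite_integral:
  fixes f :: "real \<Rightarrow> real"
  assumes lip: "L-lipschitz_on UNIV f"
  obtains g where "\<And>a b. a \<le> b \<Longrightarrow> (g has_integral (f b - f a)) {a..b}"
proof -
  have l: "\<bar>f x - f y\<bar> \<le> L * \<bar>x - y\<bar>" for x y
    using lipschitz_onD[OF lip, of x y] by (simp add: dist_real_def)
  have 1: "f x + L * x \<le> f y + L * y" if "x \<le> y" for x y
    using l[of x y] that by (simp add: algebra_simps)
  have 2: "(f y + L * y) - (f x + L * x) \<le> (2 * L) * (y - x)" if "x \<le> y" for x y
    using l[of x y] that by (simp add: algebra_simps)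
  \<comment> \<open>Adding \<open>L t\<close> makes the function nondecreasing and at most doubles the Lipschitz constant.\<close>
  obtain g where g: "\<And>a b. a \<le> b \<Longrightarrow> (g has_integral ((f b + L * b) - (f a + L * a))) {a..b}"
    using monotone_lipschitz_is_indefinite_integral[of "\<lambda>t. f t + L * t" "2 * L"] 1 2 by blast
  have "((\<lambda>x. g x - L) has_integral (f b - f a)) {a..b}" if "a \<le> b" for a b
  proof -
    have "((\<lambda>x. L) has_integral (measure lborel (cbox a b) *\<^sub>R L)) (cbox a b)" by (rule has_integral_const)
    then have "((\<lambda>x. L) has_integral ((b - a) * L)) {a..b}" using that by simp
    from has_integral_diff[OF g[OF that] this] show ?thesis by (simp add: algebra_simps)
  qed
  then show ?thesis using that by blast
qed

text \<open>
  This is the Lebesgue differentiation theorem for intervals to the right of a point.  Intervals to the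
  left are treated by reflection in the theorem that follows.
\<close>

lemma indefinite_integral_right_derivative:
  fixes f g :: "real \<Rightarrow> real"
  assumes g: "\<And>a b. a \<le> b \<Longrightarrow> (g has_integral (f b - f a)) {a..b}"
  shows "AE x in lborel. ((\<lambda>h. (f (x + h) - f x) / h) \<longlongrightarrow> g x) (at_right 0)"
proof -
  have int: "g integrable_on cbox a b" for a b
    using g[of a b] by (cases "a \<le> b") (auto simp: integrable_on_def)
  obtain N where N: "negligible N" and d: "\<And>x e. x \<notin> N \<Longrightarrow> 0 < e \<Longrightarrow>
      \<exists>d>0. \<forall>h. 0 < h \<and> h < d \<longrightarrow> norm (integral (cbox x (x + h *\<^sub>R One)) g /\<^sub>R h ^ DIM(real) - g x) < e"
    using integrable_ccontinuous_explicit[of g, OF int] by blast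
  have "((\<lambda>h. (f (x + h) - f x) / h) \<longlongrightarrow> g x) (at_right 0)" if "x \<notin> N" for x
  proof (rule tendstoI)
    fix e :: real assume "0 < e"
    from d[OF that this] obtain d where "d > 0" and
      d: "\<And>h. 0 < h \<Longrightarrow> h < d \<Longrightarrow> norm (integral (cbox x (x + h *\<^sub>R One)) g /\<^sub>R h ^ DIM(real) - g x) < e" by blast
    have "dist ((f (x + h) - f x) / h) (g x) < e" if "0 < h" "h < d" for h
    proof -
      have "integral {x..x + h} g = f (x + h) - f x" using g[of x "x + h"] that by (simp add: integral_unique)
      then show ?thesis using d[OF that] by (simp add: dist_real_def divide_inverse mult.commute)
    qed
    then show "\<forall>\<^sub>F h in at_right 0. dist ((f (x + h) - f x) / h) (g x) < e"
      using \<open>d > 0\<close> by (auto simp: eventually_at_right_field intro!: exI[of _ d])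
  qed
  moreover have "AE x in lborel. x \<notin> N"
    using AE_not_in[of N lebesgue] N by (simp add: negligible_iff_null_sets AE_completion_iff)
  ultimately show ?thesis by (auto elim: eventually_mono)
qed

theorem lipschitz_real_differentiable_AE:
  fixes f :: "real \<Rightarrow> real"
  assumes lip: "L-lipschitz_on UNIV f"
  shows "AE x in lborel. f differentiable (at x)"
proof -
  obtain g where g: "\<And>a b. a \<le> b \<Longrightarrow> (g has_integral (f b - f a)) {a..b}"
    using lipschitz_is_indefinite_integral[OF lip] by blast
  \<comment> \<open>The left derivative of \<open>f\<close> at \<open>x\<close> is the right derivative of \<open>- f (- t)\<close> at \<open>- x\<close>; both one-sided
    derivatives are the same density \<open>g\<close>.\<close>
  have "((\<lambda>x. g (- x)) has_integral (- f (- b) - - f (- a))) {a..b}" if "a \<le> b" for a b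
    using g[of "- b" "- a"] that has_integral_reflect_real[of g "f (-a) - f (-b)" "-a" "-b"] by simp
  then have reflected: "AE x in lborel. ((\<lambda>h. (- f (- (x + h)) - - f (- x)) / h) \<longlongrightarrow> g (- x)) (at_right 0)"
    using indefinite_integral_right_derivative[of "\<lambda>x. g (- x)" "\<lambda>x. - f (- x)"] by simp
  have left: "AE x in lborel. ((\<lambda>h. (f x - f (x - h)) / h) \<longlongrightarrow> g x) (at_right 0)"
  proof -
    have "AE x in (distr lborel borel (uminus :: real \<Rightarrow> real)).
        ((\<lambda>h. (- f (- (x + h)) - - f (- x)) / h) \<longlongrightarrow> g (- x)) (at_right 0)"
      by (subst lborel_distr_uminus) (rule reflected)
    then have "AE x in lborel. ((\<lambda>h. (- f (- (- x + h)) - - f (- (- x))) / h) \<longlongrightarrow> g (- (- x))) (at_right 0)"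
      by (rule AE_distrD[rotated]) simp
    then show ?thesis by (simp add: algebra_simps)
  qed
  have "AE x in lborel. ((\<lambda>h. (f (x + h) - f x) / h) \<longlongrightarrow> g x) (at_right 0)"
    by (rule indefinite_integral_right_derivative) (rule g)
  then show ?thesis
    using left
  proof eventually_elim
    case (elim x)
    have "((\<lambda>h. (f (x + h) - f x) / h) \<longlongrightarrow> g x) (at_left 0)"
    proof -
      have "((\<lambda>h. (f x - f (x - (- h))) / (- h)) \<longlongrightarrow> g x) (at_left 0)"
        using elim(2) unfolding filterlim_at_left_to_right[of _ _ 0] by simp
      moreover have "(f x - f (x - (- h))) / (- h) = (f (x + h) - f x) / h" for h
  by (cases "h = 0") (simp_all add: field_simps)
      ultimately show ?thesis by simp
    qed
    with elim(1) have "((\<lambda>h. (f (x + h) - f x) / h) \<longlongrightarrow> g x) (at 0)"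
      by (simp add: filterlim_split_at)
    then have "(f has_field_derivative g x) (at x)" by (simp add: DERIV_def)
    then show ?case by (auto simp: real_differentiable_def)
  qed
qed

text \<open>
  Solutions of the differential inclusion arise as limits of Lipschitz curves, hence as Lipschitz curves;
  this provides their derivative.
\<close>

corollary lipschitz_vector_differentiable_AE:
  fixes f :: "real \<Rightarrow> 'v::euclidean_space"
  assumes lip: "L-lipschitz_on UNIV f"
  shows "AE x in lborel. \<exists>d. (f has_vector_derivative d) (at x)"
proof -
  have "AE x in lborel. (\<lambda>x. f x \<bullet> b) differentiable (at x)" if b: "b \<in> Basis" for b
  proof (rule lipschitz_real_differentiable_AE)
    show "L-lipschitz_on UNIV (\<lambda>x. f x \<bullet> b)"
    proof (rule lipschitz_onI)
      fix x y :: real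
      have "dist (f x \<bullet> b) (f y \<bullet> b) = \<bar>(f x - f y) \<bullet> b\<bar>" by (simp add: dist_real_def inner_diff_left)
      also have "\<dots> \<le> norm (f x - f y)" using b by (rule Basis_le_norm)
      also have "\<dots> \<le> L * dist x y" using lipschitz_onD[OF lip, of x y] by (simp add: dist_norm)
      finally show "dist (f x \<bullet> b) (f y \<bullet> b) \<le> L * dist x y" .
    qed (rule lipschitz_on_nonneg[OF lip])
  qed
  then have "AE x in lborel. \<forall>b\<in>Basis. (\<lambda>x. f x \<bullet> b) differentiable (at x)"
    by (intro AE_finite_allI) auto
  then show ?thesis
  proof eventually_elim
    case (elim x)
    then have "f differentiable (at x)"
      using differentiable_componentwise_within[of f x UNIV] by simp
    then show ?case by (auto simp: vector_derivative_works)
  qed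
qed

section \<open>Averages as a curve in logarithmic time\<close>

text \<open>
  The integral of the indicator of \<open>[0, 1]\<close> from \<open>0\<close> to \<open>s\<close>.
\<close>

definition unit_ramp :: "real \<Rightarrow> real" where
  "unit_ramp s = max 0 (min 1 s)"

text \<open>
  The integral from \<open>0\<close> to \<open>u\<close> of the step function with value \<open>\<theta> j\<close> on \<open>[j, j + 1)\<close>, written as a
  finite sum so that its increments are visibly nonnegative combinations of the \<open>\<theta> j\<close>.
\<close>

definition step_integral :: "(nat \<Rightarrow> 'v::real_vector) \<Rightarrow> real \<Rightarrow> 'v" where
  "step_integral \<theta> u = (\<Sum>j<nat \<lceil>u\<rceil>. unit_ramp (u - real j) *\<^sub>R \<theta> j)"

definition log_time_average :: "(nat \<Rightarrow> 'v::real_vector) \<Rightarrow> real \<Rightarrow> 'v" where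
  "log_time_average \<theta> t = step_integral \<theta> (exp t) /\<^sub>R exp t"

lemma step_integral_upto:
  assumes "u \<le> real N"
  shows "step_integral \<theta> u = (\<Sum>j<N. unit_ramp (u - real j) *\<^sub>R \<theta> j)"
  unfolding step_integral_def
proof (rule sum.mono_neutral_left)
  show "{..<nat \<lceil>u\<rceil>} \<subseteq> {..<N}" using assms by (auto simp: nat_less_iff ceiling_le_iff less_ceiling_iff)
  show "\<forall>i\<in>{..<N} - {..<nat \<lceil>u\<rceil>}. unit_ramp (u - real i) *\<^sub>R \<theta> i = 0"
  proof
    fix i assume "i \<in> {..<N} - {..<nat \<lceil>u\<rceil>}"
    then have "u \<le> real i" by (simp add: not_less nat_le_iff ceiling_le_iff)
    then show "unit_ramp (u - real i) *\<^sub>R \<theta> i = 0" by (simp add: unit_ramp_def)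
  qed
qed auto

lemma sum_unit_ramp:
  assumes "0 \<le> u"
  shows "(\<Sum>j<N. unit_ramp (u - real j)) = min u (real N)"
  using assms by (induction N) (auto simp: unit_ramp_def min_def max_def)

lemma step_integral_of_nat: "step_integral \<theta> (real n) = (\<Sum>j<n. \<theta> j)"
  unfolding step_integral_upto[OF order_refl]
proof (rule sum.cong)
  fix j assume "j \<in> {..<n}"
  then have "real j + 1 \<le> real n" by auto
  then show "unit_ramp (real n - real j) *\<^sub>R \<theta> j = \<theta> j"  by (simp add: unit_ramp_def)
qed simp

text \<open>
  The increment over \<open>[a, b]\<close> is a combination of the \<open>\<theta> j\<close> with nonnegative weights of sum \<open>b - a\<close>, and
  only those \<open>j\<close> contribute for which \<open>[j, j + 1]\<close> meets the interior of \<open>[a, b]\<close>.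
\<close>

lemma step_integral_average_in_convex:
  fixes \<theta> :: "nat \<Rightarrow> 'v::real_vector"
  assumes ab: "0 \<le> a" "a < b" and K: "convex K"
    and mem: "\<And>j. a < real j + 1 \<Longrightarrow> real j < b \<Longrightarrow> \<theta> j \<in> K"
  shows "(step_integral \<theta> b - step_integral \<theta> a) /\<^sub>R (b - a) \<in> K"
proof -
  obtain N :: nat where N: "b \<le> real N" using real_arch_simple by blast
  define c where "c j = unit_ramp (b - real j) - unit_ramp (a - real j)" for j
  define J where "J = {j\<in>{..<N}. a < real j + 1 \<and> real j < b}"
  have c0: "c j \<ge> 0" for j using ab by (auto simp: c_def unit_ramp_def)
  have cJ: "c j = 0" if "j \<in> {..<N} - J" for j using that ab by (auto simp: J_def c_def unit_ramp_def)
  have "(\<Sum>j<N. c j) = b - a"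
    unfolding c_def sum_subtractf using ab N by (simp add: sum_unit_ramp)
  moreover have "(\<Sum>j<N. c j) = (\<Sum>j\<in>J. c j)"
    using cJ by (intro sum.mono_neutral_right) (auto simp: J_def)
  ultimately have cs: "(\<Sum>j\<in>J. c j) = b - a" by simp
  have "step_integral \<theta> b - step_integral \<theta> a = (\<Sum>j<N. c j *\<^sub>R \<theta> j)"
    using N ab by (simp add: step_integral_upto[of _ N] c_def sum_subtractf scaleR_diff_left)
  also have "\<dots> = (\<Sum>j\<in>J. c j *\<^sub>R \<theta> j)"
    using cJ by (intro sum.mono_neutral_right) (auto simp: J_def)
  finally have eq: "(step_integral \<theta> b - step_integral \<theta> a) /\<^sub>R (b - a) = (\<Sum>j\<in>J. (c j / (b - a)) *\<^sub>R \<theta> j)"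
    by (simp add: scaleR_sum_right divide_inverse mult.commute)
  have "(\<Sum>j\<in>J. (c j / (b - a)) *\<^sub>R \<theta> j) \<in> K"
  proof (rule convex_sum)
    show "(\<Sum>j\<in>J. c j / (b - a)) = 1" using cs ab by (simp add: sum_divide_distrib[symmetric])
    show "finite J" by (simp add: J_def)
    show "c j / (b - a) \<ge> 0" if "j \<in> J" for j using c0 ab by simp
    show "\<theta> j \<in> K" if "j \<in> J" for j using that mem by (simp add: J_def)
  qed fact
  then show ?thesis by (simp only: eq)
qed

text \<open>
  The integrated form of \<open>y' = - y + \<theta>\<close>: both sides of the equation for \<open>(e\<^sup>t y t)'\<close> are integrated from
  \<open>t\<close> to \<open>t + h\<close> and divided by the length of the time interval in the variable \<open>e\<^sup>t\<close>.
\<close>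

lemma log_time_average_increment:
  fixes \<theta> :: "nat \<Rightarrow> 'v::real_vector"
  assumes h: "0 < h" and K: "convex K"
    and mem: "\<And>j. exp t < real j + 1 \<Longrightarrow> real j < exp (t + h) \<Longrightarrow> \<theta> j \<in> K"
  shows "(exp h *\<^sub>R log_time_average \<theta> (t + h) - log_time_average \<theta> t) /\<^sub>R (exp h - 1) \<in> K"
proof -
  have mean: "(step_integral \<theta> (exp (t + h)) - step_integral \<theta> (exp t)) /\<^sub>R (exp (t + h) - exp t) \<in> K"
    using h mem by (intro step_integral_average_in_convex K) auto
  have eq: "(step_integral \<theta> (exp (t + h)) - step_integral \<theta> (exp t)) /\<^sub>R (exp (t + h) - exp t)
      = (exp h *\<^sub>R log_time_average \<theta> (t + h) - log_time_average \<theta> t) /\<^sub>R (exp h - 1)"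
  proof -
    have 1: "exp (t + h) - exp t = exp t * (exp h - 1)" by (simp add: exp_add algebra_simps)
    have 2: "exp h *\<^sub>R log_time_average \<theta> (t + h) - log_time_average \<theta> t
        = inverse (exp t) *\<^sub>R (step_integral \<theta> (exp (t + h)) - step_integral \<theta> (exp t))"
      by (simp add: log_time_average_def exp_add scaleR_diff_right)
    show ?thesis unfolding 1 2 by (simp add: mult.commute)
  qed
  show ?thesis using mean by (simp only: eq)
qed

lemma log_time_average_in_convex:
  fixes \<theta> :: "nat \<Rightarrow> 'v::real_vector"
  assumes K: "convex K" and mem: "\<And>j. \<theta> j \<in> K"
  shows "log_time_average \<theta> t \<in> K"
  using step_integral_average_in_convex[OF _ _ K, of 0 "exp t" \<theta>] mem
  by (simp add: log_time_average_def step_integral_def)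

lemma log_time_average_ln:
  assumes "n \<ge> 1"
  shows "log_time_average \<theta> (ln (real n)) = (1 / real n) *\<^sub>R (\<Sum>j<n. \<theta> j)"
  using assms by (simp add: log_time_average_def step_integral_of_nat divide_inverse)

text \<open>
  The increment from \<open>t\<close> to \<open>t + h\<close> is \<open>1 - e\<^bsup>- h\<^esup>\<close> times the difference of two points of \<open>K\<close>.
\<close>

lemma log_time_average_lipschitz:
  fixes \<theta> :: "nat \<Rightarrow> 'v::real_normed_vector"
  assumes K: "convex K" and mem: "\<And>j. \<theta> j \<in> K" and D: "\<And>x y. x \<in> K \<Longrightarrow> y \<in> K \<Longrightarrow> dist x y \<le> D"
  shows "D-lipschitz_on UNIV (log_time_average \<theta>)"
proof -
  let ?y = "log_time_average \<theta>"
  have D0: "0 \<le> D" using D[OF mem[of 0] mem[of 0]] by simp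
  have *: "dist (?y (t + h)) (?y t) \<le> D * h" if h: "0 < h" for t h
  proof -
    define m where "m = (exp h *\<^sub>R ?y (t + h) - ?y t) /\<^sub>R (exp h - 1)"
    have m: "m \<in> K" unfolding m_def by (rule log_time_average_increment[OF h K mem])
    have "(exp h - 1) *\<^sub>R m = exp h *\<^sub>R ?y (t + h) - ?y t" using h by (simp add: m_def)
    then have e: "exp h *\<^sub>R (?y (t + h) - ?y t) = (exp h - 1) *\<^sub>R (m - ?y t)"
      by (simp add: algebra_simps)
    have "?y (t + h) - ?y t = (exp (- h) * exp h) *\<^sub>R (?y (t + h) - ?y t)"
      by (simp add: exp_minus)
    also have "\<dots> = exp (- h) *\<^sub>R ((exp h - 1) *\<^sub>R (m - ?y t))"
      by (simp only: scaleR_scaleR[symmetric] e)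
    also have "\<dots> = (exp (- h) * (exp h - 1)) *\<^sub>R (m - ?y t)" by simp
    also have "exp (- h) * (exp h - 1) = 1 - exp (- h)"
      by (simp add: right_diff_distrib mult_exp_exp)
    finally have "?y (t + h) - ?y t = (1 - exp (- h)) *\<^sub>R (m - ?y t)" .
    then have "dist (?y (t + h)) (?y t) = (1 - exp (- h)) * dist m (?y t)"
      using h by (simp add: dist_norm)
    also have "\<dots> \<le> h * D"
      using h exp_ge_add_one_self[of "- h"] D0
      by (intro mult_mono D m log_time_average_in_convex K mem) auto
    finally show ?thesis by (simp add: mult.commute)
  qed
  show ?thesis
  proof (rule lipschitz_onI)
    fix x y :: real
    show "dist (?y x) (?y y) \<le> D * dist x y"
    proof (cases x y rule: linorder_cases)
      case less then show ?thesis using *[of "y - x" x] by (simp add: dist_real_def dist_commute)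
    next
      case greater then show ?thesis using *[of "x - y" y] by (simp add: dist_real_def)
    qed simp
  qed (rule D0)
qed


section \<open>Limits of time shifts and internal chain transitivity\<close>

lemma limit_set_iff_frequently:
  fixes v :: "nat \<Rightarrow> 'a::metric_space"
  shows "p \<in> limit_set v \<longleftrightarrow> (\<forall>e>0. \<forall>N. \<exists>n\<ge>N. dist (v n) p < e)"
proof
  assume "p \<in> limit_set v"
  then obtain r where r: "filterlim r at_top sequentially" "(\<lambda>k. v (r k)) \<longlonglongrightarrow> p" by (auto simp: limit_set_def)
  show "\<forall>e>0. \<forall>N. \<exists>n\<ge>N. dist (v n) p < e"
  proof (intro allI impI)
    fix e :: real and N :: nat assume "e > 0"
    have "\<forall>\<^sub>F k in sequentially. r k \<ge> N" using r(1) by (simp add: filterlim_at_top)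
    moreover have "\<forall>\<^sub>F k in sequentially. dist (v (r k)) p < e" using r(2) \<open>e > 0\<close> by (rule tendstoD)
    ultimately have "\<forall>\<^sub>F k in sequentially. r k \<ge> N \<and> dist (v (r k)) p < e" by eventually_elim auto
    then obtain M where "\<forall>k\<ge>M. r k \<ge> N \<and> dist (v (r k)) p < e" unfolding eventually_sequentially by blast
    then show "\<exists>n\<ge>N. dist (v n) p < e" by blast
  qed
next
  assume *: "\<forall>e>0. \<forall>N. \<exists>n\<ge>N. dist (v n) p < e"
  then have "\<forall>k. \<exists>n. n \<ge> k \<and> dist (v n) p < inverse (real (Suc k))" by simp
  from choice[OF this] obtain r where r: "\<And>k. r k \<ge> k" "\<And>k. dist (v (r k)) p < inverse (real (Suc k))"
    by blast
  have "filterlim r at_top sequentially"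
    using r(1) by (intro filterlim_at_top_mono[OF filterlim_ident]) auto
  moreover have "(\<lambda>k. v (r k)) \<longlonglongrightarrow> p"
    by (subst tendsto_dist_iff, rule tendsto_sandwich[OF _ _ tendsto_const LIMSEQ_inverse_real_of_nat])
      (use r(2) in \<open>auto intro!: always_eventually simp: less_imp_le\<close>)
  ultimately show "p \<in> limit_set v" by (auto simp: limit_set_def)
qed

lemma closed_limit_set:
  fixes v :: "nat \<Rightarrow> 'a::metric_space"
  shows "closed (limit_set v)"
  unfolding closed_sequential_limits
proof (intro allI impI, elim conjE)
  fix x l assume x: "\<forall>n. x n \<in> limit_set v" and l: "x \<longlonglongrightarrow> l"
  show "l \<in> limit_set v"
    unfolding limit_set_iff_frequently
  proof (intro allI impI)
    fix e :: real and N :: nat assume "e > 0"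
    obtain m where m: "dist (x m) l < e / 2"
      using tendstoD[OF l, of "e / 2"] \<open>e > 0\<close> by (auto simp: eventually_sequentially)
    have "x m \<in> limit_set v" "e / 2 > 0" using x \<open>e > 0\<close> by simp_all
    then obtain n where "n \<ge> N" "dist (v n) (x m) < e / 2"
      unfolding limit_set_iff_frequently by blast
    then have "dist (v n) l < e" using m dist_triangle[of "v n" l "x m"] by linarith
    then show "\<exists>n\<ge>N. dist (v n) l < e" using \<open>n \<ge> N\<close> by blast
  qed
qed

lemma limit_set_cong:
  fixes v w :: "nat \<Rightarrow> 'a::real_normed_vector"
  assumes "(\<lambda>n. v n - w n) \<longlonglongrightarrow> 0"
  shows "limit_set v = limit_set w"
proof -
  have *: "limit_set v \<subseteq> limit_set w" if vw: "(\<lambda>n. v n - w n) \<longlonglongrightarrow> 0" for v w :: "nat \<Rightarrow> 'a"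
  proof
    fix p assume "p \<in> limit_set v"
    then obtain r where r: "filterlim r at_top sequentially" "(\<lambda>k. v (r k)) \<longlonglongrightarrow> p" by (auto simp: limit_set_def)
    have "(\<lambda>k. v (r k) - (v (r k) - w (r k))) \<longlonglongrightarrow> p - 0"
      by (intro tendsto_diff r filterlim_compose[OF vw])
    then show "p \<in> limit_set w" using r(1) by (auto simp: limit_set_def)
  qed
  show ?thesis using *[OF assms] *[of w v] tendsto_minus[OF assms] by auto
qed

lemma lipschitz_imp_abs_continuous:
  assumes lip: "D-lipschitz_on UNIV f"
  shows "abs_continuous_on I f"
  unfolding abs_continuous_on_def
proof (intro allI impI)
  fix \<epsilon> :: real assume "\<epsilon> > 0"
  have D0: "D \<ge> 0" by (rule lipschitz_on_nonneg[OF lip])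
  show "\<exists>\<delta>>0. \<forall>A. finite A \<and> (\<forall>(a, b)\<in>A. a \<le> b \<and> {a..b} \<subseteq> I) \<and>
        pairwise (\<lambda>(a, b) (c, d). {a<..<b} \<inter> {c<..<d} = {}) A \<and> (\<Sum>(a, b)\<in>A. b - a) < \<delta> \<longrightarrow>
        (\<Sum>(a, b)\<in>A. dist (f a) (f b)) < \<epsilon>"
  proof (intro exI[of _ "\<epsilon> / (D + 1)"] conjI allI impI, goal_cases)
    case 1 then show ?case using \<open>\<epsilon> > 0\<close> D0 by simp
  next
    case (2 A)
    then have A: "\<And>a b. (a, b) \<in> A \<Longrightarrow> a \<le> b" and s: "(\<Sum>(a, b)\<in>A. b - a) < \<epsilon> / (D + 1)" by auto
    have "(\<Sum>(a, b)\<in>A. dist (f a) (f b)) \<le> (\<Sum>(a, b)\<in>A. D * (b - a))"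
    proof (rule sum_mono, clarify)
      fix a b assume "(a, b) \<in> A"
      then show "dist (f a) (f b) \<le> D * (b - a)"
        using lipschitz_onD[OF lip, of a b] A[of a b] by (simp add: dist_real_def)
    qed
    also have "\<dots> = D * (\<Sum>(a, b)\<in>A. b - a)" by (simp add: sum_distrib_left case_prod_beta)
    also have "\<dots> \<le> (D + 1) * (\<Sum>(a, b)\<in>A. b - a)"
      using A by (intro mult_right_mono sum_nonneg) auto
    also have "\<dots> < \<epsilon>" using s D0 by (simp add: field_simps)
    finally show ?case .
  qed
qed

lemma closed_slice:
  assumes "closed S" "closed C"
  shows "closed (slice S C u)"
proof -
  have "slice S C u = S \<inter> Pair u -` C" by (auto simp: slice_def)
  moreover have "closed (Pair u -` C)"
    using assms(2) by (rule closed_vimage) (intro continuous_intros)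
  ultimately show ?thesis using assms(1) by auto
qed

text \<open>
  The quotient is \<open>z t\<close> plus the difference quotient of \<open>z\<close> times a factor that tends to \<open>1\<close>.
\<close>

lemma tendsto_mean_slope:
  fixes z :: "real \<Rightarrow> 'v::real_normed_vector"
  assumes "(z has_vector_derivative d) (at t)"
  shows "((\<lambda>h. (exp h *\<^sub>R z (t + h) - z t) /\<^sub>R (exp h - 1)) \<longlongrightarrow> d + z t) (at_right 0)"
proof -
  have "((\<lambda>h. norm (z (t + h) - z t - h *\<^sub>R d) / norm h) \<longlongrightarrow> 0) (at 0)"
    using assms by (simp add: has_vector_derivative_def has_derivative_at)
  then have "((\<lambda>h. dist ((z (t + h) - z t) /\<^sub>R h) d) \<longlongrightarrow> 0) (at 0)"
  proof (rule Lim_transform_eventually)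
    have "norm (z (t + h) - z t - h *\<^sub>R d) / norm h = dist ((z (t + h) - z t) /\<^sub>R h) d" if "h \<noteq> 0" for h
    proof -
      have "(z (t + h) - z t) /\<^sub>R h - d = (z (t + h) - z t - h *\<^sub>R d) /\<^sub>R h"
        using that by (simp add: scaleR_diff_right)
      then show ?thesis by (simp add: dist_norm divide_inverse mult.commute)
    qed
    then show "\<forall>\<^sub>F h in at 0. norm (z (t + h) - z t - h *\<^sub>R d) / norm h = dist ((z (t + h) - z t) /\<^sub>R h) d"
      by (simp add: eventually_at_filter)
  qed
  then have "((\<lambda>h. (z (t + h) - z t) /\<^sub>R h) \<longlongrightarrow> d) (at 0)"
    by (subst tendsto_dist_iff)
  then have s: "((\<lambda>h. (z (t + h) - z t) /\<^sub>R h) \<longlongrightarrow> d) (at_right 0)"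
    by (rule filterlim_at_split[THEN iffD1, THEN conjunct2])
  have e: "((\<lambda>h::real. exp h * h / (exp h - 1)) \<longlongrightarrow> 1) (at_right 0)"
    by real_asymp
  have "((\<lambda>h. (exp h * h / (exp h - 1)) *\<^sub>R ((z (t + h) - z t) /\<^sub>R h) + z t) \<longlongrightarrow> 1 *\<^sub>R d + z t) (at_right 0)"
    by (intro tendsto_intros e s)
  then have "((\<lambda>h. (exp h * h / (exp h - 1)) *\<^sub>R ((z (t + h) - z t) /\<^sub>R h) + z t) \<longlongrightarrow> d + z t) (at_right 0)"
    by simp
  then show ?thesis
  proof (rule Lim_transform_eventually)
    have "(exp h * h / (exp h - 1)) *\<^sub>R ((z (t + h) - z t) /\<^sub>R h) + z t =
        (exp h *\<^sub>R z (t + h) - z t) /\<^sub>R (exp h - 1)" if "0 < h" for h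
    proof -
      have 1: "exp h - 1 \<noteq> 0" using that by simp
      have "(exp h - 1) *\<^sub>R ((exp h * h / (exp h - 1)) *\<^sub>R ((z (t + h) - z t) /\<^sub>R h) + z t) =
         exp h *\<^sub>R (z (t + h) - z t) + (exp h - 1) *\<^sub>R z t"
        using that 1 by (simp add: scaleR_add_right)
      also have "\<dots> = exp h *\<^sub>R z (t + h) - z t" by (simp add: algebra_simps)
      finally show ?thesis using 1 by (metis inverse_inverse_eq pth_1 scaleR_scaleR left_inverse)
    qed
    then show "\<forall>\<^sub>F h in at_right 0. (exp h * h / (exp h - 1)) *\<^sub>R ((z (t + h) - z t) /\<^sub>R h) + z t =
        (exp h *\<^sub>R z (t + h) - z t) /\<^sub>R (exp h - 1)"
      by (simp add: eventually_at_right_less eventually_at_right_field) (metis zero_less_one)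
  qed
qed

text \<open>
  The deterministic situation on one trajectory.  The last assumption is what the adaptedness of \<open>C\<close>
  gives once \<open>v\<close> has been replaced by \<open>w\<close>.
\<close>

locale averaged_inclusion =
  fixes S :: "'v::euclidean_space set" and C :: "('v \<times> 'v) set"
    and \<theta> :: "nat \<Rightarrow> 'v" and w :: "nat \<Rightarrow> 'v"
  assumes compact_S: "compact S" and convex_S: "convex S"
    and closed_C: "closed C"
    and convex_slice: "\<And>u. u \<in> S \<Longrightarrow> convex (slice S C u)"
    and theta_S: "\<And>n. \<theta> n \<in> S"
    and w_eq: "\<And>n. w n = (1 / real n) *\<^sub>R (\<Sum>j<n. \<theta> j)"
    and limits: "\<And>r p. filterlim r at_top sequentially \<Longrightarrow> (\<lambda>k. (w (r k), \<theta> (r k))) \<longlonglongrightarrow> p \<Longrightarrow> p \<in> C"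
begin

abbreviation y where "y \<equiv> log_time_average \<theta>"

lemma y_in_S: "y t \<in> S" by (rule log_time_average_in_convex[OF convex_S theta_S])

lemma y_ln: "n \<ge> 1 \<Longrightarrow> y (ln (real n)) = w n"
  by (simp add: log_time_average_ln w_eq)

text \<open>
  Any bound on the distances in \<open>S\<close> serves as Lipschitz constant; adding \<open>1\<close> makes it positive, so that
  it can be divided by.
\<close>

definition speed where "speed = diameter S + 1"

lemma speed_pos: "0 < speed"
  using diameter_ge_0[OF compact_imp_bounded[OF compact_S]] by (simp add: speed_def)

lemma y_lipschitz: "speed-lipschitz_on UNIV y"
proof (rule log_time_average_lipschitz[OF convex_S theta_S])
  fix a b assume "a \<in> S" "b \<in> S"
  then show "dist a b \<le> speed"
    using diameter_bounded_bound[OF compact_imp_bounded[OF compact_S]] by (force simp: speed_def)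
qed

lemma y_dist: "dist (y s) (y t) \<le> speed * \<bar>s - t\<bar>"
  using lipschitz_onD[OF y_lipschitz, of s t] by (simp add: dist_real_def)

text \<open>
  Upper semicontinuity in the form in which it is used: a violating subsequence would, by compactness
  of \<open>S\<close>, have a limit point \<open>(u, q)\<close> of \<open>(w n, \<theta> n)\<close> with \<open>q\<close> away from \<open>C u\<close>.
\<close>

lemma theta_near_slice:
  assumes "\<eta> > 0"
  obtains \<rho> N where "\<rho> > 0" "\<And>n. n \<ge> N \<Longrightarrow> dist (w n) u < \<rho> \<Longrightarrow> \<exists>q\<in>slice S C u. dist (\<theta> n) q < \<eta>"
proof (rule ccontr)
  assume neg: "\<not> thesis"
  have "\<exists>n\<ge>k. dist (w n) u < inverse (real (Suc k)) \<and> (\<forall>q\<in>slice S C u. \<eta> \<le> dist (\<theta> n) q)" for k :: nat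
  proof (rule ccontr)
    assume "\<not> ?thesis"
    then have "\<And>n. n \<ge> k \<Longrightarrow> dist (w n) u < inverse (real (Suc k)) \<Longrightarrow> \<exists>q\<in>slice S C u. dist (\<theta> n) q < \<eta>"
      by (auto simp: not_le)
    then show False using neg that[of "inverse (real (Suc k))" k] by simp
  qed
  then obtain r where r: "\<And>k. r k \<ge> k" "\<And>k. dist (w (r k)) u < inverse (real (Suc k))"
    "\<And>k q. q \<in> slice S C u \<Longrightarrow> \<eta> \<le> dist (\<theta> (r k)) q" by metis
  obtain q \<sigma> where q: "q \<in> S" and \<sigma>: "strict_mono \<sigma>" and lim: "((\<lambda>k. \<theta> (r k)) \<circ> \<sigma>) \<longlonglongrightarrow> q"
    using compact_S theta_S unfolding compact_def by (metis (no_types, lifting))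
  have rt: "filterlim r at_top sequentially"
    using r(1) by (intro filterlim_at_top_mono[OF filterlim_ident]) auto
  have \<sigma>t: "filterlim \<sigma> at_top sequentially" by (rule filterlim_subseq[OF \<sigma>])
  have "(\<lambda>k. w (r k)) \<longlonglongrightarrow> u"
    by (subst tendsto_dist_iff, rule tendsto_sandwich[OF _ _ tendsto_const LIMSEQ_inverse_real_of_nat])
      (use r(2) in \<open>auto intro!: always_eventually simp: less_imp_le\<close>)
  then have "(\<lambda>k. w (r (\<sigma> k))) \<longlonglongrightarrow> u" using \<sigma>t by (rule filterlim_compose)
  then have "(\<lambda>k. (w (r (\<sigma> k)), \<theta> (r (\<sigma> k)))) \<longlonglongrightarrow> (u, q)"
    using lim by (intro tendsto_Pair) (auto simp: o_def)
  then have "(u, q) \<in> C"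
    using limits[of "\<lambda>k. r (\<sigma> k)" "(u, q)"] filterlim_compose[OF rt \<sigma>t] by auto
  then have "q \<in> slice S C u" using q by (simp add: slice_def)
  then have "\<eta> \<le> dist (\<theta> (r (\<sigma> k))) q" for k by (rule r(3))
  moreover have "\<forall>\<^sub>F k in sequentially. dist (\<theta> (r (\<sigma> k))) q < \<eta>"
    using tendstoD[OF lim \<open>\<eta> > 0\<close>] by (simp add: o_def)
  ultimately show False by (auto simp: eventually_sequentially not_less[symmetric])
qed

text \<open>
  The curve at time \<open>t\<close> is close to the sequence at the integer part of \<open>e\<^sup>t\<close>, because the curve is
  Lipschitz and the two times differ by at most \<open>t - ln (e\<^sup>t - 1)\<close>.
\<close>

lemma limit_of_translates_in_limit_set:
  assumes t: "filterlim t at_top sequentially" and z: "(\<lambda>k. y (t k + s)) \<longlonglongrightarrow> p"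
  shows "p \<in> limit_set w"
proof -
  define r where "r k = nat \<lfloor>exp (t k + s)\<rfloor>" for k
  have ts: "filterlim (\<lambda>k. t k + s) at_top sequentially"
    using filterlim_tendsto_add_at_top[OF tendsto_const t, of s] by (simp add: add.commute)
  have et: "filterlim (\<lambda>k. exp (t k + s)) at_top sequentially"
    by (rule filterlim_compose[OF exp_at_top ts])
  have rt: "filterlim r at_top sequentially"
    unfolding filterlim_at_top
  proof
    fix Z :: nat
    have "\<forall>\<^sub>F k in sequentially. real Z \<le> exp (t k + s)" using et by (simp add: filterlim_at_top)
    then show "\<forall>\<^sub>F k in sequentially. Z \<le> r k"
      by eventually_elim (simp add: r_def le_nat_floor)
  qed
  have "(\<lambda>k. speed * ((t k + s) - ln (exp (t k + s) - 1))) \<longlonglongrightarrow> speed * 0"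
  proof (intro tendsto_mult tendsto_const)
    have "((\<lambda>x::real. x - ln (exp x - 1)) \<longlongrightarrow> 0) at_top" by real_asymp
    then show "(\<lambda>k. (t k + s) - ln (exp (t k + s) - 1)) \<longlonglongrightarrow> 0" using ts by (rule filterlim_compose)
  qed
  moreover have le: "\<forall>\<^sub>F k in sequentially. dist (w (r k)) (y (t k + s)) \<le> speed * ((t k + s) - ln (exp (t k + s) - 1))"
  proof -
    have "\<forall>\<^sub>F k in sequentially. 2 \<le> exp (t k + s)" using et by (simp add: filterlim_at_top)
    then show ?thesis
    proof eventually_elim
      case (elim k)
      let ?a = "t k + s"
      have f: "0 \<le> \<lfloor>exp ?a\<rfloor>" by simp
      have 1: "real (r k) \<le> exp ?a" "exp ?a - 1 < real (r k)"
        unfolding r_def by (simp_all add: f)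
      then have 2: "r k \<ge> 1" "0 < exp ?a - 1" using elim by linarith+
      have "ln (real (r k)) \<le> ?a" using 1(1) 2 ln_mono[of "real (r k)" "exp ?a"] by simp
      moreover have "ln (exp ?a - 1) \<le> ln (real (r k))"
        by (rule ln_mono) (use 1 2 in linarith)+
      moreover have "dist (w (r k)) (y ?a) \<le> speed * \<bar>ln (real (r k)) - ?a\<bar>"
        using y_dist[of "ln (real (r k))" ?a] y_ln[OF 2(1)] by simp
      ultimately show ?case
        using mult_left_mono[of "\<bar>ln (real (r k)) - ?a\<bar>" "?a - ln (exp ?a - 1)" speed] speed_pos by linarith
    qed
  qed
  ultimately have "(\<lambda>k. dist (w (r k)) (y (t k + s))) \<longlonglongrightarrow> 0"
    by (intro tendsto_sandwich[OF _ le tendsto_const]) auto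
  then have "(\<lambda>k. w (r k) - y (t k + s)) \<longlonglongrightarrow> 0" by (simp add: dist_norm tendsto_norm_zero_iff)
  from tendsto_add[OF this z] have "(\<lambda>k. w (r k)) \<longlonglongrightarrow> p" by simp
  then show ?thesis using rt by (auto simp: limit_set_def)
qed

lemma limit_of_translates_lipschitz:
  assumes z: "\<And>s. (\<lambda>k. y (t k + s)) \<longlonglongrightarrow> z s"
  shows "speed-lipschitz_on UNIV z"
proof (rule lipschitz_onI)
  fix a b :: real
  have "(\<lambda>k. dist (y (t k + a)) (y (t k + b))) \<longlonglongrightarrow> dist (z a) (z b)" by (intro tendsto_dist z)
  then show "dist (z a) (z b) \<le> speed * dist a b"
  proof (rule tendsto_upperbound)
    have "dist (y (t k + a)) (y (t k + b)) \<le> speed * dist a b" for k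
      using y_dist[of "t k + a" "t k + b"] by (simp add: dist_real_def)
    then show "\<forall>\<^sub>F k in sequentially. dist (y (t k + a)) (y (t k + b)) \<le> speed * dist a b" by simp
  qed simp
qed (use speed_pos in simp)

lemma limit_of_translates_in_S:
  assumes z: "\<And>s. (\<lambda>k. y (t k + s)) \<longlonglongrightarrow> z s"
  shows "z s \<in> S"
  using closed_sequentially[OF compact_imp_closed[OF compact_S] _ z] y_in_S by blast

text \<open>
  While \<open>h\<close> is small, the indices between \<open>e\<^bsup>t k + s\<^esup>\<close> and \<open>e\<^bsup>t k + s + h\<^esup>\<close> belong to times at which \<open>w\<close>
  is near \<open>z s\<close>.  The corresponding \<open>\<theta> j\<close> lie in a closed convex neighbourhood of the slice, hence so
  do their mean, its limit in \<open>k\<close> and the limit of the latter as \<open>h\<close> tends to \<open>0\<close>.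
\<close>

lemma limit_of_translates_derivative:
  assumes t: "filterlim t at_top sequentially" and z: "\<And>s. (\<lambda>k. y (t k + s)) \<longlonglongrightarrow> z s"
    and d: "(z has_vector_derivative d) (at s)"
  shows "d + z s \<in> slice S C (z s)"
proof -
  let ?u = "z s"
  have cl: "closed (slice S C ?u)" by (rule closed_slice[OF compact_imp_closed[OF compact_S] closed_C])
  have co: "compact (slice S C ?u)"
    using compact_Int_closed[OF compact_S cl] by (simp add: slice_def Int_def)
  have "\<exists>q\<in>slice S C ?u. dist q (d + ?u) < e" if e: "e > 0" for e
  proof -
    define \<eta> where "\<eta> = e / 2"
    have \<eta>: "\<eta> > 0" using e by (simp add: \<eta>_def)
    define K where "K = {x + b | x b. x \<in> slice S C ?u \<and> b \<in> cball 0 \<eta>}"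
    have "K = (\<Union>x\<in>slice S C ?u. \<Union>b\<in>cball 0 \<eta>. {x + b})" unfolding K_def by blast
    then have convK: "convex K"
      using convex_sums[OF convex_slice[OF limit_of_translates_in_S[OF z]] convex_cball[of 0 \<eta>]] by simp
    have closedK: "closed K" unfolding K_def
      using compact_imp_closed[OF compact_sums[OF co compact_cball[of 0 \<eta>]]] by simp
    obtain \<rho> N where \<rho>: "\<rho> > 0" and near: "\<And>n. n \<ge> N \<Longrightarrow> dist (w n) ?u < \<rho> \<Longrightarrow> \<exists>q\<in>slice S C ?u. dist (\<theta> n) q < \<eta>"
      using theta_near_slice[OF \<eta>] by blast
    \<comment> \<open>Within time \<open>h0\<close> the curve moves by at most \<open>\<rho> / 2\<close>; the other half is left for the distance of
      the shifted curve from its limit.\<close>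
    define h0 where "h0 = \<rho> / (2 * speed)"
    have h0: "h0 > 0" using \<rho> speed_pos by (simp add: h0_def)
    have mean: "(exp h *\<^sub>R z (s + h) - z s) /\<^sub>R (exp h - 1) \<in> K" if h: "0 < h" "h < h0" for h
    proof (rule Lim_in_closed_set[OF closedK])
      show "(\<lambda>k. (exp h *\<^sub>R y (t k + s + h) - y (t k + s)) /\<^sub>R (exp h - 1)) \<longlonglongrightarrow> (exp h *\<^sub>R z (s + h) - z s) /\<^sub>R (exp h - 1)"
        using z[of s] z[of "s + h"] by (intro tendsto_intros) (simp_all add: add.assoc)
      have ts: "filterlim (\<lambda>k. t k + s) at_top sequentially"
        using filterlim_tendsto_add_at_top[OF tendsto_const t, of s] by (simp add: add.commute)
      have et: "filterlim (\<lambda>k. exp (t k + s)) at_top sequentially"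
        by (rule filterlim_compose[OF exp_at_top ts])
      have "\<forall>\<^sub>F k in sequentially. real N + 1 \<le> exp (t k + s)" using et by (simp add: filterlim_at_top)
      moreover have "\<forall>\<^sub>F k in sequentially. 1 / (1 - exp (- h)) \<le> exp (t k + s)" using et by (simp add: filterlim_at_top)
      moreover have "\<forall>\<^sub>F k in sequentially. dist (y (t k + s)) ?u < \<rho> / 2" using z \<rho> by (intro tendstoD) auto
      ultimately show "\<forall>\<^sub>F k in sequentially. (exp h *\<^sub>R y (t k + s + h) - y (t k + s)) /\<^sub>R (exp h - 1) \<in> K"
      proof eventually_elim
        case (elim k)
        let ?a = "t k + s"
        show ?case
        proof (rule log_time_average_increment[OF h(1) convK])
          fix j :: nat assume j: "exp ?a < real j + 1" "real j < exp (?a + h)"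
          have jN: "j \<ge> N" using elim(1) j(1) by linarith
          have j1: "j \<ge> 1"
          proof (rule ccontr)
            assume "\<not> j \<ge> 1"
            then have "j = 0" by simp
            then have "exp ?a < 1" using j(1) by simp
            moreover have "1 \<le> 1 / (1 - exp (- h))" using h by simp
            ultimately show False using elim(2) by linarith
          qed
          \<comment> \<open>The first index may lie before \<open>e\<^sup>a\<close> by less than \<open>1\<close>; for large \<open>a\<close> this costs at most \<open>h\<close> in
            logarithmic time.\<close>
          have "exp (?a - h) \<le> exp ?a - 1"
          proof -
            have "1 \<le> exp ?a * (1 - exp (- h))" using elim(2) h by (simp add: field_simps)
            then show ?thesis by (simp add: exp_diff exp_minus field_simps)
          qed
          then have "exp (?a - h) \<le> real j" using j(1) by linarith
          then have "?a - h \<le> ln (real j)" using j1 by (simp add: ln_ge_iff)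
          moreover have "ln (real j) \<le> ?a + h" using j(2) j1 ln_mono[of "real j" "exp (?a + h)"] by simp
          ultimately have "\<bar>ln (real j) - ?a\<bar> \<le> h" by linarith
          then have "speed * \<bar>ln (real j) - ?a\<bar> \<le> speed * h0" using h speed_pos by (intro mult_left_mono) auto
          also have "speed * h0 = \<rho> / 2" using speed_pos by (simp add: h0_def)
          finally have "dist (w j) (y ?a) \<le> \<rho> / 2"
            using y_dist[of "ln (real j)" ?a] y_ln[OF j1] by simp
          then have "dist (w j) ?u < \<rho>"
            using elim(3) dist_triangle[of "w j" ?u "y ?a"] by linarith
          from near[OF jN this] obtain q where q: "q \<in> slice S C ?u" "dist (\<theta> j) q < \<eta>" by blast
          have "\<theta> j = q + (\<theta> j - q)" "\<theta> j - q \<in> cball 0 \<eta>" using q(2) by (simp_all add: dist_norm norm_minus_commute)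
          then show "\<theta> j \<in> K" using q(1) unfolding K_def by blast
        qed
      qed
    qed simp
    have "d + ?u \<in> K"
    proof (rule Lim_in_closed_set[OF closedK _ _ tendsto_mean_slope[OF d]])
      show "\<forall>\<^sub>F h in at_right 0. (exp h *\<^sub>R z (s + h) - z s) /\<^sub>R (exp h - 1) \<in> K"
        using mean h0 by (auto simp: eventually_at_right_field)
    qed simp
    then obtain q b where "q \<in> slice S C ?u" "norm b \<le> \<eta>" "d + ?u = q + b" by (auto simp: K_def)
    then show ?thesis using e by (intro bexI[of _ q]) (auto simp: dist_norm \<eta>_def)
  qed
  then have "d + ?u \<in> closure (slice S C ?u)" unfolding closure_approachable by blast
  then show ?thesis using cl by simp
qed

lemma limit_of_translates_solution:
  assumes t: "filterlim t at_top sequentially" and z: "\<And>s. (\<lambda>k. y (t k + s)) \<longlonglongrightarrow> z s"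
  shows "inclusion_solution S C z"
  unfolding inclusion_solution_def
proof (intro conjI allI)
  have lip: "speed-lipschitz_on UNIV z" using z by (rule limit_of_translates_lipschitz)
  show "z s \<in> S" for s using z by (rule limit_of_translates_in_S)
  show "abs_continuous_on {a..b} z" for a b by (rule lipschitz_imp_abs_continuous[OF lip])
  show "AE s in lborel. \<exists>d. (z has_vector_derivative d) (at s) \<and> d + z s \<in> slice S C (z s)"
    using lipschitz_vector_differentiable_AE[OF lip]
    by eventually_elim (use limit_of_translates_derivative[OF t z] in blast)
qed

text \<open>
  A diagonal argument gives convergence at the rational times; the common Lipschitz constant extends
  it to all times.
\<close>

lemma translates_subsequence:
  fixes t :: "nat \<Rightarrow> real"
  obtains \<sigma> z where "strict_mono (\<sigma> :: nat \<Rightarrow> nat)" "\<And>s. (\<lambda>k. y (t (\<sigma> k) + s)) \<longlonglongrightarrow> z s"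
proof -
  obtain B where B: "\<And>x. x \<in> S \<Longrightarrow> norm x \<le> B"
    using compact_imp_bounded[OF compact_S] by (auto simp: bounded_iff)
  obtain \<sigma> where \<sigma>: "strict_mono (\<sigma> :: nat \<Rightarrow> nat)"
    and conv: "\<And>q. q \<in> \<rat> \<Longrightarrow> \<exists>l. (\<lambda>k. y (t (\<sigma> k) + q)) \<longlonglongrightarrow> l"
    using function_convergent_subsequence[of "\<rat> :: real set" "\<lambda>k q. y (t k + q)" B]
      B[OF y_in_S] countable_rat by blast
  have "convergent (\<lambda>k. y (t (\<sigma> k) + s))" for s
  proof (rule Cauchy_convergent, rule metric_CauchyI)
    fix e :: real assume e: "e > 0"
    obtain q where q: "q \<in> \<rat>" "s < q" "q < s + e / (3 * speed)"
      using Rats_dense_in_real[of s "s + e / (3 * speed)"] e speed_pos by auto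
    have near: "dist (y (t (\<sigma> k) + s)) (y (t (\<sigma> k) + q)) < e / 3" for k
    proof -
      have "dist (y (t (\<sigma> k) + s)) (y (t (\<sigma> k) + q)) \<le> speed * (q - s)"
        using y_dist[of "t (\<sigma> k) + s" "t (\<sigma> k) + q"] q by simp
      also have "\<dots> < speed * (e / (3 * speed))" using q speed_pos by (intro mult_strict_left_mono) auto
      finally show ?thesis using speed_pos by simp
    qed
    have "Cauchy (\<lambda>k. y (t (\<sigma> k) + q))" using conv[OF q(1)] by (auto intro: LIMSEQ_imp_Cauchy)
    then obtain M where M: "\<And>m n. m \<ge> M \<Longrightarrow> n \<ge> M \<Longrightarrow> dist (y (t (\<sigma> m) + q)) (y (t (\<sigma> n) + q)) < e / 3"
      using e unfolding Cauchy_def by (metis divide_pos_pos zero_less_numeral)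
    have "dist (y (t (\<sigma> m) + s)) (y (t (\<sigma> n) + s)) < e" if "m \<ge> M" "n \<ge> M" for m n
      using near[of m] near[of n] M[OF that]
        dist_triangle[of "y (t (\<sigma> m) + s)" "y (t (\<sigma> n) + s)" "y (t (\<sigma> m) + q)"]
        dist_triangle[of "y (t (\<sigma> m) + q)" "y (t (\<sigma> n) + s)" "y (t (\<sigma> n) + q)"]
      by (simp add: dist_commute)
    then show "\<exists>M. \<forall>m\<ge>M. \<forall>n\<ge>M. dist (y (t (\<sigma> m) + s)) (y (t (\<sigma> n) + s)) < e" by blast
  qed
  then have "\<forall>s. \<exists>l. (\<lambda>k. y (t (\<sigma> k) + s)) \<longlonglongrightarrow> l" by (auto simp: convergent_def)
  then obtain z where "\<And>s. (\<lambda>k. y (t (\<sigma> k) + s)) \<longlonglongrightarrow> z s" by metis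
  then show ?thesis using that \<sigma> by blast
qed

text \<open>
  Otherwise there are arbitrarily late shifts without such a solution; along a subsequence they converge
  pointwise, hence uniformly on compact intervals, to a solution inside the limit set.
\<close>

lemma shadowed_by_solution:
  assumes "\<epsilon> > 0" "T > 0"
  obtains t0 where "\<And>t. t \<ge> t0 \<Longrightarrow> \<exists>z. inclusion_solution S C z \<and> range z \<subseteq> limit_set w \<and> (\<forall>s\<in>{0..T}. dist (y (t + s)) (z s) \<le> \<epsilon>)"
proof (rule ccontr)
  assume neg: "\<not> thesis"
  then have "\<forall>k::nat. \<exists>t\<ge>real k. \<not> (\<exists>z. inclusion_solution S C z \<and> range z \<subseteq> limit_set w \<and> (\<forall>s\<in>{0..T}. dist (y (t + s)) (z s) \<le> \<epsilon>))"
    using that by blast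
  then obtain t where t: "\<And>k. t k \<ge> real k"
    and no: "\<And>k z. inclusion_solution S C z \<Longrightarrow> range z \<subseteq> limit_set w \<Longrightarrow> \<exists>s\<in>{0..T}. \<not> dist (y (t k + s)) (z s) \<le> \<epsilon>"
    by metis
  obtain \<sigma> z where \<sigma>: "strict_mono (\<sigma> :: nat \<Rightarrow> nat)" and z: "\<And>s. (\<lambda>k. y (t (\<sigma> k) + s)) \<longlonglongrightarrow> z s"
    using translates_subsequence[of t] by blast
  have "filterlim t at_top sequentially"
    using t by (intro filterlim_at_top_mono[OF filterlim_real_sequentially]) auto
  then have ts: "filterlim (\<lambda>k. t (\<sigma> k)) at_top sequentially"
    using filterlim_subseq[OF \<sigma>] by (rule filterlim_compose)
  have sol: "inclusion_solution S C z" using ts z by (rule limit_of_translates_solution)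
  have rg: "range z \<subseteq> limit_set w" using limit_of_translates_in_limit_set[OF ts z] by auto
  have lipz: "dist (z a) (z b) \<le> speed * \<bar>a - b\<bar>" for a b
    using lipschitz_onD[OF limit_of_translates_lipschitz[of "\<lambda>k. t (\<sigma> k)" z, OF z], of a b] by (simp add: dist_real_def)
  \<comment> \<open>A grid so fine that both curves move by at most \<open>\<epsilon> / 4\<close> between neighbouring points.\<close>
  define \<delta> where "\<delta> = \<epsilon> / (4 * speed)"
  have \<delta>: "\<delta> > 0" using assms speed_pos by (simp add: \<delta>_def)
  define m where "m = nat \<lceil>T / \<delta>\<rceil>"
  have "\<forall>\<^sub>F k in sequentially. \<forall>i\<in>{..m}. dist (y (t (\<sigma> k) + real i * \<delta>)) (z (real i * \<delta>)) < \<epsilon> / 2"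
    using assms z by (intro eventually_ball_finite ballI tendstoD) auto
  then obtain k where k: "\<And>i. i \<le> m \<Longrightarrow> dist (y (t (\<sigma> k) + real i * \<delta>)) (z (real i * \<delta>)) < \<epsilon> / 2"
    by (auto simp: eventually_sequentially)
  have "dist (y (t (\<sigma> k) + s)) (z s) \<le> \<epsilon>" if s: "s \<in> {0..T}" for s
  proof -
    define i where "i = nat \<lfloor>s / \<delta>\<rfloor>"
    have f: "0 \<le> \<lfloor>s / \<delta>\<rfloor>" using s \<delta> by simp
    have i1: "real i \<le> s / \<delta>" "s / \<delta> < real i + 1" using f by (simp_all add: i_def)
    have "real i * \<delta> \<le> s" "s < (real i + 1) * \<delta>" using i1 \<delta> by (simp_all add: field_simps)
    then have close: "\<bar>s - real i * \<delta>\<bar> \<le> \<delta>" by (simp add: algebra_simps)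
    have "s / \<delta> \<le> T / \<delta>" using s \<delta> by (simp add: divide_right_mono)
    then have "i \<le> m" unfolding i_def m_def by (intro nat_mono order_trans[OF floor_mono floor_le_ceiling])
    have Dc: "speed * \<bar>s - real i * \<delta>\<bar> \<le> \<epsilon> / 4"
      using mult_left_mono[OF close, of speed] speed_pos by (simp add: \<delta>_def)
    have "dist (y (t (\<sigma> k) + s)) (y (t (\<sigma> k) + real i * \<delta>)) \<le> \<epsilon> / 4"
      using y_dist[of "t (\<sigma> k) + s" "t (\<sigma> k) + real i * \<delta>"] Dc by simp
    moreover have "dist (z (real i * \<delta>)) (z s) \<le> \<epsilon> / 4"
      using lipz[of "real i * \<delta>" s] Dc by (simp add: abs_minus_commute)
    moreover note k[OF \<open>i \<le> m\<close>]
    ultimately show ?thesis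
      using dist_triangle[of "y (t (\<sigma> k) + s)" "z s" "y (t (\<sigma> k) + real i * \<delta>)"]
        dist_triangle[of "y (t (\<sigma> k) + real i * \<delta>)" "z s" "z (real i * \<delta>)"] by linarith
  qed
  then show False using no[OF sol rg, of "\<sigma> k"] by blast
qed

lemma limit_set_subset_S: "limit_set w \<subseteq> S"
proof
  fix p assume "p \<in> limit_set w"
  then have "\<exists>n\<ge>1. dist (w n) p < e" if "e > 0" for e using that by (simp add: limit_set_iff_frequently)
  moreover have "w n \<in> S" if "n \<ge> 1" for n using y_in_S[of "ln (real n)"] y_ln[OF that] by simp
  ultimately have "p \<in> closure S" unfolding closure_approachable by blast
  then show "p \<in> S" using compact_imp_closed[OF compact_S] by simp
qed

lemma limit_set_visited:
  assumes "p \<in> limit_set w" "e > 0"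
  obtains s where "s \<ge> t0" "dist (y s) p < e"
proof -
  obtain n where n: "n \<ge> max 1 (nat \<lceil>exp t0\<rceil>)" "dist (w n) p < e"
    using assms unfolding limit_set_iff_frequently by blast
  have "exp t0 \<le> real n" using n(1) by linarith
  then have "t0 \<le> ln (real n)" using n(1) by (simp add: ln_ge_iff)
  moreover have "dist (y (ln (real n))) p < e" using n y_ln[of n] by simp
  ultimately show ?thesis using that by blast
qed

theorem limit_set_internally_chain_transitive:
  "internally_chain_transitive S C (limit_set w)"
  unfolding internally_chain_transitive_def
proof (intro conjI ballI)
  show "limit_set w \<subseteq> S" by (rule limit_set_subset_S)
  show "compact (limit_set w)"
    using compact_Int_closed[OF compact_S closed_limit_set[of w]] limit_set_subset_S by (simp add: Int_absorb1)
  fix p q assume p: "p \<in> limit_set w" and q: "q \<in> limit_set w"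
  show "chain_reachable S C (limit_set w) p q"
    unfolding chain_reachable_def
  proof (intro allI impI)
    fix \<epsilon> T :: real assume "\<epsilon> > 0" "T > 0"
    define T' where "T' = T + 1"
    have T': "T' > 0" using \<open>T > 0\<close> by (simp add: T'_def)
    obtain t0 where shadow: "\<And>t. t \<ge> t0 \<Longrightarrow> \<exists>z. inclusion_solution S C z \<and> range z \<subseteq> limit_set w \<and>
        (\<forall>s\<in>{0..2 * T'}. dist (y (t + s)) (z s) \<le> \<epsilon> / 2)"
      using shadowed_by_solution[of "\<epsilon> / 2" "2 * T'"] \<open>\<epsilon> > 0\<close> T' by auto
    obtain s0 where s0: "s0 \<ge> t0" "dist (y s0) p < \<epsilon> / 2"
      using limit_set_visited[OF p, of "\<epsilon> / 2" t0] \<open>\<epsilon> > 0\<close> by auto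
    obtain s1 where s1: "s1 \<ge> s0 + T'" "dist (y s1) q < \<epsilon> / 2"
      using limit_set_visited[OF q, of "\<epsilon> / 2" "s0 + T'"] \<open>\<epsilon> > 0\<close> by auto
    \<comment> \<open>The time between the two visits is cut into \<open>n\<close> pieces of equal length \<open>l\<close>.  As \<open>n\<close> is maximal with
      \<open>T' \<le> l\<close>, also \<open>l \<le> 2 * T'\<close>, so one shadowing time serves for all pieces.\<close>
    define n where "n = nat \<lfloor>(s1 - s0) / T'\<rfloor>"
    define l where "l = (s1 - s0) / real n"
    have ge1: "1 \<le> (s1 - s0) / T'" using s1 T' by (simp add: field_simps)
    have n1: "n \<ge> 1" unfolding n_def using ge1 by linarith
    have nb: "real n \<le> (s1 - s0) / T'" "(s1 - s0) / T' < real n + 1"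
      unfolding n_def using ge1 by (auto simp: of_nat_floor) 
    have l1: "T' \<le> l" using nb(1) n1 T' by (simp add: l_def field_simps)
    have "s1 - s0 < (real n + 1) * T'" using nb(2) T' by (simp add: field_simps)
    also have "\<dots> \<le> (2 * real n) * T'" using n1 T' by (intro mult_right_mono) auto
    finally have l2: "l \<le> 2 * T'" using n1 by (simp add: l_def field_simps)
    have ln: "real n * l = s1 - s0" using n1 by (simp add: l_def)
    have "\<exists>z. inclusion_solution S C z \<and> range z \<subseteq> limit_set w \<and>
        (\<forall>s\<in>{0..2 * T'}. dist (y (s0 + (real i - 1) * l + s)) (z s) \<le> \<epsilon> / 2)" if "i \<ge> 1" for i :: nat
    proof (rule shadow)
      have "0 \<le> (real i - 1) * l" using that l1 T' by simp
      then show "t0 \<le> s0 + (real i - 1) * l" using s0 by linarith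
    qed
    then obtain \<xi> where \<xi>: "\<And>i. i \<ge> 1 \<Longrightarrow> inclusion_solution S C (\<xi> i)" "\<And>i. i \<ge> 1 \<Longrightarrow> range (\<xi> i) \<subseteq> limit_set w"
      and sh: "\<And>i s. i \<ge> (1::nat) \<Longrightarrow> s \<in> {0..2 * T'} \<Longrightarrow> dist (y (s0 + (real i - 1) * l + s)) (\<xi> i s) \<le> \<epsilon> / 2"
      by metis
    have start: "dist (y (s0 + (real i - 1) * l)) (\<xi> i 0) \<le> \<epsilon> / 2" if "i \<ge> 1" for i
      using sh[OF that, of 0] T' by simp
    have stop: "dist (y (s0 + real i * l)) (\<xi> i l) \<le> \<epsilon> / 2" if "i \<ge> 1" for i
      using sh[OF that, of l] l1 l2 T' by (simp add: algebra_simps)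
    show "\<exists>(n::nat) \<xi> t. n \<ge> 1 \<and>
        (\<forall>i\<in>{1..n}. inclusion_solution S C (\<xi> i) \<and> t i > T \<and> \<xi> i ` {0..t i} \<subseteq> limit_set w) \<and>
        (\<forall>i\<in>{1..<n}. norm (\<xi> i (t i) - \<xi> (i + 1) 0) \<le> \<epsilon>) \<and>
        norm (\<xi> 1 0 - p) \<le> \<epsilon> \<and> norm (\<xi> n (t n) - q) \<le> \<epsilon>"
    proof (rule exI[of _ n], rule exI[of _ \<xi>], rule exI[of _ "\<lambda>_. l"], intro conjI ballI)
      show "1 \<le> n" by (rule n1)
      fix i assume "i \<in> {1..n}"
      then have "i \<ge> 1" by simp
      with \<xi>(1)[OF this] \<xi>(2)[OF this]
      show "inclusion_solution S C (\<xi> i)" "\<xi> i ` {0..l} \<subseteq> limit_set w" by auto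
      show "T < l" using l1 by (simp add: T'_def)
    next
      fix i assume "i \<in> {1..<n}"
      then have i: "i \<ge> 1" by simp
      show "norm (\<xi> i l - \<xi> (i + 1) 0) \<le> \<epsilon>"
        using stop[OF i] start[of "i + 1"] dist_triangle[of "\<xi> i l" "\<xi> (i + 1) 0" "y (s0 + real i * l)"]
        by (simp add: dist_norm[symmetric] dist_commute)
    next
      show "norm (\<xi> 1 0 - p) \<le> \<epsilon>"
        using start[of 1] s0(2) dist_triangle[of "\<xi> 1 0" p "y s0"] by (simp add: dist_norm[symmetric] dist_commute)
      show "norm (\<xi> n l - q) \<le> \<epsilon>"
        using stop[OF n1] s1(2) dist_triangle[of "\<xi> n l" q "y s1"] ln by (simp add: dist_norm[symmetric] dist_commute)
    qed
  qed
qed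

end

section \<open>Invariant probability of an indecomposable Markov matrix\<close>

lemma mat_pow_0: "mat_pow N 0 = mat 1" by (simp add: mat_pow_def)
lemma mat_pow_Suc: "mat_pow N (Suc k) = N ** mat_pow N k" by (simp add: mat_pow_def)
lemma mat_pow_add: "mat_pow N (i + j) = mat_pow N i ** mat_pow N j"
  by (induction i) (simp_all add: mat_pow_0 mat_pow_Suc matrix_mul_assoc)

lemma mat_pow_nonneg:
  fixes N :: "real^'e::finite^'e"
  assumes "markov_matrix N"
  shows "0 \<le> mat_pow N k $ x $ y"
proof (induction k arbitrary: x y)
  case 0 show ?case by (simp add: mat_pow_0 mat_def)
next
  case (Suc k)
  show ?case using assms Suc
    by (auto simp: mat_pow_Suc matrix_matrix_mult_def markov_matrix_def intro!: sum_nonneg)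
qed

definition accessible :: "real^'e^'e \<Rightarrow> 'e::finite \<Rightarrow> 'e \<Rightarrow> bool" where
  "accessible N x y \<longleftrightarrow> (\<exists>i. mat_pow N i $ x $ y > 0)"

lemma accessible_refl: "accessible N x x"
  unfolding accessible_def by (rule exI[of _ 0]) (simp add: mat_pow_0 mat_def)

lemma accessible_step:
  assumes "N $ x $ y > 0" shows "accessible N x y"
  unfolding accessible_def using assms by (intro exI[of _ 1]) (simp add: mat_pow_Suc mat_pow_0)

lemma accessible_trans:
  fixes N :: "real^'e::finite^'e"
  assumes N: "markov_matrix N" and "accessible N x y" "accessible N y z"
  shows "accessible N x z"
proof -
  obtain i j where ij: "mat_pow N i $ x $ y > 0" "mat_pow N j $ y $ z > 0"
    using assms by (auto simp: accessible_def)
  have "0 < mat_pow N i $ x $ y * mat_pow N j $ y $ z" using ij by simp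
  also have "\<dots> \<le> (\<Sum>u\<in>UNIV. mat_pow N i $ x $ u * mat_pow N j $ u $ z)"
    by (rule member_le_sum) (auto intro!: mult_nonneg_nonneg mat_pow_nonneg N)
  also have "\<dots> = mat_pow N (i + j) $ x $ z" by (simp add: mat_pow_add matrix_matrix_mult_def)
  finally show ?thesis unfolding accessible_def by blast
qed

text \<open>
  A state of the closed set from which the fewest states are accessible can be reached back from each of
  them, so the states accessible from it form a closed class.
\<close>

lemma closed_set_contains_recurrent_class:
  fixes N :: "real^'e::finite^'e"
  assumes N: "markov_matrix N" and A: "A \<noteq> {}" and closed: "\<And>x y. x \<in> A \<Longrightarrow> N $ x $ y > 0 \<Longrightarrow> y \<in> A"
  obtains R where "recurrent_class N R" "R \<noteq> {}" "R \<subseteq> A"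
proof -
  have pow: "y \<in> A" if "x \<in> A" "mat_pow N k $ x $ y > 0" for x y k
    using that
  proof (induction k arbitrary: x)
    case 0 then show ?case by (auto simp: mat_pow_0 mat_def split: if_splits)
  next
    case (Suc k)
    have "\<exists>u. N $ x $ u * mat_pow N k $ u $ y > 0"
    proof (rule ccontr)
      assume "\<not> ?thesis"
      then have "(\<Sum>u\<in>UNIV. N $ x $ u * mat_pow N k $ u $ y) \<le> 0" by (intro sum_nonpos) (auto simp: not_less)
      then show False using Suc.prems(2) by (simp add: mat_pow_Suc matrix_matrix_mult_def)
    qed
    then obtain u where u: "N $ x $ u * mat_pow N k $ u $ y > 0" by blast
    moreover have "N $ x $ u \<ge> 0" using N by (simp add: markov_matrix_def)
    ultimately have "N $ x $ u > 0" "mat_pow N k $ u $ y > 0"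
      by (auto simp: zero_less_mult_iff)
    then show ?case using Suc.IH[of u] closed[OF Suc.prems(1)] by blast
  qed
  have reachA: "{y. accessible N x y} \<subseteq> A" if "x \<in> A" for x
    using pow[OF that] by (auto simp: accessible_def)
  obtain x where x: "x \<in> A" and least: "\<And>y. y \<in> A \<Longrightarrow> card {z. accessible N x z} \<le> card {z. accessible N y z}"
    using A arg_min_nat_lemma[of "\<lambda>x. x \<in> A" _ "\<lambda>x. card {z. accessible N x z}"] by blast
  define R where "R = {z. accessible N x z}"
  have returns: "accessible N y x" if "y \<in> R" for y
  proof -
    have "y \<in> A" using that reachA[OF x] by (auto simp: R_def)
    have sub: "{z. accessible N y z} \<subseteq> R" using that accessible_trans[OF N] by (auto simp: R_def)
    have "{z. accessible N y z} = R"
      by (rule card_subset_eq[OF _ sub]) (use least[OF \<open>y \<in> A\<close>] card_mono[OF _ sub] in \<open>auto simp: R_def\<close>)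
    then show ?thesis using accessible_refl[of N x] by (auto simp: R_def)
  qed
  have "R = communicates N `` {x}"
    using returns by (auto simp: R_def communicates_def accessible_def)
  then have "R \<in> UNIV // communicates N" by (auto simp: quotient_def)
  moreover have "N $ u $ v = 0" if "u \<in> R" "v \<notin> R" for u v
  proof (rule ccontr)
    assume "N $ u $ v \<noteq> 0"
    moreover have "N $ u $ v \<ge> 0" using N by (simp add: markov_matrix_def)
    ultimately have "accessible N u v" by (intro accessible_step) simp
    moreover have "accessible N x u" using that by (simp add: R_def)
    ultimately have "v \<in> R" unfolding R_def using accessible_trans[OF N] by blast
    then show False using that by blast
  qed
  ultimately have "recurrent_class N R" unfolding recurrent_class_def by blast
  moreover have "R \<noteq> {}" using accessible_refl[of N x] by (auto simp: R_def)
  ultimately show ?thesis using that reachA[OF x] R_def by blast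
qed

text \<open>
  The maximum principle: a value that is an average of values not exceeding \<open>m\<close> can be \<open>m\<close> only if
  all values that enter with positive weight are \<open>m\<close>.
\<close>

lemma harmonic_max_closed:
  fixes N :: "real^'e::finite^'e" and f :: "real^'e"
  assumes N: "markov_matrix N" and harm: "N *v f = f"
    and m: "\<And>x. f $ x \<le> m" and x: "f $ x = m" and pos: "N $ x $ y > 0"
  shows "f $ y = m"
proof (rule ccontr)
  assume "f $ y \<noteq> m"
  then have lt: "f $ y < m" using m[of y] by simp
  have "f $ x = (\<Sum>u\<in>UNIV. N $ x $ u * f $ u)" using arg_cong[OF harm, of "\<lambda>g. g $ x"] by (simp add: matrix_vector_mult_def)
  also have "\<dots> < (\<Sum>u\<in>UNIV. N $ x $ u * m)"
  proof (rule sum_strict_mono_ex1)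
    show "\<forall>u\<in>UNIV. N $ x $ u * f $ u \<le> N $ x $ u * m"
      using N m by (auto simp: markov_matrix_def intro!: mult_left_mono)
    show "\<exists>u\<in>UNIV. N $ x $ u * f $ u < N $ x $ u * m" using pos lt by (auto intro!: exI[of _ y])
  qed simp
  also have "\<dots> = m" using N by (simp add: sum_distrib_right[symmetric] markov_matrix_def)
  finally show False using x by simp
qed

text \<open>
  The sets where a harmonic function is maximal and where it is minimal are both closed, so each of them
  contains a recurrent class.  As there is only one such class, the two sets meet.
\<close>

lemma harmonic_constant:
  fixes N :: "real^'e::finite^'e" and f :: "real^'e"
  assumes N: "markov_matrix N" and ind: "indecomposable N" and harm: "N *v f = f"
  shows "f $ x = f $ y"
proof -
  define hi where "hi = Max (range (\<lambda>x. f $ x))"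
  define lo where "lo = Max (range (\<lambda>x. (- f) $ x))"
  have hi: "f $ x \<le> hi" for x by (simp add: hi_def)
  have lo: "(- f) $ x \<le> lo" for x unfolding lo_def by (rule Max_ge) auto
  have "hi \<in> range (\<lambda>x. f $ x)" unfolding hi_def by (rule Max_in) auto
  then have neh: "{x. f $ x = hi} \<noteq> {}" by auto
  have "lo \<in> range (\<lambda>x. (- f) $ x)" unfolding lo_def by (rule Max_in) auto
  then have nel: "{x. (- f) $ x = lo} \<noteq> {}" by auto
  have harm': "N *v (- f) = - f" using harm
    by (simp add: vec_eq_iff matrix_vector_mult_def sum_negf)
  obtain R1 where R1: "recurrent_class N R1" "R1 \<noteq> {}" "R1 \<subseteq> {x. f $ x = hi}"
    using closed_set_contains_recurrent_class[OF N neh] harmonic_max_closed[OF N harm hi] by blast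
  obtain R2 where R2: "recurrent_class N R2" "R2 \<noteq> {}" "R2 \<subseteq> {x. (- f) $ x = lo}"
    using closed_set_contains_recurrent_class[OF N nel] harmonic_max_closed[OF N harm' lo] by blast
  have "R1 = R2" using ind R1(1) R2(1) unfolding indecomposable_def by blast
  then obtain u where "f $ u = hi" "(- f) $ u = lo" using R1 R2 by blast
  then have "hi = - lo" by simp
  then have "f $ z = hi" for z using hi[of z] lo[of z] by simp
  then show ?thesis by simp
qed

definition all_ones :: "real^'e^'e" where "all_ones = (\<chi> x y. 1)"

text \<open>
  Adding the matrix of ones removes the kernel of \<open>I - N\<close>, the constants, without the need to know
  \<open>\<Pi>\<close>.  This makes \<open>\<pi>\<close> and \<open>Q\<close> explicit functions of \<open>N\<close> and shows that they are measurable.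
\<close>

lemma invertible_shifted_generator:
  fixes N :: "real^'e::finite^'e"
  assumes N: "markov_matrix N" and ind: "indecomposable N"
    and p: "p v* N = p" "(\<Sum>x\<in>UNIV. p $ x) = 1"
  shows "invertible (mat 1 - N + all_ones)"
proof -
  have "f = 0" if f: "(mat 1 - N + all_ones) *v f = 0" for f
  proof -
    let ?s = "\<Sum>x\<in>UNIV. f $ x"
    have Jf: "all_ones *v f = (\<chi> x. ?s)" by (simp add: all_ones_def matrix_vector_mult_def)
    have e: "(f - N *v f) + (\<chi> x. ?s) = 0"
      using f by (simp add: matrix_vector_mult_add_rdistrib matrix_vector_mult_diff_rdistrib Jf)
    have "p \<bullet> (N *v f) = p \<bullet> f" using p(1) by (metis dot_lmul_matrix)
    then have "p \<bullet> ((f - N *v f) + (\<chi> x. ?s)) = p \<bullet> (\<chi> x. ?s)" by (simp add: inner_add_right inner_diff_right)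
    also have "\<dots> = ?s" by (simp add: inner_vec_def sum_distrib_right[symmetric] p(2))
    finally have s0: "?s = 0" using e by simp
    then have "N *v f = f" using e by (simp add: vec_eq_iff)
    then have c: "f $ x = f $ y" for x y by (rule harmonic_constant[OF N ind])
    have "f $ x = 0" for x
    proof -
      have "?s = (\<Sum>y\<in>(UNIV::'e set). f $ x)" by (rule sum.cong) (auto intro: c)
      then show ?thesis using s0 by simp
    qed
    then show ?thesis by (simp add: vec_eq_iff)
  qed
  then show ?thesis
    by (subst invertible_left_inverse, subst matrix_left_invertible_ker) blast
qed

text \<open>
  The singular matrix \<open>I - N\<close> has a nonzero left null vector \<open>q\<close>.  The vector of absolute values satisfies
  \<open>|q| \<le> |q| N\<close> entrywise, with equal sums, so it is invariant too.
\<close>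

lemma ex_invariant_prob:
  fixes N :: "real^'e::finite^'e"
  assumes N: "markov_matrix N"
  shows "\<exists>p. (\<forall>x. 0 \<le> p $ x) \<and> (\<Sum>x\<in>UNIV. p $ x) = 1 \<and> p v* N = p"
proof -
  have one: "N *v 1 = 1" using N by (simp add: vec_eq_iff matrix_vector_mult_def markov_matrix_def)
  have "\<not> invertible (mat 1 - N)"
  proof
    assume "invertible (mat 1 - N)"
    then have "\<forall>x. (mat 1 - N) *v x = 0 \<longrightarrow> x = 0"
      by (simp add: invertible_left_inverse matrix_left_invertible_ker)
    moreover have "(mat 1 - N) *v 1 = 0" by (simp add: matrix_vector_mult_diff_rdistrib one)
    ultimately have "(1::real^'e) = 0" by blast
    then show False by simp
  qed
  then have "\<not> invertible (transpose (mat 1 - N))" by (metis transpose_transpose transpose_invertible)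
  then obtain q where q: "transpose (mat 1 - N) *v q = 0" "q \<noteq> 0"
    by (auto simp: invertible_left_inverse matrix_left_invertible_ker)
  have "q v* (mat 1 - N) = 0" using q(1) by (simp add: transpose_matrix_vector)
  moreover have "q v* (mat 1 - N) = q v* mat 1 - q v* N"
    by (simp add: vec_eq_iff vector_matrix_mult_def algebra_simps sum_subtractf)
  ultimately have qN: "q v* N = q" by simp
  have qy: "q $ y = (\<Sum>x\<in>UNIV. q $ x * N $ x $ y)" for y
  proof -
    have "q $ y = (q v* N) $ y" by (simp add: qN)
    also have "\<dots> = (\<Sum>x\<in>UNIV. q $ x * N $ x $ y)"
      by (simp add: vector_matrix_mult_def mult.commute)
    finally show ?thesis .
  qed
  have Nn: "0 \<le> N $ x $ y" "(\<Sum>y\<in>UNIV. N $ x $ y) = 1" for x y using N by (auto simp: markov_matrix_def)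
  have le: "\<bar>q $ y\<bar> \<le> (\<Sum>x\<in>UNIV. \<bar>q $ x\<bar> * N $ x $ y)" for y
    using sum_abs[of "\<lambda>x. q $ x * N $ x $ y" UNIV] by (simp add: qy[symmetric] abs_mult Nn)
  have tot: "(\<Sum>y\<in>UNIV. (\<Sum>x\<in>UNIV. \<bar>q $ x\<bar> * N $ x $ y) - \<bar>q $ y\<bar>) = 0"
  proof -
    have "(\<Sum>y\<in>UNIV. \<Sum>x\<in>UNIV. \<bar>q $ x\<bar> * N $ x $ y) = (\<Sum>x\<in>UNIV. \<bar>q $ x\<bar>)"
      by (subst sum.swap) (simp add: sum_distrib_left[symmetric] Nn)
    then show ?thesis by (simp add: sum_subtractf)
  qed
  have eq: "(\<Sum>x\<in>UNIV. \<bar>q $ x\<bar> * N $ x $ y) = \<bar>q $ y\<bar>" for y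
    using tot le by (subst (asm) sum_nonneg_eq_0_iff) auto
  define s where "s = (\<Sum>x\<in>UNIV. \<bar>q $ x\<bar>)"
  have "s > 0"
  proof -
    obtain x where "q $ x \<noteq> 0" using q(2) by (auto simp: vec_eq_iff)
    then show ?thesis unfolding s_def by (intro sum_pos2[of UNIV x]) auto
  qed
  define p :: "real^'e" where "p = (\<chi> x. \<bar>q $ x\<bar> / s)"
  have "\<forall>x. 0 \<le> p $ x" using \<open>s > 0\<close> by (simp add: p_def)
  moreover have "(\<Sum>x\<in>UNIV. p $ x) = 1" using \<open>s > 0\<close> by (simp add: p_def sum_divide_distrib[symmetric] s_def)
  moreover have "p v* N = p"
    using eq \<open>s > 0\<close> by (simp add: vec_eq_iff p_def vector_matrix_mult_def sum_divide_distrib[symmetric] mult.commute)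
  ultimately show ?thesis by blast
qed

lemma invariant_prob_unique:
  fixes N :: "real^'e::finite^'e"
  assumes N: "markov_matrix N" and ind: "indecomposable N"
    and p: "p v* N = p" "(\<Sum>x\<in>UNIV. p $ x) = 1" and q: "q v* N = q" "(\<Sum>x\<in>UNIV. q $ x) = 1"
  shows "p = q"
proof -
  have s: "r v* (mat 1 - N + all_ones) = 1" if "r v* N = r" "(\<Sum>x\<in>UNIV. r $ x) = 1" for r :: "real^'e"
  proof -
    have 1: "r v* (mat 1 - N + all_ones) = r v* mat 1 - r v* N + r v* all_ones"
      by (simp add: vec_eq_iff vector_matrix_mult_def algebra_simps sum.distrib sum_subtractf)
    have "r v* all_ones = 1" using that(2) by (simp add: vec_eq_iff vector_matrix_mult_def all_ones_def)
    then show ?thesis using that 1 by (simp add: vector_matrix_mul_rid)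
  qed
  obtain B where B: "(mat 1 - N + all_ones) ** B = mat 1"
    using invertible_shifted_generator[OF N ind p] by (auto simp: invertible_def)
  have "r = 1 v* B" if "r v* N = r" "(\<Sum>x\<in>UNIV. r $ x) = 1" for r :: "real^'e"
    using s[OF that] B by (metis vector_matrix_mul_assoc vector_matrix_mul_rid)
  from this[OF p] this[OF q] show ?thesis by simp
qed

lemma invariant_prob_props:
  fixes N :: "real^'e::finite^'e"
  assumes N: "markov_matrix N" and ind: "indecomposable N"
  shows invariant_prob_nonneg: "0 \<le> invariant_prob N $ x"
    and invariant_prob_sum: "(\<Sum>x\<in>UNIV. invariant_prob N $ x) = 1"
    and invariant_prob_invariant: "invariant_prob N v* N = invariant_prob N"
proof -
  have "\<exists>!p. (\<forall>x. 0 \<le> p $ x) \<and> (\<Sum>x\<in>UNIV. p $ x) = 1 \<and> p v* N = p"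
    using ex_invariant_prob[OF N] invariant_prob_unique[OF N ind] by blast
  from theI'[OF this] show "0 \<le> invariant_prob N $ x" "(\<Sum>x\<in>UNIV. invariant_prob N $ x) = 1"
    "invariant_prob N v* N = invariant_prob N"
    unfolding invariant_prob_def by auto
qed

lemma invariant_prob_solves:
  fixes N :: "real^'e::finite^'e"
  assumes N: "markov_matrix N" and ind: "indecomposable N"
  shows "transpose (mat 1 - N + all_ones) *v invariant_prob N = 1"
    and "invertible (mat 1 - N + all_ones)"
proof -
  note p = invariant_prob_props[OF N ind]
  show "invertible (mat 1 - N + all_ones)" by (rule invertible_shifted_generator[OF N ind p(3,2)])
  show "transpose (mat 1 - N + all_ones) *v invariant_prob N = 1"
  proof -
    let ?r = "invariant_prob N"
    have 1: "?r v* (mat 1 - N + all_ones) = ?r v* mat 1 - ?r v* N + ?r v* all_ones"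
      by (simp add: vec_eq_iff vector_matrix_mult_def algebra_simps sum.distrib sum_subtractf)
    have "?r v* all_ones = 1" using p(2) by (simp add: vec_eq_iff vector_matrix_mult_def all_ones_def)
    then show ?thesis using p(3) 1 by (simp add: transpose_matrix_vector vector_matrix_mul_rid)
  qed
qed

section \<open>Pseudo inverse and Poisson equation\<close>

lemma matrix_diff_ldistrib: "A ** (B - C) = A ** B - A ** (C :: real^'n^'m)"
  by (simp add: vec_eq_iff matrix_matrix_mult_def algebra_simps sum_subtractf)

lemma matrix_diff_rdistrib: "(A - B) ** C = A ** C - B ** (C :: real^'n^'m)"
  by (simp add: vec_eq_iff matrix_matrix_mult_def algebra_simps sum_subtractf)

lemma matrix_inv_invertible:
  assumes "invertible A"
  shows "A ** matrix_inv A = mat 1 \<and> matrix_inv A ** A = mat 1"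
  using assms unfolding invertible_def matrix_inv_def by (rule someI_ex)

text \<open>
  A potential kernel of the chain, normalised differently from \<open>Q\<close>, which is obtained from it by
  subtracting the \<open>\<pi>\<close>-mean of each column.
\<close>

abbreviation (input) potential :: "real^'e^'e \<Rightarrow> real^'e::finite^'e" where
  "potential N \<equiv> matrix_inv (mat 1 - N + all_ones)"

lemma potential_inverse:
  assumes "markov_matrix N" "indecomposable N"
  shows "(mat 1 - N + all_ones) ** potential N = mat 1" "potential N ** (mat 1 - N + all_ones) = mat 1"
  using matrix_inv_invertible[OF invariant_prob_solves(2)[OF assms]] by auto

lemma all_ones_mult_potential:
  fixes N :: "real^'e::finite^'e"
  assumes N: "markov_matrix N" "indecomposable N"
  shows "all_ones ** potential N = inv_projector N"
proof -
  let ?p = "invariant_prob N"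
  have "?p v* (mat 1 - N + all_ones) = 1"
    using invariant_prob_solves(1)[OF N] by (simp add: transpose_matrix_vector)
  then have "1 v* potential N = (?p v* (mat 1 - N + all_ones)) v* potential N" by simp
  also have "\<dots> = ?p" using potential_inverse(1)[OF N] by (simp add: vector_matrix_mul_assoc)
  finally have "1 v* potential N = ?p" .
  then have "(1 v* potential N) $ y = ?p $ y" for y by simp
  then have "(\<Sum>x\<in>UNIV. potential N $ x $ y) = ?p $ y" for y
    by (simp add: vector_matrix_mult_def)
  then show ?thesis by (simp add: vec_eq_iff matrix_matrix_mult_def all_ones_def inv_projector_def)
qed

lemma inv_projector_mult:
  fixes N :: "real^'e::finite^'e"
  assumes N: "markov_matrix N" "indecomposable N"
  shows "inv_projector N ** N = inv_projector N" "N ** inv_projector N = inv_projector N"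
    "inv_projector N ** all_ones = all_ones" "inv_projector N *v 1 = 1"
proof -
  note p = invariant_prob_props[OF N]
  have "(invariant_prob N v* N) $ y = invariant_prob N $ y" for y by (simp add: p(3))
  then show "inv_projector N ** N = inv_projector N"
    by (simp add: vec_eq_iff matrix_matrix_mult_def inv_projector_def vector_matrix_mult_def mult.commute)
  show "N ** inv_projector N = inv_projector N"
    using N(1) by (simp add: vec_eq_iff matrix_matrix_mult_def inv_projector_def markov_matrix_def sum_distrib_right[symmetric])
  show "inv_projector N ** all_ones = all_ones"
    using p(2) by (simp add: vec_eq_iff matrix_matrix_mult_def inv_projector_def all_ones_def)
  show "inv_projector N *v 1 = 1"
    using p(2) by (simp add: vec_eq_iff matrix_vector_mult_def inv_projector_def)
qed

text \<open>
  With \<open>B\<close> the potential matrix and \<open>J\<close> the matrix of ones, \<open>J B = \<Pi>\<close> gives \<open>(I - N) B = I - \<Pi>\<close>, and \<open>B J\<close>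
  is a multiple of \<open>J\<close>, which \<open>I - \<Pi>\<close> annihilates.
\<close>

lemma pseudo_inverse_exists:
  fixes N :: "real^'e::finite^'e"
  assumes N: "markov_matrix N" "indecomposable N"
  defines "Q \<equiv> (mat 1 - inv_projector N) ** potential N"
  shows "Q *v 1 = 0" "Q ** (mat 1 - N) = mat 1 - inv_projector N" "(mat 1 - N) ** Q = mat 1 - inv_projector N"
proof -
  let ?A = "mat 1 - N + all_ones" and ?B = "potential N" and ?P = "inv_projector N"
  let ?c = "real CARD('e)"
  note B = potential_inverse[OF N] and P = inv_projector_mult[OF N]
  have "?A *v 1 = ?c *\<^sub>R 1"
    using N(1) by (simp add: vec_eq_iff matrix_vector_mult_def all_ones_def markov_matrix_def sum.distrib sum_subtractf mat_def)
  then have "?B *v (?A *v 1) = ?c *\<^sub>R (?B *v 1)" by (simp add: matrix_vector_mult_scaleR)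
  then have "(1::real^'e) = ?c *\<^sub>R (?B *v 1)" using B(2) by (simp add: matrix_vector_mul_assoc)
  then have "(1 / ?c) *\<^sub>R (1::real^'e) = (1 / ?c) *\<^sub>R (?c *\<^sub>R (?B *v 1))" by simp
  then have B1: "?B *v 1 = (1 / ?c) *\<^sub>R 1" by simp
  have Q1: "Q *v x = ?B *v x - ?P *v (?B *v x)" for x
    unfolding Q_def by (simp add: matrix_vector_mul_assoc[symmetric] matrix_vector_mult_diff_rdistrib)
  show "Q *v 1 = 0" unfolding Q1 B1 by (simp add: matrix_vector_mult_scaleR P(4))
  have JP: "(mat 1 - ?P) ** all_ones = 0" by (simp add: matrix_diff_rdistrib P(3))
  have Bx: "?B ** (mat 1 - N) = mat 1 - ?B ** all_ones"
  proof -
    have "?B ** ((mat 1 - N + all_ones) - all_ones) = mat 1 - ?B ** all_ones"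
      by (subst matrix_diff_ldistrib) (simp only: B(2))
    then show ?thesis by simp
  qed
  have BJ: "?B ** all_ones = (1 / ?c) *\<^sub>R all_ones"
    using B1 by (simp add: vec_eq_iff matrix_vector_mult_def matrix_matrix_mult_def all_ones_def)
  have "Q ** (mat 1 - N) = (mat 1 - ?P) ** (mat 1 - ?B ** all_ones)"
    unfolding Q_def by (simp only: matrix_mul_assoc[symmetric] Bx)
  also have "\<dots> = (mat 1 - ?P) - (mat 1 - ?P) ** (?B ** all_ones)"
    by (subst matrix_diff_ldistrib) simp
  also have "(mat 1 - ?P) ** (?B ** all_ones) = 0"
    unfolding BJ using JP by (simp add: vec_eq_iff matrix_matrix_mult_def all_ones_def sum_divide_distrib[symmetric])
  finally show "Q ** (mat 1 - N) = mat 1 - ?P" by simp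
  have "(mat 1 - N) ** (mat 1 - ?P) = mat 1 - N"
    by (subst matrix_diff_ldistrib) (simp add: matrix_diff_rdistrib P(2))
  then have "(mat 1 - N) ** Q = (mat 1 - N) ** ?B" unfolding Q_def by (simp add: matrix_mul_assoc)
  also have "\<dots> = ((mat 1 - N + all_ones) - all_ones) ** ?B" by simp
  also have "\<dots> = mat 1 - all_ones ** ?B" by (subst matrix_diff_rdistrib) (simp only: B(1))
  finally show "(mat 1 - N) ** Q = mat 1 - ?P" by (simp add: all_ones_mult_potential[OF N])
qed

lemma pseudo_inverse_eq:
  fixes N :: "real^'e::finite^'e"
  assumes N: "markov_matrix N" "indecomposable N"
  shows "pseudo_inverse N = (mat 1 - inv_projector N) ** potential N"
  unfolding pseudo_inverse_def
proof (rule the_equality)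
  let ?P = "inv_projector N" and ?Q = "(mat 1 - inv_projector N) ** potential N"
  let ?ok = "\<lambda>Q. Q *v 1 = 0 \<and> Q ** (mat 1 - N) = mat 1 - ?P \<and> (mat 1 - N) ** Q = mat 1 - ?P"
  show ok: "?ok ?Q" using pseudo_inverse_exists[OF N] by blast
  have right: "Q ** (mat 1 - ?P) = Q" if "Q *v 1 = 0" for Q :: "real^'e^'e"
  proof -
    have "(\<Sum>y\<in>UNIV. Q $ x $ y) = 0" for x
      using arg_cong[OF that, of "\<lambda>v. v $ x"] by (simp add: matrix_vector_mult_def)
    then have "Q ** ?P = 0"
      by (simp add: vec_eq_iff matrix_matrix_mult_def inv_projector_def sum_distrib_right[symmetric])
    then show ?thesis by (simp add: matrix_diff_ldistrib)
  qed
  have left: "(mat 1 - ?P) ** Q = Q" if "?ok Q" for Q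
    using right[of Q] that by (metis matrix_mul_assoc)
  fix Q assume Q: "?ok Q"
  have "Q = Q ** ((mat 1 - N) ** ?Q)" using right[of Q] Q ok by simp
  also have "\<dots> = (mat 1 - ?P) ** ?Q" using Q by (simp only: matrix_mul_assoc)
  also have "\<dots> = ?Q" by (rule left[OF ok])
  finally show "Q = ?Q" .
qed

lemma pseudo_inverse_right:
  fixes N :: "real^'e::finite^'e"
  assumes N: "markov_matrix N" "indecomposable N"
  shows "N ** pseudo_inverse N = pseudo_inverse N - mat 1 + inv_projector N"
proof -
  have "(mat 1 - N) ** pseudo_inverse N = mat 1 - inv_projector N"
    using pseudo_inverse_exists(3)[OF N] by (simp add: pseudo_inverse_eq[OF N])
  then show ?thesis by (simp add: matrix_diff_rdistrib algebra_simps)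
qed

lemma borel_measurable_det:
  fixes A :: "'w \<Rightarrow> real^'n::finite^'n"
  assumes [measurable]: "\<And>i j. (\<lambda>\<omega>. A \<omega> $ i $ j) \<in> borel_measurable F"
  shows "(\<lambda>\<omega>. det (A \<omega>)) \<in> borel_measurable F"
  unfolding det_def by measurable

text \<open>
  By Cramer's rule the entries of the inverse are quotients of determinants.
\<close>

lemma borel_measurable_matrix_inv:
  fixes A :: "'w \<Rightarrow> real^'n::finite^'n"
  assumes A [measurable]: "\<And>i j. (\<lambda>\<omega>. A \<omega> $ i $ j) \<in> borel_measurable F"
    and inv: "\<And>\<omega>. \<omega> \<in> space F \<Longrightarrow> invertible (A \<omega>)"
  shows "(\<lambda>\<omega>. matrix_inv (A \<omega>) $ i $ j) \<in> borel_measurable F"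
proof -
  let ?f = "\<lambda>\<omega>. det (\<chi> k l. if l = i then axis j 1 $ k else A \<omega> $ k $ l) / det (A \<omega>)"
  have "(\<lambda>\<omega>. matrix_inv (A \<omega>) $ i $ j) \<in> borel_measurable F \<longleftrightarrow> ?f \<in> borel_measurable F"
  proof (rule measurable_cong)
    fix \<omega> assume \<omega>: "\<omega> \<in> space F"
    have "A \<omega> ** matrix_inv (A \<omega>) = mat 1" using matrix_inv_invertible[OF inv[OF \<omega>]] by simp
    then have "A \<omega> *v (matrix_inv (A \<omega>) *v axis j 1) = axis j 1" by (simp add: matrix_vector_mul_assoc)
    moreover have "det (A \<omega>) \<noteq> 0" using inv[OF \<omega>] by (simp add: invertible_det_nz)
    ultimately have "matrix_inv (A \<omega>) *v axis j 1 =
        (\<chi> i. det (\<chi> k l. if l = i then axis j 1 $ k else A \<omega> $ k $ l) / det (A \<omega>))"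
      by (simp add: cramer)
    from arg_cong[OF this, of "\<lambda>v. v $ i"] show "matrix_inv (A \<omega>) $ i $ j = ?f \<omega>"
      by (simp add: matrix_vector_mul_component inner_axis)
  qed
  also have "?f \<in> borel_measurable F"
    by (intro borel_measurable_divide borel_measurable_det A) simp_all
  finally show ?thesis .
qed

lemma borel_measurable_potential:
  fixes N :: "'w \<Rightarrow> real^'n::finite^'n"
  assumes A [measurable]: "\<And>i j. (\<lambda>\<omega>. N \<omega> $ i $ j) \<in> borel_measurable F"
    and N: "\<And>\<omega>. \<omega> \<in> space F \<Longrightarrow> markov_matrix (N \<omega>)" "\<And>\<omega>. \<omega> \<in> space F \<Longrightarrow> indecomposable (N \<omega>)"
  shows "(\<lambda>\<omega>. potential (N \<omega>) $ i $ j) \<in> borel_measurable F"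
proof (rule borel_measurable_matrix_inv)
  show "(\<lambda>\<omega>. (mat 1 - N \<omega> + all_ones) $ i $ j) \<in> borel_measurable F" for i j by simp
  show "invertible (mat 1 - N \<omega> + all_ones)" if "\<omega> \<in> space F" for \<omega>
    using that by (intro invariant_prob_solves N)
qed

lemma borel_measurable_invariant_prob:
  fixes N :: "'w \<Rightarrow> real^'n::finite^'n"
  assumes A [measurable]: "\<And>i j. (\<lambda>\<omega>. N \<omega> $ i $ j) \<in> borel_measurable F"
    and N: "\<And>\<omega>. \<omega> \<in> space F \<Longrightarrow> markov_matrix (N \<omega>)" "\<And>\<omega>. \<omega> \<in> space F \<Longrightarrow> indecomposable (N \<omega>)"
  shows "(\<lambda>\<omega>. invariant_prob (N \<omega>) $ y) \<in> borel_measurable F"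
proof -
  have "(\<lambda>\<omega>. invariant_prob (N \<omega>) $ y) \<in> borel_measurable F \<longleftrightarrow>
      (\<lambda>\<omega>. \<Sum>x\<in>UNIV. potential (N \<omega>) $ x $ y) \<in> borel_measurable F"
  proof (rule measurable_cong)
    fix \<omega> assume "\<omega> \<in> space F"
    then have "all_ones ** potential (N \<omega>) = inv_projector (N \<omega>)" by (intro all_ones_mult_potential N)
    from arg_cong[OF this, of "\<lambda>A. A $ y $ y"]
    show "invariant_prob (N \<omega>) $ y = (\<Sum>x\<in>UNIV. potential (N \<omega>) $ x $ y)"
      by (simp add: matrix_matrix_mult_def all_ones_def inv_projector_def)
  qed
  also have "(\<lambda>\<omega>. \<Sum>x\<in>UNIV. potential (N \<omega>) $ x $ y) \<in> borel_measurable F"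
    by (intro borel_measurable_sum borel_measurable_potential A N)
  finally show ?thesis .
qed

lemma borel_measurable_pseudo_inverse:
  fixes N :: "'w \<Rightarrow> real^'n::finite^'n"
  assumes A [measurable]: "\<And>i j. (\<lambda>\<omega>. N \<omega> $ i $ j) \<in> borel_measurable F"
    and N: "\<And>\<omega>. \<omega> \<in> space F \<Longrightarrow> markov_matrix (N \<omega>)" "\<And>\<omega>. \<omega> \<in> space F \<Longrightarrow> indecomposable (N \<omega>)"
  shows "(\<lambda>\<omega>. pseudo_inverse (N \<omega>) $ x $ y) \<in> borel_measurable F"
proof -
  let ?f = "\<lambda>\<omega>. \<Sum>u\<in>UNIV. ((mat 1 :: real^'n^'n) $ x $ u - invariant_prob (N \<omega>) $ u) * potential (N \<omega>) $ u $ y"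
  have "(\<lambda>\<omega>. pseudo_inverse (N \<omega>) $ x $ y) \<in> borel_measurable F \<longleftrightarrow> ?f \<in> borel_measurable F"
    by (rule measurable_cong) (simp add: pseudo_inverse_eq N matrix_matrix_mult_def inv_projector_def)
  also have "?f \<in> borel_measurable F"
    by (intro borel_measurable_sum borel_measurable_times borel_measurable_diff borel_measurable_const
        borel_measurable_potential borel_measurable_invariant_prob A N)
  finally show ?thesis .
qed


lemma mat_act_mult: "mat_act (A ** B) f x = mat_act A (mat_act B f) (x::'e::finite)"
proof -
  have "mat_act (A ** B) f x = (\<Sum>y\<in>UNIV. \<Sum>u\<in>UNIV. (A $ x $ u * B $ u $ y) *\<^sub>R f y)"
    by (simp add: mat_act_def matrix_matrix_mult_def scaleR_sum_left)
  also have "\<dots> = (\<Sum>u\<in>UNIV. \<Sum>y\<in>UNIV. (A $ x $ u * B $ u $ y) *\<^sub>R f y)" by (rule sum.swap)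
  finally show ?thesis by (simp add: mat_act_def scaleR_sum_right)
qed

lemma mat_act_diff: "mat_act (A - B) f x = mat_act A f x - mat_act B f (x::'e::finite)"
  by (simp add: mat_act_def scaleR_diff_left sum_subtractf)

lemma mat_act_add: "mat_act (A + B) f x = mat_act A f x + mat_act B f (x::'e::finite)"
  by (simp add: mat_act_def scaleR_add_left sum.distrib)

lemma mat_act_diff_right: "mat_act A (\<lambda>y. f y - g y) x = mat_act A f x - mat_act A g (x::'e::finite)"
  by (simp add: mat_act_def scaleR_diff_right sum_subtractf)

lemma mat_act_mat_1: "mat_act (mat 1) f (x::'e::finite) = f x"
proof -
  have "mat_act (mat 1) f x = (\<Sum>y\<in>UNIV. if x = y then f y else 0)"
    unfolding mat_act_def by (rule sum.cong) (auto simp: mat_def)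
  then show ?thesis by simp
qed

lemma mat_act_inv_projector: "mat_act (inv_projector N) f (x::'e::finite) = prob_act (invariant_prob N) f"
  by (simp add: mat_act_def inv_projector_def prob_act_def)

lemma mat_norm_ge: "\<bar>A $ x $ y\<bar> \<le> mat_norm (A :: real^'e::finite^'e)"
  unfolding mat_norm_def by (rule Max_ge) (auto intro: image_eqI[of _ _ "(x, y)"])

lemma mat_norm_nonneg: "0 \<le> mat_norm (A :: real^'e::finite^'e)"
  using mat_norm_ge[of A undefined undefined] by linarith

lemma fun_norm_ge: "norm (f x) \<le> fun_norm (f :: 'e::finite \<Rightarrow> 'v::real_normed_vector)"
  unfolding fun_norm_def by (rule Max_ge) auto

lemma norm_mat_act_le:
  fixes A :: "real^'e::finite^'e" and f :: "'e \<Rightarrow> 'v::real_normed_vector"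
  assumes "\<And>y. norm (f y) \<le> K"
  shows "norm (mat_act A f x) \<le> real CARD('e) * mat_norm A * K"
proof -
  have "norm (mat_act A f x) \<le> (\<Sum>y\<in>UNIV. norm (A $ x $ y *\<^sub>R f y))" unfolding mat_act_def by (rule norm_sum)
  also have "\<dots> \<le> (\<Sum>y\<in>(UNIV::'e set). mat_norm A * K)"
    by (intro sum_mono) (auto intro!: mult_mono mat_norm_ge mat_norm_nonneg assms)
  finally show ?thesis by simp
qed

lemma norm_mat_act_markov_le:
  fixes N :: "real^'e::finite^'e" and f :: "'e \<Rightarrow> 'v::real_normed_vector"
  assumes N: "markov_matrix N" and f: "\<And>y. norm (f y) \<le> K"
  shows "norm (mat_act N f x) \<le> K"
proof -
  have "norm (mat_act N f x) \<le> (\<Sum>y\<in>UNIV. norm (N $ x $ y *\<^sub>R f y))" unfolding mat_act_def by (rule norm_sum)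
  also have "\<dots> \<le> (\<Sum>y\<in>UNIV. N $ x $ y * K)"
    using N f by (intro sum_mono) (auto simp: markov_matrix_def intro!: mult_left_mono)
  also have "\<dots> = K" using N by (simp add: markov_matrix_def sum_distrib_right[symmetric])
  finally show ?thesis .
qed

lemma norm_prob_act_diff_le:
  fixes p q :: "real^'e::finite" and f :: "'e \<Rightarrow> 'v::real_normed_vector"
  assumes "\<And>y. norm (f y) \<le> K"
  shows "norm (prob_act p f - prob_act q f) \<le> real CARD('e) * fun_norm (\<lambda>x. p $ x - q $ x) * K"
proof -
  have "prob_act p f - prob_act q f = (\<Sum>y\<in>UNIV. (p $ y - q $ y) *\<^sub>R f y)"
    by (simp add: prob_act_def scaleR_diff_left sum_subtractf)
  also have "norm \<dots> \<le> (\<Sum>y\<in>UNIV. norm ((p $ y - q $ y) *\<^sub>R f y))" by (rule norm_sum)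
  also have "\<dots> \<le> (\<Sum>y\<in>(UNIV::'e set). fun_norm (\<lambda>x. p $ x - q $ x) * K)"
  proof (intro sum_mono)
    fix y
    have "\<bar>p $ y - q $ y\<bar> \<le> fun_norm (\<lambda>x. p $ x - q $ x)"
      using fun_norm_ge[of "\<lambda>x. p $ x - q $ x" y] by simp
    moreover have "0 \<le> fun_norm (\<lambda>x. p $ x - q $ x)" using calculation by linarith
    ultimately show "norm ((p $ y - q $ y) *\<^sub>R f y) \<le> fun_norm (\<lambda>x. p $ x - q $ x) * K"
      using assms by (auto intro!: mult_mono)
  qed
  finally show ?thesis by simp
qed

text \<open>
  The function that corrects the Markovian noise.  It is \<open>N Q f\<close> and not \<open>Q f\<close> because the reward is
  attached to the next state: the mean to be corrected is \<open>N f\<close>, so the Poisson equation has the right-hand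
  side \<open>\<pi> f - N f\<close>.
\<close>

abbreviation (input) corrector :: "real^'e::finite^'e \<Rightarrow> ('e \<Rightarrow> 'v::real_vector) \<Rightarrow> 'e \<Rightarrow> 'v" where
  "corrector N f \<equiv> mat_act (N ** pseudo_inverse N) f"

lemma corrector_eq:
  assumes "markov_matrix N" "indecomposable N"
  shows "corrector N f x = mat_act (pseudo_inverse N) f x - f x + prob_act (invariant_prob N) f"
  by (simp add: pseudo_inverse_right[OF assms] mat_act_add mat_act_diff mat_act_mat_1 mat_act_inv_projector)

text \<open>
  Since \<open>N Q - Q = \<Pi> - I\<close> and \<open>N \<Pi> = \<Pi>\<close>, applying \<open>N\<close> gives \<open>N (N Q) - N Q = \<Pi> - N\<close>.
\<close>

lemma poisson_equation:
  assumes N: "markov_matrix N" "indecomposable N"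
  shows "mat_act N (corrector N f) x - corrector N f x = prob_act (invariant_prob N) f - mat_act N f x"
proof -
  let ?Q = "pseudo_inverse N" and ?P = "inv_projector N"
  have "N ** (N ** ?Q) - N ** ?Q = N ** (N ** ?Q - ?Q)" by (simp add: matrix_diff_ldistrib)
  also have "N ** ?Q - ?Q = ?P - mat 1" by (simp add: pseudo_inverse_right[OF N])
  also have "N ** (?P - mat 1) = ?P - N" by (simp add: matrix_diff_ldistrib inv_projector_mult[OF N])
  finally have "mat_act (N ** (N ** ?Q) - N ** ?Q) f x = mat_act (?P - N) f x" by simp
  then show ?thesis by (simp add: mat_act_diff mat_act_mult mat_act_inv_projector)
qed

lemma norm_corrector_le:
  fixes f :: "'e::finite \<Rightarrow> 'v::real_normed_vector"
  assumes "markov_matrix N" "\<And>y. norm (f y) \<le> K"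
  shows "norm (corrector N f x) \<le> real CARD('e) * mat_norm (pseudo_inverse N) * K"
  unfolding mat_act_mult by (intro norm_mat_act_markov_le norm_mat_act_le assms)

text \<open>
  The change of the function \<open>f\<close> is measured after applying \<open>N' Q'\<close>; the change of the matrix is
  \<open>N' Q' - N Q = (Q' - Q) + (\<Pi>' - \<Pi>)\<close>, in which the variation of \<open>N\<close> itself does not occur.
\<close>

lemma norm_corrector_diff_le:
  fixes f f' :: "'e::finite \<Rightarrow> 'v::real_normed_vector"
  assumes N: "markov_matrix N" "indecomposable N" and N': "markov_matrix N'" "indecomposable N'"
    and f: "\<And>y. norm (f y) \<le> K"
  shows "norm (corrector N' f' x - corrector N f x) \<le>
      fun_norm (mat_act (N' ** pseudo_inverse N') (\<lambda>x. f' x - f x))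
      + real CARD('e) * mat_norm (pseudo_inverse N' - pseudo_inverse N) * K
      + real CARD('e) * fun_norm (\<lambda>x. invariant_prob N' $ x - invariant_prob N $ x) * K"
proof -
  have "corrector N' f' x - corrector N f x = mat_act (N' ** pseudo_inverse N') (\<lambda>x. f' x - f x) x
      + mat_act (pseudo_inverse N' - pseudo_inverse N) f x
      + (prob_act (invariant_prob N') f - prob_act (invariant_prob N) f)"
    using corrector_eq[OF N, of f x] corrector_eq[OF N', of f x]
    by (simp add: mat_act_diff_right mat_act_diff)
  also have "norm \<dots> \<le> norm (mat_act (N' ** pseudo_inverse N') (\<lambda>x. f' x - f x) x)
      + norm (mat_act (pseudo_inverse N' - pseudo_inverse N) f x)
      + norm (prob_act (invariant_prob N') f - prob_act (invariant_prob N) f)"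
    by (intro norm_triangle_mono order_refl)
  also have "\<dots> \<le> fun_norm (mat_act (N' ** pseudo_inverse N') (\<lambda>x. f' x - f x))
      + real CARD('e) * mat_norm (pseudo_inverse N' - pseudo_inverse N) * K
      + real CARD('e) * fun_norm (\<lambda>x. invariant_prob N' $ x - invariant_prob N $ x) * K"
    by (intro add_mono fun_norm_ge norm_mat_act_le norm_prob_act_diff_le f)
  finally show ?thesis .
qed

section \<open>A strong law for martingale differences of slowly growing size\<close>

text \<open>
  Taking conditional expectations, the linear term disappears for a martingale difference, and the
  quadratic exponential remains; this replaces Hoeffding's lemma.
\<close>

lemma exp_le_add_exp_square: "exp x \<le> x + exp (x\<^sup>2)" for x :: real
proof -
  consider "x \<le> -1" | "-1 \<le> x" "x \<le> 0" | "0 \<le> x" "x \<le> 1" | "1 \<le> x" by linarith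
  then show ?thesis
  proof cases
    case 1
    have "exp x \<le> 1" using 1 by simp
    moreover have "1 + x\<^sup>2 \<le> exp (x\<^sup>2)" by (rule exp_ge_add_one_self)
    moreover have "- x \<le> x\<^sup>2" using mult_left_mono_neg[of x "-1" x] 1 by (simp add: power2_eq_square)
    ultimately show ?thesis by linarith
  next
    case 2
    have "inverse (1 + (- x) + (- x)\<^sup>2 / 2) \<ge> inverse (exp (- x))"
      using exp_lower_Taylor_quadratic[of "- x"] 2 by (intro le_imp_inverse_le) (auto intro: add_pos_nonneg)
    then have "exp x \<le> inverse (1 - x + x\<^sup>2 / 2)" by (simp add: exp_minus)
    also have "\<dots> \<le> 1 + x + x\<^sup>2"
    proof -
      have "(1 + x + x\<^sup>2) * (1 - x + x\<^sup>2 / 2) = 1 + x\<^sup>2 / 2 * (1 - x + x\<^sup>2)"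
        by (simp add: field_simps power2_eq_square)
      also have "\<dots> \<ge> 1" using 2 by simp
      finally have "1 \<le> (1 + x + x\<^sup>2) * (1 - x + x\<^sup>2 / 2)" .
      moreover have "0 < 1 - x + x\<^sup>2 / 2" using 2 by (intro add_pos_nonneg) auto
      ultimately show ?thesis by (simp add: field_simps)
    qed
    also have "\<dots> \<le> x + exp (x\<^sup>2)" using exp_ge_add_one_self[of "x\<^sup>2"] by simp
    finally show ?thesis .
  next
    case 3
    have "exp x \<le> 1 + x + x\<^sup>2" by (rule exp_bound) (use 3 in auto)
    also have "\<dots> \<le> x + exp (x\<^sup>2)" using exp_ge_add_one_self[of "x\<^sup>2"] by simp
    finally show ?thesis .
  next
    case 4
    have "x \<le> x\<^sup>2" using mult_left_mono[of 1 x x] 4 by (simp add: power2_eq_square)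
    then have "exp x \<le> exp (x\<^sup>2)" by (simp only: exp_le_cancel_iff)
    then show ?thesis using 4 by linarith
  qed
qed

text \<open>
  The function \<open>n / ln n\<close> is, up to the factor \<open>2\<close>, increasing from \<open>3\<close> on, so a bound for \<open>a j\<close> in terms
  of \<open>j\<close> becomes one in terms of every later \<open>n\<close>.
\<close>

lemma running_max_growth:
  fixes a :: "nat \<Rightarrow> real"
  assumes lim: "(\<lambda>n. (a n)\<^sup>2 * ln (real n) / real n) \<longlonglongrightarrow> 0" and "\<delta> > 0"
  shows "\<forall>\<^sub>F n in sequentially. \<forall>j<n. (a j)\<^sup>2 \<le> \<delta> * real n / ln (real n)"
proof -
  have "\<forall>\<^sub>F n in sequentially. (a n)\<^sup>2 * ln (real n) / real n < \<delta> / 2"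
    using order_tendstoD(2)[OF lim, of "\<delta> / 2"] \<open>\<delta> > 0\<close> by simp
  then obtain N0 where N0: "\<And>n. n \<ge> N0 \<Longrightarrow> (a n)\<^sup>2 * ln (real n) / real n < \<delta> / 2"
    by (auto simp: eventually_sequentially)
  define N where "N = max N0 3"
  define K where "K = Max ((\<lambda>j. (a j)\<^sup>2) ` {..N})"
  have "filterlim (\<lambda>n. \<delta> * real n / ln (real n)) at_top sequentially"
    using \<open>\<delta> > 0\<close> by real_asymp
  then have "\<forall>\<^sub>F n in sequentially. K \<le> \<delta> * real n / ln (real n)" by (simp add: filterlim_at_top)
  moreover have "\<forall>\<^sub>F n in sequentially. n \<ge> N" by (rule eventually_ge_at_top)
  ultimately show ?thesis
  proof eventually_elim
    case (elim n)
    show ?case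
    proof (intro allI impI)
      fix j assume "j < n"
      show "(a j)\<^sup>2 \<le> \<delta> * real n / ln (real n)"
      proof (cases "j \<le> N")
        case True
        then have "(a j)\<^sup>2 \<le> K" unfolding K_def by (intro Max_ge) auto
        then show ?thesis using elim by linarith
      next
        case False
        then have j3: "real j \<ge> 3" "j \<ge> N0" by (auto simp: N_def)
        have jn: "real j \<le> real n" using \<open>j < n\<close> by simp
        have ln1: "1 \<le> ln (real j)"
        proof -
          have "exp 1 \<le> (3::real)" using exp_le by simp
          then show ?thesis using j3 by (simp add: ln_ge_iff)
        qed
        have "ln (real j) \<le> ln (real n)" by (rule ln_mono) (use j3 jn in linarith)+
        then have lnn: "1 \<le> ln (real n)" using ln1 by linarith
        \<comment> \<open>Compares \<open>j / ln j\<close> with \<open>n / ln n\<close> by the concavity of the logarithm; \<open>ln j \<ge> 1\<close> absorbs the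
          remaining terms.\<close>
        have "ln (real n / real j) \<le> real n / real j - 1" using j3 jn by (intro ln_le_minus_one) auto
        then have "ln (real n) \<le> ln (real j) + real n / real j - 1" using j3 jn by (simp add: ln_div)
        then have "real j * ln (real n) \<le> real j * (ln (real j) + real n / real j - 1)"
          using j3 by (intro mult_left_mono) auto
        also have "\<dots> = real j * ln (real j) + real n - real j" using j3 by (simp add: algebra_simps)
        also have "\<dots> \<le> real n * ln (real j) + real n * ln (real j)"
        proof -
          have "real j * ln (real j) \<le> real n * ln (real j)" using jn ln1 by (intro mult_right_mono) auto
          moreover have "real n * 1 \<le> real n * ln (real j)" using ln1 by (intro mult_left_mono) auto
          ultimately show ?thesis by linarith
        qed
        finally have key: "real j * ln (real n) \<le> 2 * real n * ln (real j)" by simp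
        have "(a j)\<^sup>2 * ln (real j) \<le> \<delta> / 2 * real j"
          using N0[OF j3(2)] j3 by (simp add: field_simps)
        then have "(a j)\<^sup>2 * ln (real j) * ln (real n) \<le> \<delta> / 2 * (real j * ln (real n))"
          using lnn mult_right_mono[of "(a j)\<^sup>2 * ln (real j)" "\<delta> / 2 * real j" "ln (real n)"] by (simp add: mult.assoc)
        also have "\<dots> \<le> \<delta> / 2 * (2 * real n * ln (real j))" using key \<open>\<delta> > 0\<close> by (intro mult_left_mono) auto
        finally have "((a j)\<^sup>2 * ln (real n)) * ln (real j) \<le> (\<delta> * real n) * ln (real j)" by (simp add: mult_ac)
        then have "(a j)\<^sup>2 * ln (real n) \<le> \<delta> * real n" using ln1 by (simp add: mult_le_cancel_right)
        then show ?thesis using lnn by (simp add: field_simps)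
      qed
    qed
  qed
qed

context prob_space
begin

lemma integrable_bounded:
  fixes f :: "'a \<Rightarrow> real"
  assumes "f \<in> borel_measurable M" "\<And>\<omega>. \<omega> \<in> space M \<Longrightarrow> \<bar>f \<omega>\<bar> \<le> K"
  shows "integrable M f"
  using assms by (intro integrable_const_bound[of _ K]) auto

text \<open>
  The hypothesis \<open>orth\<close> expresses that \<open>\<xi> j\<close> has conditional mean \<open>0\<close> given \<open>F j\<close>, tested against bounded
  functions.  Each step of the induction multiplies the exponential moment by at most
  \<open>exp ((l * b)\<^sup>2)\<close>.
\<close>

lemma exp_martingale_bound:
  fixes \<xi> :: "nat \<Rightarrow> 'a \<Rightarrow> real"
  assumes sub: "\<And>j. subalgebra M (F j)" and mono: "\<And>i j. i \<le> j \<Longrightarrow> sets (F i) \<subseteq> sets (F j)"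
    and meas: "\<And>j. \<xi> j \<in> borel_measurable (F (Suc j))"
    and bnd: "\<And>j \<omega>. \<omega> \<in> space M \<Longrightarrow> \<bar>\<xi> j \<omega>\<bar> \<le> b"
    and orth: "\<And>j Z K. Z \<in> borel_measurable (F j) \<Longrightarrow> (\<And>\<omega>. \<omega> \<in> space M \<Longrightarrow> \<bar>Z \<omega>\<bar> \<le> K) \<Longrightarrow> (\<integral>\<omega>. Z \<omega> * \<xi> j \<omega> \<partial>M) = 0"
  shows "(\<integral>\<omega>. exp (l * (\<Sum>j<n. \<xi> j \<omega>)) \<partial>M) \<le> exp (real n * (l * b)\<^sup>2)"
proof (induction n)
  case 0 show ?case by (simp add: prob_space)
next
  case (Suc n)
  have spF: "space (F j) = space M" for j using sub by (simp add: subalgebra_def)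
  have subF: "subalgebra (F j) (F i)" if "i \<le> j" for i j
    using mono[OF that] by (simp add: subalgebra_def spF)
  have measM: "\<xi> j \<in> borel_measurable M" for j using measurable_from_subalg[OF sub meas] .
  have measF: "\<xi> j \<in> borel_measurable (F n)" if "j < n" for j
    using measurable_from_subalg[OF subF meas] that by simp
  define Z where "Z = (\<lambda>\<omega>. exp (l * (\<Sum>j<n. \<xi> j \<omega>)))"
  have ZF: "Z \<in> borel_measurable (F n)" unfolding Z_def
    by (intro borel_measurable_exp[THEN measurable_compose[rotated]] borel_measurable_times borel_measurable_const borel_measurable_sum measF) auto
  have ZM [measurable]: "Z \<in> borel_measurable M" by (rule measurable_from_subalg[OF sub ZF])
  have [measurable]: "\<xi> n \<in> borel_measurable M" by (rule measM)
  have Z0: "Z \<omega> \<ge> 0" for \<omega> by (simp add: Z_def)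
  have Zb: "\<bar>Z \<omega>\<bar> \<le> exp (\<bar>l\<bar> * (real n * b))" if "\<omega> \<in> space M" for \<omega>
  proof -
    have "\<bar>\<Sum>j<n. \<xi> j \<omega>\<bar> \<le> (\<Sum>j<n. \<bar>\<xi> j \<omega>\<bar>)" by (rule sum_abs)
    also have "\<dots> \<le> (\<Sum>j<n. b)" by (intro sum_mono bnd that)
    finally have "\<bar>l * (\<Sum>j<n. \<xi> j \<omega>)\<bar> \<le> \<bar>l\<bar> * (real n * b)" by (simp add: abs_mult mult_left_mono)
    then show ?thesis by (simp add: Z_def)
  qed
  have lb: "\<bar>l * \<xi> n \<omega>\<bar> \<le> \<bar>l\<bar> * b" if "\<omega> \<in> space M" for \<omega>
    using bnd[OF that] by (simp add: abs_mult mult_left_mono)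
  have sq: "(l * \<xi> n \<omega>)\<^sup>2 \<le> (l * b)\<^sup>2" if "\<omega> \<in> space M" for \<omega>
    using power_mono[OF lb[OF that], of 2] by (simp add: power_mult_distrib)
  have intZ: "integrable M Z" by (rule integrable_bounded[OF ZM Zb])
  have intZx: "integrable M (\<lambda>\<omega>. Z \<omega> * \<xi> n \<omega>)"
  proof (rule integrable_bounded)
    show "\<bar>Z \<omega> * \<xi> n \<omega>\<bar> \<le> exp (\<bar>l\<bar> * (real n * b)) * b" if "\<omega> \<in> space M" for \<omega>
      unfolding abs_mult using Zb[OF that] bnd[OF that] by (intro mult_mono) auto
  qed simp
  have "(\<integral>\<omega>. exp (l * (\<Sum>j<Suc n. \<xi> j \<omega>)) \<partial>M) = (\<integral>\<omega>. Z \<omega> * exp (l * \<xi> n \<omega>) \<partial>M)"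
    by (simp add: Z_def distrib_left exp_add)
  also have "\<dots> \<le> (\<integral>\<omega>. l * (Z \<omega> * \<xi> n \<omega>) + exp ((l * b)\<^sup>2) * Z \<omega> \<partial>M)"
  proof (rule integral_mono)
    show "integrable M (\<lambda>\<omega>. Z \<omega> * exp (l * \<xi> n \<omega>))"
    proof (rule integrable_bounded)
      show "\<bar>Z \<omega> * exp (l * \<xi> n \<omega>)\<bar> \<le> exp (\<bar>l\<bar> * (real n * b)) * exp (\<bar>l\<bar> * b)" if "\<omega> \<in> space M" for \<omega>
        unfolding abs_mult using Zb[OF that] lb[OF that] by (intro mult_mono) auto
    qed simp
    show "integrable M (\<lambda>\<omega>. l * (Z \<omega> * \<xi> n \<omega>) + exp ((l * b)\<^sup>2) * Z \<omega>)" using intZ intZx by simp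
    fix \<omega> assume \<omega>: "\<omega> \<in> space M"
    have "exp (l * \<xi> n \<omega>) \<le> l * \<xi> n \<omega> + exp ((l * \<xi> n \<omega>)\<^sup>2)" by (rule exp_le_add_exp_square)
    also have "\<dots> \<le> l * \<xi> n \<omega> + exp ((l * b)\<^sup>2)" using sq[OF \<omega>] by simp
    finally have "Z \<omega> * exp (l * \<xi> n \<omega>) \<le> Z \<omega> * (l * \<xi> n \<omega> + exp ((l * b)\<^sup>2))" by (rule mult_left_mono[OF _ Z0])
    then show "Z \<omega> * exp (l * \<xi> n \<omega>) \<le> l * (Z \<omega> * \<xi> n \<omega>) + exp ((l * b)\<^sup>2) * Z \<omega>" by (simp add: algebra_simps)
  qed
  also have "\<dots> = exp ((l * b)\<^sup>2) * (\<integral>\<omega>. Z \<omega> \<partial>M)"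
    using intZ intZx orth[OF ZF Zb] by simp
  also have "\<dots> \<le> exp ((l * b)\<^sup>2) * exp (real n * (l * b)\<^sup>2)"
    using Suc.IH unfolding Z_def by (intro mult_left_mono) auto
  also have "\<dots> = exp (real (Suc n) * (l * b)\<^sup>2)" by (simp add: mult_exp_exp algebra_simps)
  finally show ?case .
qed

lemma martingale_upper_tail:
  fixes \<xi> :: "nat \<Rightarrow> 'a \<Rightarrow> real"
  assumes sub: "\<And>j. subalgebra M (F j)" and mono: "\<And>i j. i \<le> j \<Longrightarrow> sets (F i) \<subseteq> sets (F j)"
    and meas: "\<And>j. \<xi> j \<in> borel_measurable (F (Suc j))"
    and bnd: "\<And>j \<omega>. \<omega> \<in> space M \<Longrightarrow> \<bar>\<xi> j \<omega>\<bar> \<le> b"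
    and orth: "\<And>j Z K. Z \<in> borel_measurable (F j) \<Longrightarrow> (\<And>\<omega>. \<omega> \<in> space M \<Longrightarrow> \<bar>Z \<omega>\<bar> \<le> K) \<Longrightarrow> (\<integral>\<omega>. Z \<omega> * \<xi> j \<omega> \<partial>M) = 0"
    and "b > 0" "n > 0" "a > 0"
  shows "prob {\<omega>\<in>space M. (\<Sum>j<n. \<xi> j \<omega>) \<ge> a * real n} \<le> exp (- (a\<^sup>2 * real n / (4 * b\<^sup>2)))"
proof -
  \<comment> \<open>The parameter that minimises \<open>n * (l * b)\<^sup>2 - l * a * n\<close>.\<close>
  define l where "l = a / (2 * b\<^sup>2)"
  have l: "l > 0" using assms by (simp add: l_def)
  let ?S = "\<lambda>\<omega>. \<Sum>j<n. \<xi> j \<omega>"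
  have [measurable]: "\<xi> j \<in> borel_measurable M" for j using measurable_from_subalg[OF sub meas] .
  have Sb: "\<bar>?S \<omega>\<bar> \<le> real n * b" if "\<omega> \<in> space M" for \<omega>
  proof -
    have "\<bar>?S \<omega>\<bar> \<le> (\<Sum>j<n. \<bar>\<xi> j \<omega>\<bar>)" by (rule sum_abs)
    also have "\<dots> \<le> (\<Sum>j<n. b)" by (intro sum_mono bnd that)
    finally show ?thesis by simp
  qed
  have int: "integrable M (\<lambda>\<omega>. exp (l * ?S \<omega>))"
  proof (rule integrable_bounded)
    show "\<bar>exp (l * ?S \<omega>)\<bar> \<le> exp (l * (real n * b))" if "\<omega> \<in> space M" for \<omega>
      using Sb[OF that] l by simp
  qed simp
  have "prob {\<omega>\<in>space M. ?S \<omega> \<ge> a * real n} = (\<integral>\<omega>. indicator {\<omega>\<in>space M. ?S \<omega> \<ge> a * real n} \<omega> \<partial>M)"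
    by simp
  also have "\<dots> \<le> (\<integral>\<omega>. exp (- (l * (a * real n))) * exp (l * ?S \<omega>) \<partial>M)"
  proof (rule integral_mono)
    show "integrable M (indicat_real {\<omega>\<in>space M. ?S \<omega> \<ge> a * real n})" by (intro integrable_real_indicator) (auto simp: emeasure_eq_measure)
    show "integrable M (\<lambda>\<omega>. exp (- (l * (a * real n))) * exp (l * ?S \<omega>))" using int by simp
    fix \<omega> assume "\<omega> \<in> space M"
    show "indicat_real {\<omega>\<in>space M. ?S \<omega> \<ge> a * real n} \<omega> \<le> exp (- (l * (a * real n))) * exp (l * ?S \<omega>)"
      using l by (auto simp: indicator_def mult_exp_exp)
  qed
  also have "\<dots> = exp (- (l * (a * real n))) * (\<integral>\<omega>. exp (l * ?S \<omega>) \<partial>M)" using int by simp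
  also have "\<dots> \<le> exp (- (l * (a * real n))) * exp (real n * (l * b)\<^sup>2)"
    by (intro mult_left_mono exp_martingale_bound[of F \<xi> b l n, OF sub mono meas bnd orth]) auto
  also have "\<dots> = exp (- (a\<^sup>2 * real n / (4 * b\<^sup>2)))"
    using \<open>b > 0\<close> by (simp add: mult_exp_exp l_def power2_eq_square field_simps)
  finally show ?thesis .
qed

text \<open>
  For fixed \<open>n\<close> all differences with index below \<open>n\<close> are truncated on the event \<open>A j > b n\<close>, which is
  determined by the past, so they remain martingale differences.  The level \<open>b n\<close> is of order
  \<open>sqrt (n / ln n)\<close>: then the exponential inequality yields tails of order \<open>n\<^sup>-\<^sup>2\<close>, and by the growth
  condition the truncation is eventually without effect.  The hypothesis \<open>orth\<close> tests only with functions
  \<open>Z\<close> for which \<open>Z * \<xi> j\<close> is bounded, since \<open>\<xi> j\<close> itself may fail to be integrable.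
\<close>

theorem martingale_slln:
  fixes \<xi> :: "nat \<Rightarrow> 'a \<Rightarrow> real" and A :: "nat \<Rightarrow> 'a \<Rightarrow> real"
  assumes sub: "\<And>j. subalgebra M (F j)" and mono: "\<And>i j. i \<le> j \<Longrightarrow> sets (F i) \<subseteq> sets (F j)"
    and meas: "\<And>j. \<xi> j \<in> borel_measurable (F (Suc j))"
    and Ameas: "\<And>j. A j \<in> borel_measurable (F j)"
    and bnd: "\<And>j \<omega>. \<omega> \<in> space M \<Longrightarrow> \<bar>\<xi> j \<omega>\<bar> \<le> A j \<omega>"
    and orth: "\<And>j Z K. Z \<in> borel_measurable (F j) \<Longrightarrow> (\<And>\<omega>. \<omega> \<in> space M \<Longrightarrow> \<bar>Z \<omega>\<bar> \<le> K)
        \<Longrightarrow> (\<And>\<omega>. \<omega> \<in> space M \<Longrightarrow> \<bar>Z \<omega>\<bar> * A j \<omega> \<le> K) \<Longrightarrow> (\<integral>\<omega>. Z \<omega> * \<xi> j \<omega> \<partial>M) = 0"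
    and growth: "AE \<omega> in M. (\<lambda>n. (A n \<omega>)\<^sup>2 * ln (real n) / real n) \<longlonglongrightarrow> 0"
  shows "AE \<omega> in M. (\<lambda>n. (\<Sum>j<n. \<xi> j \<omega>) / real n) \<longlonglongrightarrow> 0"
proof -
  have measM [measurable]: "\<xi> j \<in> borel_measurable M" for j using measurable_from_subalg[OF sub meas] .
  have AM [measurable]: "A j \<in> borel_measurable M" for j using measurable_from_subalg[OF sub Ameas] .
  have spF: "space (F j) = space M" for j using sub by (simp add: subalgebra_def)
  have A0: "0 \<le> A j \<omega>" if "\<omega> \<in> space M" for j \<omega> using bnd[OF that, of j] by linarith
  have small: "AE \<omega> in M. \<forall>\<^sub>F n in sequentially. \<bar>\<Sum>j<n. \<xi> j \<omega>\<bar> < a * real n" if a: "a > 0" for a :: real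
  proof -
    \<comment> \<open>The factor \<open>8\<close> makes the tail bound \<open>exp (- a\<^sup>2 n / (4 (b n)\<^sup>2))\<close> equal to \<open>n\<^sup>-\<^sup>2\<close>.\<close>
    define b where "b n = sqrt (a\<^sup>2 / 8 * real n / ln (real n))" for n :: nat
    define \<eta> where "\<eta> n j \<omega> = indicat_real {\<omega>\<in>space M. A j \<omega> \<le> b n} \<omega> * \<xi> j \<omega>" for n j \<omega>
    define E where "E n = (if n < 2 then {} else {\<omega>\<in>space M. (\<Sum>j<n. \<eta> n j \<omega>) \<ge> a * real n} \<union> {\<omega>\<in>space M. (\<Sum>j<n. - \<eta> n j \<omega>) \<ge> a * real n})" for n
    have setF: "{\<omega>\<in>space M. A j \<omega> \<le> b n} \<in> sets (F j)" for j n
    proof -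
      have "{\<omega>\<in>space (F j). A j \<omega> \<le> b n} \<in> sets (F j)" using Ameas[of j] by measurable
      then show ?thesis by (simp add: spF)
    qed
    have etaM [measurable]: "\<eta> n j \<in> borel_measurable M" for n j unfolding \<eta>_def by measurable
    have tail: "prob (E n) \<le> 2 / (real n)\<^sup>2" for n
    proof (cases "n < 2")
      case False
      then have n: "n \<ge> 2" by simp
      have lnn: "ln (real n) > 0" using n by simp
      have b: "b n > 0" using a n lnn by (simp add: b_def)
      have b2: "(b n)\<^sup>2 = a\<^sup>2 / 8 * real n / ln (real n)" using a n lnn by (simp add: b_def)
      have F1: "indicat_real {\<omega>\<in>space M. A j \<omega> \<le> b n} \<in> borel_measurable (F j)" for j
        using setF by simp
      have subS: "subalgebra (F (Suc j)) (F j)" for j using mono[of j "Suc j"] by (simp add: subalgebra_def spF)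
      have m: "\<eta> n j \<in> borel_measurable (F (Suc j))" for j
        unfolding \<eta>_def by (intro borel_measurable_times meas measurable_from_subalg[OF subS F1])
      have bd: "\<bar>\<eta> n j \<omega>\<bar> \<le> b n" if "\<omega> \<in> space M" for j \<omega>
        using bnd[OF that, of j] b by (auto simp: \<eta>_def indicator_def)
      have o: "(\<integral>\<omega>. Z \<omega> * \<eta> n j \<omega> \<partial>M) = 0"
        if Z: "Z \<in> borel_measurable (F j)" "\<And>\<omega>. \<omega> \<in> space M \<Longrightarrow> \<bar>Z \<omega>\<bar> \<le> K" for Z K j
      proof -
        let ?Z = "\<lambda>\<omega>. Z \<omega> * indicat_real {\<omega>\<in>space M. A j \<omega> \<le> b n} \<omega>"
        have K0: "0 \<le> K" using Z(2) not_empty by (meson abs_ge_zero ex_in_conv order_trans)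
        have "(\<integral>\<omega>. ?Z \<omega> * \<xi> j \<omega> \<partial>M) = 0"
        proof (rule orth[of ?Z j "K * max 1 (b n)"])
          show "?Z \<in> borel_measurable (F j)" by (intro borel_measurable_times Z(1) F1)
          fix \<omega> assume \<omega>: "\<omega> \<in> space M"
          have "K * 1 \<le> K * max 1 (b n)" by (rule mult_left_mono[OF _ K0]) simp
          moreover from this have "0 \<le> K * max 1 (b n)" using K0 by simp
          ultimately have K1: "K \<le> K * max 1 (b n)" "0 \<le> K * max 1 (b n)" by simp_all
          then show "\<bar>?Z \<omega>\<bar> \<le> K * max 1 (b n)" using Z(2)[OF \<omega>] K1 by (auto simp: indicator_def)
          have "\<bar>Z \<omega>\<bar> * A j \<omega> \<le> K * max 1 (b n)" if "A j \<omega> \<le> b n"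
            using Z(2)[OF \<omega>] that A0[OF \<omega>] K0 by (intro mult_mono) auto
          then show "\<bar>?Z \<omega>\<bar> * A j \<omega> \<le> K * max 1 (b n)"
            using K1 by (auto simp: indicator_def)
        qed
        then show ?thesis by (simp add: \<eta>_def mult.assoc)
      qed
      have ex: "exp (- (a\<^sup>2 * real n / (4 * (b n)\<^sup>2))) = 1 / (real n)\<^sup>2"
      proof -
        have "a\<^sup>2 * real n / (4 * (b n)\<^sup>2) = 2 * ln (real n)" unfolding b2 using a n lnn by (simp add: field_simps)
        then have "exp (- (a\<^sup>2 * real n / (4 * (b n)\<^sup>2))) = inverse (exp (2 * ln (real n)))"
          by (simp only: exp_minus)
        also have "exp (2 * ln (real n)) = (real n)\<^sup>2"
          using n by (simp only: mult_2 exp_add) (simp add: power2_eq_square)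
        also have "inverse ((real n)\<^sup>2) = 1 / (real n)\<^sup>2" by (simp add: divide_inverse)
        finally show ?thesis .
      qed
      have "prob {\<omega>\<in>space M. (\<Sum>j<n. \<eta> n j \<omega>) \<ge> a * real n} \<le> 1 / (real n)\<^sup>2"
        unfolding ex[symmetric]
      proof (rule martingale_upper_tail[of F "\<eta> n" "b n" n a, OF sub mono m bd _ b])
        fix j and Z :: "'a \<Rightarrow> real" and K assume "Z \<in> borel_measurable (F j)" "\<And>\<omega>. \<omega> \<in> space M \<Longrightarrow> \<bar>Z \<omega>\<bar> \<le> K"
        then show "(\<integral>\<omega>. Z \<omega> * \<eta> n j \<omega> \<partial>M) = 0" by (rule o)
      qed (use n a in auto)
      moreover have "prob {\<omega>\<in>space M. (\<Sum>j<n. - \<eta> n j \<omega>) \<ge> a * real n} \<le> 1 / (real n)\<^sup>2"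
      proof -
        have m': "(\<lambda>\<omega>. - \<eta> n j \<omega>) \<in> borel_measurable (F (Suc j))" for j using m by simp
        have bd': "\<bar>- \<eta> n j \<omega>\<bar> \<le> b n" if "\<omega> \<in> space M" for j \<omega> using bd[OF that] by simp
        show ?thesis
          unfolding ex[symmetric]
        proof (rule martingale_upper_tail[of F "\<lambda>j \<omega>. - \<eta> n j \<omega>" "b n" n a, OF sub mono m' bd' _ b])
          fix j and Z :: "'a \<Rightarrow> real" and K assume "Z \<in> borel_measurable (F j)" "\<And>\<omega>. \<omega> \<in> space M \<Longrightarrow> \<bar>Z \<omega>\<bar> \<le> K"
          then have "(\<integral>\<omega>. Z \<omega> * \<eta> n j \<omega> \<partial>M) = 0" by (rule o)
          then show "(\<integral>\<omega>. Z \<omega> * - \<eta> n j \<omega> \<partial>M) = 0" by simp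
        qed (use n a in auto)
      qed
      ultimately have "prob {\<omega>\<in>space M. (\<Sum>j<n. \<eta> n j \<omega>) \<ge> a * real n}
          + prob {\<omega>\<in>space M. (\<Sum>j<n. - \<eta> n j \<omega>) \<ge> a * real n} \<le> 2 / (real n)\<^sup>2" by simp
      moreover have "prob (E n) \<le> prob {\<omega>\<in>space M. (\<Sum>j<n. \<eta> n j \<omega>) \<ge> a * real n}
          + prob {\<omega>\<in>space M. (\<Sum>j<n. - \<eta> n j \<omega>) \<ge> a * real n}"
        unfolding E_def using False by (simp only: if_False) (intro measure_Un_le; measurable)
      ultimately show ?thesis by linarith
    qed (simp add: E_def)
    have Es [measurable]: "E n \<in> sets M" for n
    proof -
      have "{\<omega>\<in>space M. (\<Sum>j<n. \<eta> n j \<omega>) \<ge> a * real n} \<in> sets M"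
        "{\<omega>\<in>space M. (\<Sum>j<n. - \<eta> n j \<omega>) \<ge> a * real n} \<in> sets M" by measurable
      then show ?thesis unfolding E_def by simp
    qed
    have "AE \<omega> in M. \<forall>\<^sub>F n in sequentially. \<omega> \<in> space M - E n"
    proof (rule borel_cantelli_AE1)
      show "summable (\<lambda>n. prob (E n))"
      proof (rule summable_comparison_test)
        show "summable (\<lambda>n. 2 / (real n)\<^sup>2)"
          using summable_mult[OF inverse_power_summable[of 2], of "2::real"] by (simp add: divide_inverse)
        show "\<exists>N. \<forall>n\<ge>N. norm (prob (E n)) \<le> 2 / (real n)\<^sup>2" using tail by auto
      qed
    qed (auto simp: emeasure_eq_measure)
    with growth AE_space show ?thesis
    proof eventually_elim
      case (elim \<omega>)
      have "\<forall>\<^sub>F n in sequentially. \<forall>j<n. (A j \<omega>)\<^sup>2 \<le> a\<^sup>2 / 8 * real n / ln (real n)"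
        using elim a by (intro running_max_growth) auto
      then show ?case using elim(3) eventually_ge_at_top[of 2]
      proof eventually_elim
        case (elim n)
        have "A j \<omega> \<le> b n" if "j < n" for j
          using elim(1) that unfolding b_def by (intro real_le_rsqrt) auto
        then have "\<eta> n j \<omega> = \<xi> j \<omega>" if "j < n" for j
          using that \<open>\<omega> \<in> space M\<close> by (simp add: \<eta>_def)
        then have "(\<Sum>j<n. \<eta> n j \<omega>) = (\<Sum>j<n. \<xi> j \<omega>)" "(\<Sum>j<n. - \<eta> n j \<omega>) = - (\<Sum>j<n. \<xi> j \<omega>)"
          by (auto simp: sum_negf)
        then show ?case using elim(2,3) by (auto simp: E_def abs_less_iff not_le)
      qed
    qed
  qed
  have "AE \<omega> in M. \<forall>m::nat. \<forall>\<^sub>F n in sequentially. \<bar>\<Sum>j<n. \<xi> j \<omega>\<bar> < inverse (real (Suc m)) * real n"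
    unfolding AE_all_countable by (intro allI small) simp
  then show ?thesis
  proof eventually_elim
    case (elim \<omega>)
    show ?case
    proof (rule tendstoI)
      fix e :: real assume "e > 0"
      obtain m where m: "inverse (real (Suc m)) < e" using reals_Archimedean[OF \<open>e > 0\<close>] by blast
      show "\<forall>\<^sub>F n in sequentially. dist ((\<Sum>j<n. \<xi> j \<omega>) / real n) 0 < e"
        using elim[rule_format, of m] eventually_gt_at_top[of 0]
      proof eventually_elim
        case (elim n)
        then have "\<bar>\<Sum>j<n. \<xi> j \<omega>\<bar> / real n < inverse (real (Suc m))" by (simp add: divide_less_eq)
        then show ?case using m by simp
      qed
    qed
  qed
qed

end

section \<open>Conditional expectations of one step\<close>

lemma integral_transition:
  fixes X1 :: "'w \<Rightarrow> 'e::finite" and q f :: "'w \<Rightarrow> 'e \<Rightarrow> real"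
  assumes P: "prob_space P" and sub: "subalgebra P G"
    and X1: "X1 \<in> measurable P (count_space UNIV)"
    and q: "\<And>x. AE \<omega> in P. real_cond_exp P G (indicat_real {\<omega>. X1 \<omega> = x}) \<omega> = q \<omega> x"
    and qG: "\<And>x. (\<lambda>\<omega>. q \<omega> x) \<in> borel_measurable G"
    and fG: "\<And>x. (\<lambda>\<omega>. f \<omega> x) \<in> borel_measurable G"
    and fb: "\<And>\<omega> x. \<omega> \<in> space P \<Longrightarrow> \<bar>f \<omega> x\<bar> \<le> L"
  shows "integrable P (\<lambda>\<omega>. f \<omega> (X1 \<omega>))" "integrable P (\<lambda>\<omega>. \<Sum>x\<in>UNIV. q \<omega> x * f \<omega> x)"
    "(\<integral>\<omega>. f \<omega> (X1 \<omega>) \<partial>P) = (\<integral>\<omega>. (\<Sum>x\<in>UNIV. q \<omega> x * f \<omega> x) \<partial>P)"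
proof -
  interpret prob_space P by fact
  interpret finite_measure_subalgebra P G by unfold_locales (rule sub)
  note X1 [measurable]
  have fP [measurable]: "(\<lambda>\<omega>. f \<omega> x) \<in> borel_measurable P" for x by (rule measurable_from_subalg[OF sub fG])
  have qP [measurable]: "(\<lambda>\<omega>. q \<omega> x) \<in> borel_measurable P" for x by (rule measurable_from_subalg[OF sub qG])
  have iP [measurable]: "indicat_real {\<omega>. X1 \<omega> = x} \<in> borel_measurable P" for x
    unfolding indicator_def by measurable
  have L0: "0 \<le> L" using fb not_empty by (meson abs_ge_zero ex_in_conv order_trans)
  have int: "integrable P (\<lambda>\<omega>. f \<omega> x * indicat_real {\<omega>. X1 \<omega> = x} \<omega>)" for x
    by (rule integrable_const_bound[of _ L]) (use fb L0 in \<open>auto simp: indicator_def\<close>)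
  have dec: "f \<omega> (X1 \<omega>) = (\<Sum>x\<in>UNIV. f \<omega> x * indicat_real {\<omega>. X1 \<omega> = x} \<omega>)" for \<omega>
  proof -
    have "(\<Sum>x\<in>UNIV. f \<omega> x * indicat_real {\<omega>. X1 \<omega> = x} \<omega>) = (\<Sum>x\<in>UNIV. if X1 \<omega> = x then f \<omega> x else 0)"
      by (rule sum.cong) (auto simp: indicator_def)
    then show ?thesis by simp
  qed
  have step: "integrable P (\<lambda>\<omega>. q \<omega> x * f \<omega> x) \<and>
      (\<integral>\<omega>. f \<omega> x * indicat_real {\<omega>. X1 \<omega> = x} \<omega> \<partial>P) = (\<integral>\<omega>. q \<omega> x * f \<omega> x \<partial>P)" for x
  proof -
    have ae: "AE \<omega> in P. f \<omega> x * real_cond_exp P G (indicat_real {\<omega>. X1 \<omega> = x}) \<omega> = q \<omega> x * f \<omega> x"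
      using q[of x] by eventually_elim simp
    note r = real_cond_exp_intg[OF int[of x] fG iP]
    have "integrable P (\<lambda>\<omega>. q \<omega> x * f \<omega> x)"
      using integrable_cong_AE_imp[OF r(1) _ ae] by simp
    moreover have "(\<integral>\<omega>. f \<omega> x * real_cond_exp P G (indicat_real {\<omega>. X1 \<omega> = x}) \<omega> \<partial>P) = (\<integral>\<omega>. q \<omega> x * f \<omega> x \<partial>P)"
      by (rule integral_cong_AE[OF _ _ ae]) (use r(1) in \<open>auto\<close>)
    ultimately show ?thesis using r(2) by simp
  qed
  show "integrable P (\<lambda>\<omega>. f \<omega> (X1 \<omega>))" unfolding dec by (intro Bochner_Integration.integrable_sum int)
  show "integrable P (\<lambda>\<omega>. \<Sum>x\<in>UNIV. q \<omega> x * f \<omega> x)" using step by (intro Bochner_Integration.integrable_sum) blast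
  show "(\<integral>\<omega>. f \<omega> (X1 \<omega>) \<partial>P) = (\<integral>\<omega>. (\<Sum>x\<in>UNIV. q \<omega> x * f \<omega> x) \<partial>P)"
  proof -
    have "(\<integral>\<omega>. f \<omega> (X1 \<omega>) \<partial>P) = (\<Sum>x\<in>UNIV. \<integral>\<omega>. f \<omega> x * indicat_real {\<omega>. X1 \<omega> = x} \<omega> \<partial>P)"
      unfolding dec by (rule Bochner_Integration.integral_sum) (rule int)
    also have "\<dots> = (\<Sum>x\<in>UNIV. \<integral>\<omega>. q \<omega> x * f \<omega> x \<partial>P)" using step by simp
    also have "\<dots> = (\<integral>\<omega>. (\<Sum>x\<in>UNIV. q \<omega> x * f \<omega> x) \<partial>P)"
      by (rule Bochner_Integration.integral_sum[symmetric]) (use step in blast)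
    finally show ?thesis .
  qed
qed

text \<open>
  Where the transition probability \<open>q\<close> vanishes, \<open>g\<close> is arbitrary; there the conditional expectation of the
  bounded reward on the event \<open>X1 = x\<close> vanishes too, because it is dominated by a multiple of \<open>q\<close>.
\<close>

lemma integral_reward:
  fixes X1 :: "'w \<Rightarrow> 'e::finite" and q :: "'w \<Rightarrow> 'e \<Rightarrow> real" and V1 :: "'w \<Rightarrow> 'v::euclidean_space"
  assumes P: "prob_space P" and sub: "subalgebra P G"
    and X1: "X1 \<in> measurable P (count_space UNIV)" and V1: "V1 \<in> borel_measurable P"
    and Vb: "\<And>\<omega>. \<omega> \<in> space P \<Longrightarrow> norm (V1 \<omega>) \<le> B"
    and q: "\<And>x. AE \<omega> in P. real_cond_exp P G (indicat_real {\<omega>. X1 \<omega> = x}) \<omega> = q \<omega> x"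
    and qG: "\<And>x. (\<lambda>\<omega>. q \<omega> x) \<in> borel_measurable G"
    and gG: "\<And>x. (\<lambda>\<omega>. g \<omega> x) \<in> borel_measurable G"
    and g: "\<And>x. AE \<omega> in P. q \<omega> x \<noteq> 0 \<longrightarrow>
        g \<omega> x = vec_cond_exp P G (\<lambda>\<omega>. indicat_real {\<omega>. X1 \<omega> = x} \<omega> *\<^sub>R V1 \<omega>) \<omega> /\<^sub>R q \<omega> x"
    and ZG: "Z \<in> borel_measurable G" and Zb: "\<And>\<omega>. \<omega> \<in> space P \<Longrightarrow> \<bar>Z \<omega>\<bar> \<le> L"
    and b: "b \<in> Basis"
  shows "integrable P (\<lambda>\<omega>. Z \<omega> * (V1 \<omega> \<bullet> b))"
    "integrable P (\<lambda>\<omega>. \<Sum>x\<in>UNIV. Z \<omega> * (q \<omega> x * (g \<omega> x \<bullet> b)))"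
    "(\<integral>\<omega>. Z \<omega> * (V1 \<omega> \<bullet> b) \<partial>P) = (\<integral>\<omega>. (\<Sum>x\<in>UNIV. Z \<omega> * (q \<omega> x * (g \<omega> x \<bullet> b))) \<partial>P)"
proof -
  interpret prob_space P by fact
  interpret finite_measure_subalgebra P G by unfold_locales (rule sub)
  note X1 [measurable] V1 [measurable]
  have ZP [measurable]: "Z \<in> borel_measurable P" by (rule measurable_from_subalg[OF sub ZG])
  have qP [measurable]: "(\<lambda>\<omega>. q \<omega> x) \<in> borel_measurable P" for x by (rule measurable_from_subalg[OF sub qG])
  have gP [measurable]: "(\<lambda>\<omega>. g \<omega> x) \<in> borel_measurable P" for x by (rule measurable_from_subalg[OF sub gG])
  have iP [measurable]: "indicat_real {\<omega>. X1 \<omega> = x} \<in> borel_measurable P" for x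
    unfolding indicator_def by measurable
  let ?I = "\<lambda>x. indicat_real {\<omega>. X1 \<omega> = x}"
  let ?W = "\<lambda>x \<omega>. (?I x \<omega> *\<^sub>R V1 \<omega>) \<bullet> b"
  have WP [measurable]: "?W x \<in> borel_measurable P" for x by measurable
  have B0: "0 \<le> B" using Vb not_empty by (meson ex_in_conv norm_ge_zero order_trans)
  have L0: "0 \<le> L" using Zb not_empty by (meson abs_ge_zero ex_in_conv order_trans)
  have Vbb: "\<bar>V1 \<omega> \<bullet> b\<bar> \<le> B" if "\<omega> \<in> space P" for \<omega>
    using Vb[OF that] Basis_le_norm[OF b, of "V1 \<omega>"] by linarith
  have Wb: "\<bar>?W x \<omega>\<bar> \<le> B * ?I x \<omega>" if "\<omega> \<in> space P" for x \<omega>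
    using Vbb[OF that] by (auto simp: indicator_def)
  have Wlo: "- B * ?I x \<omega> \<le> ?W x \<omega>" if "\<omega> \<in> space P" for x \<omega>
    using Wb[OF that, of x] by linarith
  have intW: "integrable P (?W x)" for x
    by (rule integrable_const_bound[of _ B]) (use Vbb B0 in \<open>auto simp: indicator_def\<close>)
  have intI: "integrable P (?I x)" for x
    by (rule integrable_const_bound[of _ 1]) (auto simp: indicator_def)
  have intBI: "integrable P (\<lambda>\<omega>. c * ?I x \<omega>)" for x c using intI by simp
  have ce: "AE \<omega> in P. real_cond_exp P G (?W x) \<omega> = q \<omega> x * (g \<omega> x \<bullet> b)" for x
  proof -
    have up: "AE \<omega> in P. real_cond_exp P G (?W x) \<omega> \<le> real_cond_exp P G (\<lambda>\<omega>. B * ?I x \<omega>) \<omega>"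
      by (rule real_cond_exp_mono[OF _ intW intBI]) (use Wb in \<open>auto simp: abs_le_iff\<close>)
    have lo: "AE \<omega> in P. real_cond_exp P G (\<lambda>\<omega>. (- B) * ?I x \<omega>) \<omega> \<le> real_cond_exp P G (?W x) \<omega>"
      by (rule real_cond_exp_mono[OF _ intBI intW]) (use Wlo in auto)
    show ?thesis
      using up lo real_cond_exp_cmult[OF intI, of B x] real_cond_exp_cmult[OF intI, of "- B" x] q[of x] g[of x]
    proof eventually_elim
      case (elim \<omega>)
      show ?case
      proof (cases "q \<omega> x = 0")
        case True
        then show ?thesis using elim by simp
      next
        case False
        have "vec_cond_exp P G (\<lambda>\<omega>. ?I x \<omega> *\<^sub>R V1 \<omega>) \<omega> \<bullet> b = real_cond_exp P G (?W x) \<omega>"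
          unfolding vec_cond_exp_def using b by (rule inner_sum_left_Basis)
        then show ?thesis using elim(6) False by simp
      qed
    qed
  qed
  have intZW: "integrable P (\<lambda>\<omega>. Z \<omega> * ?W x \<omega>)" for x
    by (rule integrable_const_bound[of _ "L * B"])
      (use Vbb Zb B0 L0 in \<open>auto simp: indicator_def abs_mult intro!: mult_mono\<close>)
  have step: "integrable P (\<lambda>\<omega>. Z \<omega> * (q \<omega> x * (g \<omega> x \<bullet> b))) \<and>
      (\<integral>\<omega>. Z \<omega> * ?W x \<omega> \<partial>P) = (\<integral>\<omega>. Z \<omega> * (q \<omega> x * (g \<omega> x \<bullet> b)) \<partial>P)" for x
  proof -
    have ae: "AE \<omega> in P. Z \<omega> * real_cond_exp P G (?W x) \<omega> = Z \<omega> * (q \<omega> x * (g \<omega> x \<bullet> b))"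
      using ce[of x] by eventually_elim simp
    note r = real_cond_exp_intg[OF intZW[of x] ZG WP]
    have "integrable P (\<lambda>\<omega>. Z \<omega> * (q \<omega> x * (g \<omega> x \<bullet> b)))"
      using integrable_cong_AE_imp[OF r(1) _ ae] by simp
    moreover have "(\<integral>\<omega>. Z \<omega> * real_cond_exp P G (?W x) \<omega> \<partial>P) = (\<integral>\<omega>. Z \<omega> * (q \<omega> x * (g \<omega> x \<bullet> b)) \<partial>P)"
      by (rule integral_cong_AE[OF _ _ ae]) (use r(1) in \<open>auto\<close>)
    ultimately show ?thesis using r(2) by simp
  qed
  have dec: "Z \<omega> * (V1 \<omega> \<bullet> b) = (\<Sum>x\<in>UNIV. Z \<omega> * ?W x \<omega>)" for \<omega>
  proof -
    have "(\<Sum>x\<in>UNIV. Z \<omega> * ?W x \<omega>) = (\<Sum>x\<in>UNIV. if X1 \<omega> = x then Z \<omega> * (V1 \<omega> \<bullet> b) else 0)"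
      by (rule sum.cong) (auto simp: indicator_def)
    then show ?thesis by simp
  qed
  show "integrable P (\<lambda>\<omega>. Z \<omega> * (V1 \<omega> \<bullet> b))" unfolding dec by (intro Bochner_Integration.integrable_sum intZW)
  show "integrable P (\<lambda>\<omega>. \<Sum>x\<in>UNIV. Z \<omega> * (q \<omega> x * (g \<omega> x \<bullet> b)))" using step by (intro Bochner_Integration.integrable_sum) blast
  show "(\<integral>\<omega>. Z \<omega> * (V1 \<omega> \<bullet> b) \<partial>P) = (\<integral>\<omega>. (\<Sum>x\<in>UNIV. Z \<omega> * (q \<omega> x * (g \<omega> x \<bullet> b))) \<partial>P)"
  proof -
    have "(\<integral>\<omega>. Z \<omega> * (V1 \<omega> \<bullet> b) \<partial>P) = (\<Sum>x\<in>UNIV. \<integral>\<omega>. Z \<omega> * ?W x \<omega> \<partial>P)"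
      unfolding dec by (rule Bochner_Integration.integral_sum) (rule intZW)
    also have "\<dots> = (\<Sum>x\<in>UNIV. \<integral>\<omega>. Z \<omega> * (q \<omega> x * (g \<omega> x \<bullet> b)) \<partial>P)" using step by simp
    also have "\<dots> = (\<integral>\<omega>. (\<Sum>x\<in>UNIV. Z \<omega> * (q \<omega> x * (g \<omega> x \<bullet> b))) \<partial>P)"
      by (rule Bochner_Integration.integral_sum[symmetric]) (use step in blast)
    finally show ?thesis .
  qed
qed

text \<open>
  The equation for \<open>c\<close> says that \<open>c\<close> is the conditional mean of \<open>V1 + h (X1)\<close>.
\<close>

lemma poisson_increment_orthogonal:
  fixes X1 :: "'w \<Rightarrow> 'e::finite" and q :: "'w \<Rightarrow> 'e \<Rightarrow> real" and V1 c :: "'w \<Rightarrow> 'v::euclidean_space"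
  assumes P: "prob_space P" and sub: "subalgebra P G"
    and X1: "X1 \<in> measurable P (count_space UNIV)" and V1: "V1 \<in> borel_measurable P"
    and Vb: "\<And>\<omega>. \<omega> \<in> space P \<Longrightarrow> norm (V1 \<omega>) \<le> B"
    and q: "\<And>x. AE \<omega> in P. real_cond_exp P G (indicat_real {\<omega>. X1 \<omega> = x}) \<omega> = q \<omega> x"
    and qG: "\<And>x. (\<lambda>\<omega>. q \<omega> x) \<in> borel_measurable G"
    and gG: "\<And>x. (\<lambda>\<omega>. g \<omega> x) \<in> borel_measurable G"
    and g: "\<And>x. AE \<omega> in P. q \<omega> x \<noteq> 0 \<longrightarrow>
        g \<omega> x = vec_cond_exp P G (\<lambda>\<omega>. indicat_real {\<omega>. X1 \<omega> = x} \<omega> *\<^sub>R V1 \<omega>) \<omega> /\<^sub>R q \<omega> x"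
    and hG: "\<And>x. (\<lambda>\<omega>. h \<omega> x) \<in> borel_measurable G" and cG: "c \<in> borel_measurable G"
    and poisson: "\<And>\<omega>. \<omega> \<in> space P \<Longrightarrow> c \<omega> = (\<Sum>x\<in>UNIV. q \<omega> x *\<^sub>R g \<omega> x) + (\<Sum>x\<in>UNIV. q \<omega> x *\<^sub>R h \<omega> x)"
    and ZG: "Z \<in> borel_measurable G" and Zb: "\<And>\<omega>. \<omega> \<in> space P \<Longrightarrow> \<bar>Z \<omega>\<bar> \<le> L"
    and Zh: "\<And>\<omega> x. \<omega> \<in> space P \<Longrightarrow> \<bar>Z \<omega>\<bar> * norm (h \<omega> x) \<le> L"
    and Zc: "\<And>\<omega>. \<omega> \<in> space P \<Longrightarrow> \<bar>Z \<omega>\<bar> * norm (c \<omega>) \<le> L"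
    and b: "b \<in> Basis"
  shows "(\<integral>\<omega>. Z \<omega> * ((V1 \<omega> + h \<omega> (X1 \<omega>) - c \<omega>) \<bullet> b) \<partial>P) = 0"
proof -
  interpret prob_space P by fact
  have cP [measurable]: "c \<in> borel_measurable P" by (rule measurable_from_subalg[OF sub cG])
  have ZP [measurable]: "Z \<in> borel_measurable P" by (rule measurable_from_subalg[OF sub ZG])
  have bb: "\<bar>Z \<omega> * (u \<bullet> b)\<bar> \<le> L" if "\<bar>Z \<omega>\<bar> * norm u \<le> L" for u :: 'v and \<omega>
    using mult_left_mono[OF Basis_le_norm[OF b, of u], of "\<bar>Z \<omega>\<bar>"] that by (simp add: abs_mult)
  note r = integral_reward[OF P sub X1 V1 Vb q qG gG g ZG Zb b]
  have t: "integrable P (\<lambda>\<omega>. Z \<omega> * (h \<omega> (X1 \<omega>) \<bullet> b))"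
    "integrable P (\<lambda>\<omega>. \<Sum>x\<in>UNIV. q \<omega> x * (Z \<omega> * (h \<omega> x \<bullet> b)))"
    "(\<integral>\<omega>. Z \<omega> * (h \<omega> (X1 \<omega>) \<bullet> b) \<partial>P) = (\<integral>\<omega>. (\<Sum>x\<in>UNIV. q \<omega> x * (Z \<omega> * (h \<omega> x \<bullet> b))) \<partial>P)"
    using integral_transition[OF P sub X1 q qG, of "\<lambda>\<omega> x. Z \<omega> * (h \<omega> x \<bullet> b)" L]
      borel_measurable_times[OF ZG borel_measurable_inner[OF hG borel_measurable_const]] bb[OF Zh] by blast+
  have intc: "integrable P (\<lambda>\<omega>. Z \<omega> * (c \<omega> \<bullet> b))"
    by (rule integrable_const_bound[of _ L]) (use bb[OF Zc] in auto)
  have "(\<integral>\<omega>. Z \<omega> * ((V1 \<omega> + h \<omega> (X1 \<omega>) - c \<omega>) \<bullet> b) \<partial>P)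
      = (\<integral>\<omega>. Z \<omega> * (V1 \<omega> \<bullet> b) + Z \<omega> * (h \<omega> (X1 \<omega>) \<bullet> b) - Z \<omega> * (c \<omega> \<bullet> b) \<partial>P)"
    by (simp add: inner_add_left inner_diff_left algebra_simps)
  also have "\<dots> = (\<integral>\<omega>. Z \<omega> * (V1 \<omega> \<bullet> b) \<partial>P) + (\<integral>\<omega>. Z \<omega> * (h \<omega> (X1 \<omega>) \<bullet> b) \<partial>P) - (\<integral>\<omega>. Z \<omega> * (c \<omega> \<bullet> b) \<partial>P)"
    using r(1) t(1) intc by simp
  also have "\<dots> = (\<integral>\<omega>. (\<Sum>x\<in>UNIV. Z \<omega> * (q \<omega> x * (g \<omega> x \<bullet> b))) + (\<Sum>x\<in>UNIV. q \<omega> x * (Z \<omega> * (h \<omega> x \<bullet> b))) - Z \<omega> * (c \<omega> \<bullet> b) \<partial>P)"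
    using r(2,3) t(2,3) intc by (subst Bochner_Integration.integral_diff Bochner_Integration.integral_add; simp)+
  also have "\<dots> = (\<integral>\<omega>. 0 \<partial>P)"
  proof (rule Bochner_Integration.integral_cong[OF refl])
    fix \<omega> assume "\<omega> \<in> space P"
    from poisson[OF this] show "(\<Sum>x\<in>UNIV. Z \<omega> * (q \<omega> x * (g \<omega> x \<bullet> b))) + (\<Sum>x\<in>UNIV. q \<omega> x * (Z \<omega> * (h \<omega> x \<bullet> b))) - Z \<omega> * (c \<omega> \<bullet> b) = 0"
      by (simp add: inner_add_left inner_sum_left sum_distrib_left algebra_simps)
  qed
  finally show ?thesis by simp
qed

section \<open>Convergence of the averages\<close>

text \<open>
  The complement of the support is a union of open null sets, and by second countability countably many
  of them suffice.
\<close>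

lemma AE_in_topological_support:
  fixes Z :: "'w \<Rightarrow> 'a::second_countable_topology"
  assumes Z: "Z \<in> borel_measurable P"
  shows "AE \<omega> in P. Z \<omega> \<in> topological_support (distr P borel Z)"
proof -
  define \<U> where "\<U> = uminus ` {K. closed K \<and> (AE z in distr P borel Z. z \<in> K)}"
  have op: "openin (top_of_set UNIV) U" if "U \<in> \<U>" for U using that by (auto simp: \<U>_def)
  obtain \<V> where V: "\<V> \<subseteq> \<U>" "countable \<V>" "\<Union>\<V> = \<Union>\<U>"
    using Lindelof_openin[of \<U> UNIV, OF op] by blast
  have "AE \<omega> in P. Z \<omega> \<notin> U" if U: "U \<in> \<V>" for U
  proof -
    obtain K where K: "closed K" "AE z in distr P borel Z. z \<in> K" "U = - K"
      using U V(1) by (auto simp: \<U>_def)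
    have "AE \<omega> in P. Z \<omega> \<in> K" by (rule AE_distrD[OF Z K(2)])
    then show ?thesis by (simp add: K(3))
  qed
  then have "AE \<omega> in P. \<forall>U\<in>\<V>. Z \<omega> \<notin> U" using V(2) by (simp add: AE_ball_countable)
  then show ?thesis
  proof eventually_elim
    case (elim \<omega>)
    then have "Z \<omega> \<notin> \<Union>\<U>" using V(3) by auto
    then show ?case by (auto simp: topological_support_def \<U>_def)
  qed
qed

lemma averages_tendsto_zero:
  fixes X :: "nat \<Rightarrow> real"
  assumes X: "X \<longlonglongrightarrow> 0"
  shows "(\<lambda>n. (\<Sum>j<n. X j) / real n) \<longlonglongrightarrow> 0"
proof (rule LIMSEQ_I)
  fix e :: real assume e: "e > 0"
  obtain N where N: "\<And>n. n \<ge> N \<Longrightarrow> \<bar>X n\<bar> < e / 2" using LIMSEQ_D[OF X, of "e / 2"] e by auto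
  define B where "B = (\<Sum>j<N. \<bar>X j\<bar>)"
  obtain N' :: nat where N': "2 * B / e < real N'" using reals_Archimedean2 by blast
  have "norm ((\<Sum>j<n. X j) / real n - 0) < e" if n: "n \<ge> max (N + 1) N'" for n
  proof -
    have n0: "real n > 0" using n by simp
    have "\<bar>\<Sum>j<n. X j\<bar> \<le> (\<Sum>j<n. \<bar>X j\<bar>)" by (rule sum_abs)
    also have "\<dots> = B + (\<Sum>j\<in>{N..<n}. \<bar>X j\<bar>)"
    proof -
      have "{..<n} = {..<N} \<union> {N..<n}" using n by auto
      then have "(\<Sum>j<n. \<bar>X j\<bar>) = (\<Sum>j\<in>{..<N} \<union> {N..<n}. \<bar>X j\<bar>)" by simp
      also have "\<dots> = B + (\<Sum>j\<in>{N..<n}. \<bar>X j\<bar>)"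
        unfolding B_def by (rule sum.union_disjoint) auto
      finally show ?thesis .
    qed
    also have "(\<Sum>j\<in>{N..<n}. \<bar>X j\<bar>) \<le> (\<Sum>j\<in>{N..<n}. e / 2)"
      using N by (intro sum_mono less_imp_le) auto
    also have "\<dots> \<le> real n * (e / 2)" using e by (simp add: mult_right_mono)
    finally have "\<bar>\<Sum>j<n. X j\<bar> \<le> B + real n * (e / 2)" by simp
    moreover have "B < real n * (e / 2)"
    proof -
      have "2 * B / e < real n" using N' n by simp
      then show ?thesis using e by (simp add: field_simps)
    qed
    ultimately have "\<bar>\<Sum>j<n. X j\<bar> < e * real n" by (simp add: algebra_simps)
    then show ?thesis using n0 by (simp add: divide_less_eq)
  qed
  then show "\<exists>no. \<forall>n\<ge>no. norm ((\<Sum>j<n. X j) / real n - 0) < e" by blast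
qed

locale adapted_markov_rewards =
  fixes P :: "'w measure"
    and F :: "nat \<Rightarrow> 'w measure"
    and S :: "'v::euclidean_space set"
    and X :: "nat \<Rightarrow> 'w \<Rightarrow> 'e::finite"
    and M :: "nat \<Rightarrow> 'w \<Rightarrow> real^'e^'e"
    and V :: "nat \<Rightarrow> 'w \<Rightarrow> 'v"
    and Vhat :: "nat \<Rightarrow> 'w \<Rightarrow> 'e \<Rightarrow> 'v"
  assumes compact_S: "compact S"
    and P: "prob_space P"
    and filt: "filtration (space P) F" and sub: "\<And>n. subalgebra P (F n)"
    and X_meas: "\<And>n. X n \<in> measurable (F n) (count_space UNIV)"
    and M_meas: "\<And>n. M n \<in> borel_measurable (F n)"
    and V_meas: "\<And>n. V n \<in> borel_measurable (F n)"
    and M_markov: "\<And>n \<omega>. \<omega> \<in> space P \<Longrightarrow> markov_matrix (M n \<omega>)"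
    and V_S: "\<And>n \<omega>. \<omega> \<in> space P \<Longrightarrow> V n \<omega> \<in> S"
    and transition: "\<And>n y. AE \<omega> in P.
           real_cond_exp P (F n) (indicat_real {\<omega>. X (Suc n) \<omega> = y}) \<omega> = M n \<omega> $ X n \<omega> $ y"
    and Vhat_meas: "\<And>n x. (\<lambda>\<omega>. Vhat n \<omega> x) \<in> borel_measurable (F n)"
    and Vhat_S: "\<And>n \<omega> x. \<omega> \<in> space P \<Longrightarrow> Vhat n \<omega> x \<in> S"
    and Vhat: "\<And>n x. AE \<omega> in P. M n \<omega> $ X n \<omega> $ x \<noteq> 0 \<longrightarrow>
           Vhat n \<omega> x =
             vec_cond_exp P (F n)
               (\<lambda>\<omega>. indicat_real {\<omega>. X (Suc n) \<omega> = x} \<omega> *\<^sub>R V (Suc n) \<omega>) \<omega>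
             /\<^sub>R (M n \<omega> $ X n \<omega> $ x)"
    and M_indec: "\<And>n \<omega>. \<omega> \<in> space P \<Longrightarrow> indecomposable (M n \<omega>)"
    and Q_growth: "AE \<omega> in P. (\<lambda>n. (mat_norm (pseudo_inverse (M n \<omega>)))\<^sup>2 * ln (real n) / real n) \<longlonglongrightarrow> 0"
    and Q_var: "AE \<omega> in P. (\<lambda>n. mat_norm (pseudo_inverse (M (Suc n) \<omega>) - pseudo_inverse (M n \<omega>))) \<longlonglongrightarrow> 0"
    and p_var: "AE \<omega> in P. (\<lambda>n. fun_norm (\<lambda>x. invariant_prob (M (Suc n) \<omega>) $ x - invariant_prob (M n \<omega>) $ x)) \<longlonglongrightarrow> 0"
    and Vhat_var: "AE \<omega> in P. (\<lambda>n. fun_norm (mat_act (M (Suc n) \<omega> ** pseudo_inverse (M (Suc n) \<omega>))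
           (\<lambda>x. Vhat (Suc n) \<omega> x - Vhat n \<omega> x))) \<longlonglongrightarrow> 0"
begin

sublocale prob_space P by (rule P)

definition Q_size :: "nat \<Rightarrow> 'w \<Rightarrow> real" where "Q_size n \<omega> = mat_norm (pseudo_inverse (M n \<omega>))"

definition correction :: "nat \<Rightarrow> 'w \<Rightarrow> 'e \<Rightarrow> 'v" where "correction n \<omega> = corrector (M n \<omega>) (Vhat n \<omega>)"

abbreviation \<theta> :: "nat \<Rightarrow> 'w \<Rightarrow> 'v" where "\<theta> \<equiv> mean_drift M Vhat"

definition S_bound :: real where "S_bound = (SOME b. 0 \<le> b \<and> (\<forall>x\<in>S. norm x \<le> b))"

lemma S_bound: "0 \<le> S_bound" "x \<in> S \<Longrightarrow> norm x \<le> S_bound"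
proof -
  obtain b where b: "\<forall>x\<in>S. norm x \<le> b" using compact_imp_bounded[OF compact_S] by (auto simp: bounded_iff)
  have "0 \<le> max 0 b \<and> (\<forall>x\<in>S. norm x \<le> max 0 b)" using b by force
  then have "0 \<le> S_bound \<and> (\<forall>x\<in>S. norm x \<le> S_bound)" unfolding S_bound_def by (rule someI)
  then show "0 \<le> S_bound" "x \<in> S \<Longrightarrow> norm x \<le> S_bound" by auto
qed

lemma space_F: "space (F n) = space P" using sub by (simp add: subalgebra_def)

lemma sets_F_mono: "i \<le> j \<Longrightarrow> sets (F i) \<subseteq> sets (F j)"
  using filtration.sets_F_mono[OF filt] by auto

lemma sub_F: "i \<le> j \<Longrightarrow> subalgebra (F j) (F i)"
  by (simp add: subalgebra_def space_F sets_F_mono)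

lemma M_entry_meas: "(\<lambda>\<omega>. M n \<omega> $ x $ y) \<in> borel_measurable (F n)"
  by (rule measurable_compose[OF M_meas borel_measurable_continuous_onI]) (intro continuous_intros)

lemma M_row_meas: "(\<lambda>\<omega>. M n \<omega> $ X n \<omega> $ y) \<in> borel_measurable (F n)"
  by (rule measurable_compose_countable[OF M_entry_meas X_meas])

lemma Q_entry_meas: "(\<lambda>\<omega>. pseudo_inverse (M n \<omega>) $ x $ y) \<in> borel_measurable (F n)"
  by (rule borel_measurable_pseudo_inverse) (auto simp: space_F intro: M_entry_meas M_markov M_indec)

lemma pi_entry_meas: "(\<lambda>\<omega>. invariant_prob (M n \<omega>) $ x) \<in> borel_measurable (F n)"
  by (rule borel_measurable_invariant_prob) (auto simp: space_F intro: M_entry_meas M_markov M_indec)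

lemma Q_size_meas: "Q_size n \<in> borel_measurable (F n)"
proof -
  have "(\<lambda>\<omega>. Max ((\<lambda>(x, y). \<bar>pseudo_inverse (M n \<omega>) $ x $ y\<bar>) ` UNIV)) \<in> borel_measurable (F n)"
    by (intro borel_measurable_Max) (auto intro: borel_measurable_abs Q_entry_meas)
  then show ?thesis by (simp add: Q_size_def[abs_def] mat_norm_def)
qed

lemma correction_meas: "(\<lambda>\<omega>. correction n \<omega> x) \<in> borel_measurable (F n)"
  unfolding correction_def mat_act_def matrix_matrix_mult_def vec_lambda_beta
  by (intro borel_measurable_sum borel_measurable_scaleR borel_measurable_times M_entry_meas Q_entry_meas Vhat_meas)

lemma theta_meas: "\<theta> n \<in> borel_measurable (F n)"
  unfolding mean_drift_def prob_act_def
  by (intro borel_measurable_sum borel_measurable_scaleR pi_entry_meas Vhat_meas)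

lemma correction_current_meas: "(\<lambda>\<omega>. correction n \<omega> (X n \<omega>)) \<in> borel_measurable (F n)"
  by (rule measurable_compose_countable[OF correction_meas X_meas])

lemma correction_next_meas: "(\<lambda>\<omega>. correction n \<omega> (X (Suc n) \<omega>)) \<in> borel_measurable (F (Suc n))"
  by (rule measurable_compose_countable[OF measurable_from_subalg[OF sub_F correction_meas] X_meas]) simp

lemma norm_correction: "\<omega> \<in> space P \<Longrightarrow> norm (correction n \<omega> x) \<le> real CARD('e) * Q_size n \<omega> * S_bound"
  unfolding correction_def Q_size_def by (intro norm_corrector_le M_markov S_bound Vhat_S)

lemma theta_S: "convex S \<Longrightarrow> \<omega> \<in> space P \<Longrightarrow> \<theta> n \<omega> \<in> S"
  unfolding mean_drift_def prob_act_def
  by (intro convex_sum) (auto intro!: invariant_prob_props M_markov M_indec Vhat_S)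

lemma norm_theta: "\<omega> \<in> space P \<Longrightarrow> norm (\<theta> n \<omega>) \<le> S_bound"
proof -
  assume \<omega>: "\<omega> \<in> space P"
  note p = invariant_prob_props[OF M_markov[OF \<omega>, of n] M_indec[OF \<omega>, of n]]
  have "norm (\<theta> n \<omega>) \<le> (\<Sum>x\<in>UNIV. norm (invariant_prob (M n \<omega>) $ x *\<^sub>R Vhat n \<omega> x))"
    unfolding mean_drift_def prob_act_def by (rule norm_sum)
  also have "\<dots> \<le> (\<Sum>x\<in>UNIV. invariant_prob (M n \<omega>) $ x * S_bound)"
    using S_bound(2)[OF Vhat_S[OF \<omega>]] p(1) by (intro sum_mono) (auto intro: mult_left_mono)
  also have "\<dots> = S_bound" using p(2) by (simp add: sum_distrib_right[symmetric])
  finally show ?thesis .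
qed

text \<open>
  The martingale part of \<open>V (n + 1) - \<theta> n\<close>.
\<close>

definition noise :: "nat \<Rightarrow> 'w \<Rightarrow> 'v" where
  "noise n \<omega> = V (Suc n) \<omega> + correction n \<omega> (X (Suc n) \<omega>) - (\<theta> n \<omega> + correction n \<omega> (X n \<omega>))"

definition noise_bound :: "nat \<Rightarrow> 'w \<Rightarrow> real" where "noise_bound n \<omega> = 2 * S_bound + 2 * (real CARD('e) * S_bound) * Q_size n \<omega>"

lemma noise_orthogonal:
  assumes Z: "Z \<in> borel_measurable (F n)" "\<And>\<omega>. \<omega> \<in> space P \<Longrightarrow> \<bar>Z \<omega>\<bar> \<le> K"
    "\<And>\<omega>. \<omega> \<in> space P \<Longrightarrow> \<bar>Z \<omega>\<bar> * noise_bound n \<omega> \<le> K" and b: "b \<in> Basis"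
  shows "(\<integral>\<omega>. Z \<omega> * (noise n \<omega> \<bullet> b) \<partial>P) = 0"
  unfolding noise_def
proof (rule poisson_increment_orthogonal[where G="F n" and B=S_bound and L=K and q="\<lambda>\<omega> x. M n \<omega> $ X n \<omega> $ x" and g="Vhat n"])
  show "X (Suc n) \<in> measurable P (count_space UNIV)" by (rule measurable_from_subalg[OF sub X_meas])
  show "V (Suc n) \<in> borel_measurable P" by (rule measurable_from_subalg[OF sub V_meas])
  show "(\<lambda>\<omega>. \<theta> n \<omega> + correction n \<omega> (X n \<omega>)) \<in> borel_measurable (F n)"
    by (intro borel_measurable_add theta_meas correction_current_meas)
  fix \<omega> assume \<omega>: "\<omega> \<in> space P"
  show "norm (V (Suc n) \<omega>) \<le> S_bound" by (intro S_bound V_S \<omega>)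
  have "mat_act (M n \<omega>) (correction n \<omega>) (X n \<omega>) - correction n \<omega> (X n \<omega>) = \<theta> n \<omega> - mat_act (M n \<omega>) (Vhat n \<omega>) (X n \<omega>)"
    unfolding correction_def mean_drift_def by (rule poisson_equation[OF M_markov[OF \<omega>] M_indec[OF \<omega>]])
  then show "\<theta> n \<omega> + correction n \<omega> (X n \<omega>) = (\<Sum>x\<in>UNIV. M n \<omega> $ X n \<omega> $ x *\<^sub>R Vhat n \<omega> x) + (\<Sum>x\<in>UNIV. M n \<omega> $ X n \<omega> $ x *\<^sub>R correction n \<omega> x)"
    by (simp add: mat_act_def algebra_simps)
  have q0: "0 \<le> real CARD('e) * Q_size n \<omega> * S_bound" using S_bound(1) by (simp add: Q_size_def mat_norm_nonneg)
  have hA: "norm (correction n \<omega> x) \<le> noise_bound n \<omega>" for x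
    using norm_correction[OF \<omega>, of n x] q0 S_bound(1) by (simp add: noise_bound_def algebra_simps)
  show "\<bar>Z \<omega>\<bar> * norm (correction n \<omega> x) \<le> K" for x
    using mult_left_mono[OF hA, of "\<bar>Z \<omega>\<bar>"] Z(3)[OF \<omega>] by (meson abs_ge_zero order_trans)
  have "norm (\<theta> n \<omega> + correction n \<omega> (X n \<omega>)) \<le> noise_bound n \<omega>"
    using norm_triangle_ineq[of "\<theta> n \<omega>" "correction n \<omega> (X n \<omega>)"] norm_theta[OF \<omega>, of n] norm_correction[OF \<omega>, of n "X n \<omega>"] q0 S_bound(1)
    by (simp add: noise_bound_def algebra_simps)
  then show "\<bar>Z \<omega>\<bar> * norm (\<theta> n \<omega> + correction n \<omega> (X n \<omega>)) \<le> K"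
    using mult_left_mono[of _ "noise_bound n \<omega>" "\<bar>Z \<omega>\<bar>"] Z(3)[OF \<omega>] by (meson abs_ge_zero order_trans)
qed (use P sub transition Vhat M_row_meas Vhat_meas correction_meas Z b in blast)+

lemma norm_noise: "\<omega> \<in> space P \<Longrightarrow> norm (noise n \<omega>) \<le> noise_bound n \<omega>"
proof -
  assume \<omega>: "\<omega> \<in> space P"
  have "norm (noise n \<omega>) \<le> norm (V (Suc n) \<omega>) + norm (correction n \<omega> (X (Suc n) \<omega>)) + (norm (\<theta> n \<omega>) + norm (correction n \<omega> (X n \<omega>)))"
    unfolding noise_def by (intro order_trans[OF norm_triangle_ineq4] add_mono norm_triangle_ineq)
  then show ?thesis
    using S_bound(2)[OF V_S[OF \<omega>, of "Suc n"]] norm_correction[OF \<omega>, of n "X (Suc n) \<omega>"] norm_correction[OF \<omega>, of n "X n \<omega>"] norm_theta[OF \<omega>, of n]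
    by (simp add: noise_bound_def algebra_simps)
qed

text \<open>
  The square of a sum is at most twice the sum of the squares, and \<open>ln n / n\<close> tends to \<open>0\<close>.
\<close>

lemma noise_bound_growth: "AE \<omega> in P. (\<lambda>n. (noise_bound n \<omega>)\<^sup>2 * ln (real n) / real n) \<longlonglongrightarrow> 0"
  using Q_growth
proof eventually_elim
  case (elim \<omega>)
  let ?r = "\<lambda>n. 2 * (2 * S_bound)\<^sup>2 * (ln (real n) / real n) + 2 * (2 * (real CARD('e) * S_bound))\<^sup>2 * ((Q_size n \<omega>)\<^sup>2 * ln (real n) / real n)"
  have l: "(\<lambda>n. ln (real n) / real n) \<longlonglongrightarrow> 0" by real_asymp
  have "?r \<longlonglongrightarrow> 2 * (2 * S_bound)\<^sup>2 * 0 + 2 * (2 * (real CARD('e) * S_bound))\<^sup>2 * 0"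
    using elim by (intro tendsto_intros l) (simp add: Q_size_def)
  then have r: "?r \<longlonglongrightarrow> 0" by simp
  have up: "\<forall>\<^sub>F n in sequentially. (noise_bound n \<omega>)\<^sup>2 * ln (real n) / real n \<le> ?r n"
    using eventually_ge_at_top[of 1]
  proof eventually_elim
    case (elim n)
    let ?a = "2 * S_bound" and ?c = "2 * (real CARD('e) * S_bound) * Q_size n \<omega>"
    have "0 \<le> (?a - ?c)\<^sup>2" by simp
    then have "(noise_bound n \<omega>)\<^sup>2 \<le> 2 * ?a\<^sup>2 + 2 * ?c\<^sup>2" by (simp add: noise_bound_def power2_eq_square algebra_simps)
    moreover have "0 \<le> ln (real n) / real n" using elim by simp
    ultimately have "(noise_bound n \<omega>)\<^sup>2 * (ln (real n) / real n) \<le> (2 * ?a\<^sup>2 + 2 * ?c\<^sup>2) * (ln (real n) / real n)"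
      by (rule mult_right_mono)
    also have "\<dots> = ?r n" by (simp add: power_mult_distrib algebra_simps)
    finally show ?case by simp
  qed
  have lo: "\<forall>\<^sub>F n in sequentially. 0 \<le> (noise_bound n \<omega>)\<^sup>2 * ln (real n) / real n"
    using eventually_ge_at_top[of 1] by eventually_elim simp
  show ?case by (rule tendsto_sandwich[OF lo up tendsto_const r])
qed

lemma noise_slln: "AE \<omega> in P. (\<lambda>n. (\<Sum>j<n. noise j \<omega>) /\<^sub>R real n) \<longlonglongrightarrow> 0"
proof -
  have "AE \<omega> in P. (\<lambda>n. (\<Sum>j<n. noise j \<omega> \<bullet> b) / real n) \<longlonglongrightarrow> 0" if b: "b \<in> Basis" for b
  proof (rule martingale_slln[where F=F and A=noise_bound, OF sub sets_F_mono])
    show "(\<lambda>\<omega>. noise j \<omega> \<bullet> b) \<in> borel_measurable (F (Suc j))" for j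
      unfolding noise_def
      by (intro borel_measurable_inner borel_measurable_const borel_measurable_add borel_measurable_diff V_meas correction_next_meas
          measurable_from_subalg[OF sub_F theta_meas] measurable_from_subalg[OF sub_F correction_current_meas]) auto
    show "noise_bound j \<in> borel_measurable (F j)" for j
      unfolding noise_bound_def[abs_def] by (intro borel_measurable_add borel_measurable_times borel_measurable_const Q_size_meas)
    show "\<bar>noise j \<omega> \<bullet> b\<bar> \<le> noise_bound j \<omega>" if "\<omega> \<in> space P" for j \<omega>
      using norm_noise[OF that, of j] Basis_le_norm[OF b, of "noise j \<omega>"] by linarith
    show "(\<integral>\<omega>. Z \<omega> * (noise j \<omega> \<bullet> b) \<partial>P) = 0"
      if "Z \<in> borel_measurable (F j)" "\<And>\<omega>. \<omega> \<in> space P \<Longrightarrow> \<bar>Z \<omega>\<bar> \<le> K"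
        "\<And>\<omega>. \<omega> \<in> space P \<Longrightarrow> \<bar>Z \<omega>\<bar> * noise_bound j \<omega> \<le> K" for j Z K
      by (rule noise_orthogonal[OF that b])
  qed (assumption | rule noise_bound_growth)+
  then have "AE \<omega> in P. \<forall>b\<in>Basis. (\<lambda>n. (\<Sum>j<n. noise j \<omega> \<bullet> b) / real n) \<longlonglongrightarrow> 0"
    by (intro AE_finite_allI) auto
  then show ?thesis
  proof eventually_elim
    case (elim \<omega>)
    have "(\<lambda>n. \<Sum>b\<in>Basis. ((\<Sum>j<n. noise j \<omega> \<bullet> b) / real n) *\<^sub>R b) \<longlonglongrightarrow> (\<Sum>b\<in>Basis. 0 *\<^sub>R b)"
      using elim by (intro tendsto_sum tendsto_scaleR tendsto_const) auto
    moreover have "(\<Sum>b\<in>Basis. ((\<Sum>j<n. noise j \<omega> \<bullet> b) / real n) *\<^sub>R b) = (\<Sum>j<n. noise j \<omega>) /\<^sub>R real n" for n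
    proof -
      have "((\<Sum>j<n. noise j \<omega>) /\<^sub>R real n) \<bullet> b = (\<Sum>j<n. noise j \<omega> \<bullet> b) / real n" for b
        by (simp add: inner_sum_left divide_inverse mult.commute)
      then show ?thesis using euclidean_representation[of "(\<Sum>j<n. noise j \<omega>) /\<^sub>R real n"] by simp
    qed
    ultimately show ?case by simp
  qed
qed

text \<open>
  The sum of \<open>V (j + 1) - \<theta> j\<close> over \<open>j < n\<close> splits into the martingale, the increments of the correction at
  a fixed state, and the two boundary terms of a telescoping sum.  The boundary terms are of order
  \<open>|Q n|\<close>, hence negligible against \<open>n\<close>.
\<close>

lemma mean_error_vanishes:
  "AE \<omega> in P. (\<lambda>n. empirical_mean V n \<omega> - (1 / real n) *\<^sub>R (\<Sum>j<n. \<theta> j \<omega>)) \<longlonglongrightarrow> 0"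
  using noise_slln Q_growth Q_var p_var Vhat_var AE_space
proof eventually_elim
  case (elim \<omega>)
  note slln = elim(1) and growth = elim(2) and Qv = elim(3) and pv = elim(4) and Vv = elim(5) and \<omega> = elim(6)
  define d where "d n = fun_norm (mat_act (M (Suc n) \<omega> ** pseudo_inverse (M (Suc n) \<omega>)) (\<lambda>x. Vhat (Suc n) \<omega> x - Vhat n \<omega> x))
      + real CARD('e) * mat_norm (pseudo_inverse (M (Suc n) \<omega>) - pseudo_inverse (M n \<omega>)) * S_bound
      + real CARD('e) * fun_norm (\<lambda>x. invariant_prob (M (Suc n) \<omega>) $ x - invariant_prob (M n \<omega>) $ x) * S_bound" for n
  have "d \<longlonglongrightarrow> 0 + real CARD('e) * 0 * S_bound + real CARD('e) * 0 * S_bound" unfolding d_def by (intro tendsto_intros Qv pv Vv)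
  then have d0: "d \<longlonglongrightarrow> 0" by simp
  define D where "D n = correction (Suc n) \<omega> (X (Suc n) \<omega>) - correction n \<omega> (X (Suc n) \<omega>)" for n
  have Dd: "norm (D n) \<le> d n" for n
    unfolding D_def d_def correction_def
    by (intro norm_corrector_diff_le M_markov M_indec \<omega> S_bound(2) Vhat_S)
  have D0: "(\<lambda>n. (\<Sum>j<n. D j) /\<^sub>R real n) \<longlonglongrightarrow> 0"
  proof (rule tendsto_norm_zero_cancel, rule tendsto_sandwich[OF _ _ tendsto_const averages_tendsto_zero[OF d0]])
    have "norm ((\<Sum>j<n. D j) /\<^sub>R real n) \<le> (\<Sum>j<n. d j) / real n" for n
    proof -
      have "norm (\<Sum>j<n. D j) \<le> (\<Sum>j<n. d j)" by (intro sum_norm_le Dd)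
      then show ?thesis by (simp add: divide_inverse mult.commute mult_left_mono)
    qed
    then show "\<forall>\<^sub>F n in sequentially. norm ((\<Sum>j<n. D j) /\<^sub>R real n) \<le> (\<Sum>j<n. d j) / real n" by simp
  qed simp
  have q0: "(\<lambda>n. Q_size n \<omega> / real n) \<longlonglongrightarrow> 0"
  proof (rule tendsto_sandwich[OF _ _ tendsto_const])
    have "(\<lambda>n. 1 / real n + (Q_size n \<omega>)\<^sup>2 * ln (real n) / real n) \<longlonglongrightarrow> 0 + 0"
      using growth by (intro tendsto_add lim_1_over_n) (simp add: Q_size_def)
    then show "(\<lambda>n. 1 / real n + (Q_size n \<omega>)\<^sup>2 * ln (real n) / real n) \<longlonglongrightarrow> 0" by simp
    show "\<forall>\<^sub>F n in sequentially. 0 \<le> Q_size n \<omega> / real n" by (simp add: Q_size_def mat_norm_nonneg)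
    show "\<forall>\<^sub>F n in sequentially. Q_size n \<omega> / real n \<le> 1 / real n + (Q_size n \<omega>)\<^sup>2 * ln (real n) / real n"
      using eventually_ge_at_top[of 3]
    proof eventually_elim
      case (elim n)
      have ln1: "1 \<le> ln (real n)"
      proof -
        have "exp 1 \<le> real n" using exp_le elim by linarith
        then show ?thesis using elim by (simp add: ln_ge_iff)
      qed
      have "0 \<le> (Q_size n \<omega> - 1)\<^sup>2" "0 \<le> (Q_size n \<omega>)\<^sup>2" by simp_all
      moreover have "0 \<le> Q_size n \<omega>" by (simp add: Q_size_def mat_norm_nonneg)
      ultimately have "Q_size n \<omega> \<le> 1 + (Q_size n \<omega>)\<^sup>2" by (simp add: power2_eq_square algebra_simps)
      also have "(Q_size n \<omega>)\<^sup>2 \<le> (Q_size n \<omega>)\<^sup>2 * ln (real n)" using ln1 mult_left_mono[of 1 "ln (real n)" "(Q_size n \<omega>)\<^sup>2"] by simp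
      finally show ?case using elim by (simp add: field_simps)
    qed
  qed
  have hn: "(\<lambda>n. correction n \<omega> (X n \<omega>) /\<^sub>R real n) \<longlonglongrightarrow> 0"
  proof (rule tendsto_norm_zero_cancel, rule tendsto_sandwich[OF _ _ tendsto_const])
    have "(\<lambda>n. real CARD('e) * S_bound * (Q_size n \<omega> / real n)) \<longlonglongrightarrow> real CARD('e) * S_bound * 0" by (intro tendsto_intros q0)
    then show "(\<lambda>n. real CARD('e) * S_bound * (Q_size n \<omega> / real n)) \<longlonglongrightarrow> 0" by simp
    have "norm (correction n \<omega> (X n \<omega>) /\<^sub>R real n) \<le> real CARD('e) * S_bound * (Q_size n \<omega> / real n)" for n
      using mult_right_mono[OF norm_correction[OF \<omega>, of n "X n \<omega>"], of "inverse (real n)"]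
      by (simp add: divide_inverse mult_ac)
    then show "\<forall>\<^sub>F n in sequentially. norm (correction n \<omega> (X n \<omega>) /\<^sub>R real n) \<le> real CARD('e) * S_bound * (Q_size n \<omega> / real n)" by simp
  qed simp
  have h0: "(\<lambda>n. correction 0 \<omega> (X 0 \<omega>) /\<^sub>R real n) \<longlonglongrightarrow> 0"
  proof -
    have "(\<lambda>n. inverse (real n) *\<^sub>R correction 0 \<omega> (X 0 \<omega>)) \<longlonglongrightarrow> 0 *\<^sub>R correction 0 \<omega> (X 0 \<omega>)"
      by (intro tendsto_scaleR tendsto_const lim_inverse_n)
    then show ?thesis by simp
  qed
  have decomp: "(\<Sum>j<n. V (Suc j) \<omega>) - (\<Sum>j<n. \<theta> j \<omega>)
      = (\<Sum>j<n. noise j \<omega>) + (\<Sum>j<n. D j) + correction 0 \<omega> (X 0 \<omega>) - correction n \<omega> (X n \<omega>)" for n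
    by (induction n) (simp_all add: noise_def D_def algebra_simps)
  have eq: "empirical_mean V n \<omega> - (1 / real n) *\<^sub>R (\<Sum>j<n. \<theta> j \<omega>)
      = (\<Sum>j<n. noise j \<omega>) /\<^sub>R real n + (\<Sum>j<n. D j) /\<^sub>R real n + correction 0 \<omega> (X 0 \<omega>) /\<^sub>R real n - correction n \<omega> (X n \<omega>) /\<^sub>R real n" for n
  proof -
    have "(\<Sum>i=1..n. V i \<omega>) = (\<Sum>j<n. V (Suc j) \<omega>)"
      by (rule sum.reindex_bij_witness[of _ Suc "\<lambda>i. i - 1"]) auto
    then have "empirical_mean V n \<omega> - (1 / real n) *\<^sub>R (\<Sum>j<n. \<theta> j \<omega>)
        = inverse (real n) *\<^sub>R ((\<Sum>j<n. V (Suc j) \<omega>) - (\<Sum>j<n. \<theta> j \<omega>))"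
      by (simp add: empirical_mean_def scaleR_diff_right divide_inverse)
    then show ?thesis unfolding decomp by (simp add: scaleR_add_right scaleR_diff_right)
  qed
  have "(\<lambda>n. (\<Sum>j<n. noise j \<omega>) /\<^sub>R real n + (\<Sum>j<n. D j) /\<^sub>R real n + correction 0 \<omega> (X 0 \<omega>) /\<^sub>R real n - correction n \<omega> (X n \<omega>) /\<^sub>R real n)
      \<longlonglongrightarrow> 0 + 0 + 0 - 0"
    by (intro tendsto_add tendsto_diff slln D0 h0 hn)
  then show ?case unfolding eq by simp
qed

theorem limit_set_of_averages_internally_chain_transitive:
  assumes cS: "convex S" and C: "adapted_set P S (\<lambda>n \<omega>. (empirical_mean V n \<omega>, \<theta> n \<omega>)) C"
  shows "AE \<omega> in P. internally_chain_transitive S C (limit_set (\<lambda>n. empirical_mean V n \<omega>))"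
proof -
  let ?v = "empirical_mean V" and ?Z = "\<lambda>n \<omega>. (empirical_mean V n \<omega>, \<theta> n \<omega>)"
  have Zm: "?Z n \<in> borel_measurable P" for n
  proof (intro borel_measurable_Pair)
    show "?v n \<in> borel_measurable P"
      unfolding empirical_mean_def[abs_def]
      by (intro borel_measurable_scaleR borel_measurable_const borel_measurable_sum measurable_from_subalg[OF sub V_meas])
    show "\<theta> n \<in> borel_measurable P" by (rule measurable_from_subalg[OF sub theta_meas])
  qed
  have "AE \<omega> in P. \<forall>n. ?Z n \<omega> \<in> topological_support (distr P borel (?Z n))"
    unfolding AE_all_countable by (intro allI AE_in_topological_support Zm)
  then show ?thesis
    using mean_error_vanishes AE_space
  proof eventually_elim
    case (elim \<omega>)
    note supp = elim(1) and err = elim(2) and \<omega> = elim(3)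
    let ?w = "\<lambda>n. (1 / real n) *\<^sub>R (\<Sum>j<n. \<theta> j \<omega>)"
    interpret averaged_inclusion S C "\<lambda>n. \<theta> n \<omega>" ?w
    proof
      show "compact S" by (rule compact_S)
      show "convex S" by (rule cS)
      show "closed C" using C by (simp add: adapted_set_def)
      show "convex (slice S C u)" if "u \<in> S" for u using C that by (simp add: adapted_set_def)
      show "\<theta> n \<omega> \<in> S" for n by (rule theta_S[OF cS \<omega>])
      show "?w n = ?w n" for n ..
      fix r :: "nat \<Rightarrow> nat" and p assume r: "filterlim r at_top sequentially"
        and lim: "(\<lambda>k. (?w (r k), \<theta> (r k) \<omega>)) \<longlonglongrightarrow> p"
      \<comment> \<open>The supports concern \<open>v\<close>; the vanishing difference transfers the limit from \<open>w\<close> to \<open>v\<close>.\<close>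
      have "(\<lambda>k. (?w (r k), \<theta> (r k) \<omega>) + (?v (r k) \<omega> - ?w (r k), 0)) \<longlonglongrightarrow> p + (0, 0)"
        by (intro tendsto_add lim tendsto_Pair filterlim_compose[OF err r] tendsto_const)
      then have "(\<lambda>k. ?Z (r k) \<omega>) \<longlonglongrightarrow> p" by (simp add: plus_prod_def)
      then have "p \<in> clos_seq (\<lambda>n. topological_support (distr P borel (?Z n)))"
        using r supp unfolding clos_seq_def by (intro CollectI exI[of _ r] exI[of _ "\<lambda>n. ?Z n \<omega>"]) auto
      then show "p \<in> C" using C by (auto simp: adapted_set_def)
    qed
    have "limit_set (\<lambda>n. ?v n \<omega>) = limit_set ?w" by (rule limit_set_cong[OF err])
    then show ?case using limit_set_internally_chain_transitive by simp
  qed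
qed

end

theorem theorem2p6:
  fixes P :: "'w measure"
    and F :: "nat \<Rightarrow> 'w measure"
    and S :: "'v::euclidean_space set"
    and X :: "nat \<Rightarrow> 'w \<Rightarrow> 'e::finite"
    and M :: "nat \<Rightarrow> 'w \<Rightarrow> real^'e^'e"
    and V :: "nat \<Rightarrow> 'w \<Rightarrow> 'v"
    and Vhat :: "nat \<Rightarrow> 'w \<Rightarrow> 'e \<Rightarrow> 'v"
    and C :: "('v \<times> 'v) set"
  defines "Q \<equiv> \<lambda>n \<omega>. pseudo_inverse (M n \<omega>)"
    and "\<pi> \<equiv> \<lambda>n \<omega>. invariant_prob (M n \<omega>)"
    and "v \<equiv> empirical_mean V"
    and "\<theta> \<equiv> mean_drift M Vhat"
  assumes "compact S" and "convex S"
    and "prob_space P"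
    and "filtration (space P) F" and "\<And>n. subalgebra P (F n)"
    \<comment> \<open>the adapted process\<close>
    and "\<And>n. X n \<in> measurable (F n) (count_space UNIV)"
    and "\<And>n. M n \<in> borel_measurable (F n)"
    and "\<And>n. V n \<in> borel_measurable (F n)"
    and "\<And>n \<omega>. \<omega> \<in> space P \<Longrightarrow> markov_matrix (M n \<omega>)"
    and "\<And>n \<omega>. \<omega> \<in> space P \<Longrightarrow> V n \<omega> \<in> S"
    and "\<And>n y. AE \<omega> in P.
           real_cond_exp P (F n) (indicat_real {\<omega>. X (Suc n) \<omega> = y}) \<omega> = M n \<omega> $ X n \<omega> $ y"
    \<comment> \<open>the random maps\<close>
    and "\<And>n x. (\<lambda>\<omega>. Vhat n \<omega> x) \<in> borel_measurable (F n)"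
    and "\<And>n \<omega> x. \<omega> \<in> space P \<Longrightarrow> Vhat n \<omega> x \<in> S"
    and "\<And>n x. AE \<omega> in P. M n \<omega> $ X n \<omega> $ x \<noteq> 0 \<longrightarrow>
           Vhat n \<omega> x =
             vec_cond_exp P (F n)
               (\<lambda>\<omega>. indicat_real {\<omega>. X (Suc n) \<omega> = x} \<omega> *\<^sub>R V (Suc n) \<omega>) \<omega>
             /\<^sub>R (M n \<omega> $ X n \<omega> $ x)"
    \<comment> \<open>assumption (1)\<close>
    and "\<And>n \<omega>. \<omega> \<in> space P \<Longrightarrow> indecomposable (M n \<omega>)"
    and "AE \<omega> in P. (\<lambda>n. (mat_norm (Q n \<omega>))\<^sup>2 * ln (real n) / real n) \<longlonglongrightarrow> 0"
    and "AE \<omega> in P. (\<lambda>n. mat_norm (Q (Suc n) \<omega> - Q n \<omega>)) \<longlonglongrightarrow> 0"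
    and "AE \<omega> in P. (\<lambda>n. fun_norm (\<lambda>x. \<pi> (Suc n) \<omega> $ x - \<pi> n \<omega> $ x)) \<longlonglongrightarrow> 0"
    \<comment> \<open>assumption (2)\<close>
    and "AE \<omega> in P. (\<lambda>n. fun_norm (mat_act (M (Suc n) \<omega> ** Q (Suc n) \<omega>)
           (\<lambda>x. Vhat (Suc n) \<omega> x - Vhat n \<omega> x))) \<longlonglongrightarrow> 0"
    and "C \<subseteq> S \<times> S"
    and "adapted_set P S (\<lambda>n \<omega>. (v n \<omega>, \<theta> n \<omega>)) C"
  shows "AE \<omega> in P. internally_chain_transitive S C (limit_set (\<lambda>n. v n \<omega>))"
proof -
  interpret adapted_markov_rewards P F S X M V Vhat
    unfolding adapted_markov_rewards_def
    using assms(5,7-23) unfolding Q_def \<pi>_def by blast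
  show ?thesis
    using limit_set_of_averages_internally_chain_transitive assms(6,25) unfolding v_def \<theta>_def by blast
qed

end
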